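(* Let $X=T^2\vee S^1$ be the bouquet of a 2-dimensional torus and a circle, with base point $x_0\in X$, and let $X^k=X\times\dots\times X$ be the product of $k$ copies of $X$. For $i=1,\dots,k$ let $p_i:X\to X^k$ be the inclusion $x\mapsto(x_0,\dots,x_0,x,x_0,\dots,x_0)$ with $x$ in the $i$-th place, and let $q_i:T^2\to X^k$ be the composition of the inclusion $T^2\to X$ with $p_i$. Then for any $\xi\in H^1(X^k;\mathbf R)$ one has $$\mathrm{cat}(X^k,\xi)=\mathrm{ccat}(X^k,\xi)=1+a(\xi)+2b(\xi),$$ where $a(\xi)$ denotes the number of indices $i\in\{1,\dots,k\}$ such that $p_i^\ast(\xi)\ne0$ and $q_i^\ast(\xi)=0$, and $b(\xi)$ denotes the number of indices $i\in\{1,\dots,k\}$ such that $p_i^\ast(\xi)=0$.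
   Context: Closed 1-forms. A continuous closed 1-form $\omega$ on a topological space $X$ is given by a family of continuous functions $f_U:U\to\mathbf R$, indexed by the members of an open cover of $X$, such that $f_U-f_V$ is locally constant on $U\cap V$ for all $U,V$; two families define the same closed 1-form if their union is again such a family. For a path $\gamma:[0,1]\to X$ set $\int_\gamma\omega=\sum_i\left(f_{U_i}(\gamma(t_{i+1}))-f_{U_i}(\gamma(t_i))\right)$, where $0=t_0<\dots<t_m=1$ and $\gamma([t_i,t_{i+1}])\subset U_i$. Integration over loops defines the class $[\omega]\in H^1(X;\mathbf R)$ represented by $\omega$; on a finite cell complex every class is represented. Definitions of $\mathrm{cat}(X,\xi)$ and $\mathrm{ccat}(X,\xi)$, for $X$ a finite cell complex and $\xi\in H^1(X;\mathbf R)$. Fix a continuous closed 1-form $\omega$ representing $\xi$. A subset $A\subset X$ is $N$-movable with respect to $\omega$ if there is a continuous homotopy $h_t:A\to X$, $t\in[0,1]$, such that $h_0$ is the inclusion and $\int_x^{h_1(x)}\omega<-N$ for every $x\in A$ (integral along the path $\tau\mapsto h_\tau(x)$); it is $N$-movable with control $C$ if the homotopy can be chosen so that in addition $\int_x^{h_t(x)}\omega\le C$ for every $x\in A$ and $t\in[0,1]$. $\mathrm{cat}(X,\xi)$ is the minimal integer $k\ge0$ such that for every $N>0$ there is an open cover $X=F\cup F_1\cup\dots\cup F_k$ with each inclusion $F_j\to X$ null-homotopic and with $F$ $N$-movable with respect to $\omega$. $\mathrm{ccat}(X,\xi)$ is the minimal integer $k\ge0$ for which there exists $C>0$ such that for every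 $N>0$ there is an open cover $X=F\cup F_1\cup\dots\cup F_k$ with each inclusion $F_j\to X$ null-homotopic and with $F$ $N$-movable with control $C$ with respect to $\omega$. Both numbers are independent of the choice of $\omega$ in the class $\xi$. *)

theory Defs
  imports "HOL-Homology.Homology"
begin

section \<open>Singular cohomology with real coefficients\<close>

text \<open>
  A cochain is a real function on singular simplices (equivalently, a homomorphism from singular
  chains to the reals), extended by \<open>0\<close> to functions that are not singular simplices
  of \<open>X\<close>, so that equality of cochains is equality of functions.
\<close>

definition cochain_group :: "nat \<Rightarrow> 'a topology \<Rightarrow> (((nat \<Rightarrow> real) \<Rightarrow> 'a) \<Rightarrow> real) monoid" where
  "cochain_group p X =
     \<lparr>carrier = {c. \<forall>\<sigma>. \<not> singular_simplex p X \<sigma> \<longrightarrow> c \<sigma> = 0},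
      monoid.mult = (\<lambda>c d \<sigma>. c \<sigma> + d \<sigma>),
      one = (\<lambda>\<sigma>. 0)\<rparr>"

definition coboundary_map ::
    "nat \<Rightarrow> 'a topology \<Rightarrow> (((nat \<Rightarrow> real) \<Rightarrow> 'a) \<Rightarrow> real) \<Rightarrow> ((nat \<Rightarrow> real) \<Rightarrow> 'a) \<Rightarrow> real" where
  "coboundary_map p X c =
     (\<lambda>\<sigma>. if singular_simplex (Suc p) X \<sigma>
          then \<Sum>k\<le>Suc p. (-1) ^ k * c (singular_face (Suc p) k \<sigma>) else 0)"

definition cocycle_group :: "nat \<Rightarrow> 'a topology \<Rightarrow> (((nat \<Rightarrow> real) \<Rightarrow> 'a) \<Rightarrow> real) monoid" where
  "cocycle_group p X =
     (cochain_group p X)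
       \<lparr>carrier := {c \<in> carrier (cochain_group p X). coboundary_map p X c = (\<lambda>\<sigma>. 0)}\<rparr>"

definition coboundaries :: "nat \<Rightarrow> 'a topology \<Rightarrow> (((nat \<Rightarrow> real) \<Rightarrow> 'a) \<Rightarrow> real) set" where
  "coboundaries p X =
     (if p = 0 then {\<lambda>\<sigma>. 0}
      else coboundary_map (p - 1) X ` carrier (cochain_group (p - 1) X))"

definition cohomology_group ::
    "nat \<Rightarrow> 'a topology \<Rightarrow> (((nat \<Rightarrow> real) \<Rightarrow> 'a) \<Rightarrow> real) set monoid" where
  "cohomology_group p X = cocycle_group p X Mod coboundaries p X"

definition cochain_pullback ::
    "nat \<Rightarrow> 'a topology \<Rightarrow> ('a \<Rightarrow> 'b) \<Rightarrow> (((nat \<Rightarrow> real) \<Rightarrow> 'b) \<Rightarrow> real)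
      \<Rightarrow> ((nat \<Rightarrow> real) \<Rightarrow> 'a) \<Rightarrow> real" where
  "cochain_pullback p X f c =
     (\<lambda>\<sigma>. if singular_simplex p X \<sigma> then c (simplex_map p f \<sigma>) else 0)"

text \<open>
  The map \<open>f\<^sup>*\<close> on cohomology classes, for a continuous \<open>f\<close> with domain \<open>X\<close>. All members \<open>c\<close>
  of the class \<open>\<xi>\<close> give the same coset, so the union is a single coset.
\<close>

definition cohomology_pullback ::
    "nat \<Rightarrow> 'a topology \<Rightarrow> ('a \<Rightarrow> 'b) \<Rightarrow> (((nat \<Rightarrow> real) \<Rightarrow> 'b) \<Rightarrow> real) set
      \<Rightarrow> (((nat \<Rightarrow> real) \<Rightarrow> 'a) \<Rightarrow> real) set" where
  "cohomology_pullback p X f \<xi> =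
     (\<Union>c\<in>\<xi>. coboundaries p X #>\<^bsub>cocycle_group p X\<^esub> cochain_pullback p X f c)"


section \<open>Continuous closed 1-forms\<close>

text \<open>
  A family of functions indexed by an open cover is encoded as the set of its pairs
  \<open>(U, f\<^sub>U)\<close>. The same \<open>U\<close> may occur with several functions, as happens when two families are
  united. The values of \<open>f\<^sub>U\<close> outside \<open>U\<close> are irrelevant: changing them gives an equivalent
  family.
\<close>

definition closed_form_family :: "'a topology \<Rightarrow> ('a set \<times> ('a \<Rightarrow> real)) set \<Rightarrow> bool" where
  "closed_form_family X \<F> \<longleftrightarrow>
     (\<forall>(U, f) \<in> \<F>. openin X U \<and> continuous_map (subtopology X U) euclideanreal f) \<and>
     (\<Union>(U, f) \<in> \<F>. U) = topspace X \<and>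
     (\<forall>(U, f) \<in> \<F>. \<forall>(V, g) \<in> \<F>. \<forall>x \<in> U \<inter> V.
        \<exists>W. openin X W \<and> x \<in> W \<and> W \<subseteq> U \<inter> V \<and> (\<forall>y\<in>W. f y - g y = f x - g x))"

definition closed_forms :: "'a topology \<Rightarrow> ('a set \<times> ('a \<Rightarrow> real)) set set set" where
  "closed_forms X =
     {\<F>. closed_form_family X \<F>} //
       {(\<F>, \<G>). closed_form_family X \<F> \<and> closed_form_family X \<G> \<and> closed_form_family X (\<F> \<union> \<G>)}"

text \<open>
  The integral along a path \<open>\<gamma>\<close> parametrised by \<open>{0..1}\<close>. For a closed 1-form and a path
  in the space, the value does not depend on the family representing the form or on the
  subdivision.
\<close>

definition path_integral :: "('a set \<times> ('a \<Rightarrow> real)) set set \<Rightarrow> (real \<Rightarrow> 'a) \<Rightarrow> real" where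
  "path_integral \<omega> \<gamma> =
     (THE v. \<exists>\<F>\<in>\<omega>. \<exists>(m::nat) t U f.
        t 0 = 0 \<and> t m = 1 \<and>
        (\<forall>i<m. t i < t (Suc i) \<and> (U i, f i) \<in> \<F> \<and> \<gamma> ` {t i..t (Suc i)} \<subseteq> U i) \<and>
        v = (\<Sum>i<m. f i (\<gamma> (t (Suc i))) - f i (\<gamma> (t i))))"

text \<open>
  The class in \<open>H\<^sup>1(X; \<real>)\<close> represented by a closed 1-form: that of the cocycle which
  integrates the form over singular 1-simplices, each read as a path from its vertex \<open>0\<close> to
  its vertex \<open>1\<close>.
\<close>

definition closed_form_cocycle ::
    "'a topology \<Rightarrow> ('a set \<times> ('a \<Rightarrow> real)) set set \<Rightarrow> ((nat \<Rightarrow> real) \<Rightarrow> 'a) \<Rightarrow> real" where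
  "closed_form_cocycle X \<omega> =
     (\<lambda>\<sigma>. if singular_simplex 1 X \<sigma>
          then path_integral \<omega> (\<lambda>t. \<sigma> (\<lambda>i. if i = 0 then 1 - t else if i = 1 then t else 0))
          else 0)"

definition closed_form_class ::
    "'a topology \<Rightarrow> ('a set \<times> ('a \<Rightarrow> real)) set set \<Rightarrow> (((nat \<Rightarrow> real) \<Rightarrow> 'a) \<Rightarrow> real) set" where
  "closed_form_class X \<omega> = coboundaries 1 X #>\<^bsub>cocycle_group 1 X\<^esub> closed_form_cocycle X \<omega>"


section \<open>The invariants cat and ccat\<close>

definition movable ::
    "'a topology \<Rightarrow> ('a set \<times> ('a \<Rightarrow> real)) set set \<Rightarrow> real \<Rightarrow> 'a set \<Rightarrow> bool" where
  "movable X \<omega> N A \<longleftrightarrow>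
     A \<subseteq> topspace X \<and>
     (\<exists>h. continuous_map (prod_topology (top_of_set {0..1::real}) (subtopology X A)) X h \<and>
          (\<forall>x\<in>A. h (0, x) = x) \<and>
          (\<forall>x\<in>A. path_integral \<omega> (\<lambda>\<tau>. h (\<tau>, x)) < - N))"

text \<open>The integral from \<open>x\<close> to \<open>h\<^sub>t(x)\<close> is taken along the path \<open>\<tau> \<mapsto> h\<^bsub>t\<tau>\<^esub>(x)\<close>.\<close>

definition movable_with_control ::
    "'a topology \<Rightarrow> ('a set \<times> ('a \<Rightarrow> real)) set set \<Rightarrow> real \<Rightarrow> real \<Rightarrow> 'a set \<Rightarrow> bool" where
  "movable_with_control X \<omega> C N A \<longleftrightarrow>
     A \<subseteq> topspace X \<and>
     (\<exists>h. continuous_map (prod_topology (top_of_set {0..1::real}) (subtopology X A)) X h \<and>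
          (\<forall>x\<in>A. h (0, x) = x) \<and>
          (\<forall>x\<in>A. path_integral \<omega> (\<lambda>\<tau>. h (\<tau>, x)) < - N) \<and>
          (\<forall>x\<in>A. \<forall>t\<in>{0..1}. path_integral \<omega> (\<lambda>\<tau>. h (t * \<tau>, x)) \<le> C))"

definition cat_cover :: "'a topology \<Rightarrow> nat \<Rightarrow> 'a set \<Rightarrow> (nat \<Rightarrow> 'a set) \<Rightarrow> bool" where
  "cat_cover X k F G \<longleftrightarrow>
     openin X F \<and> (\<forall>j\<in>{1..k}. openin X (G j)) \<and>
     F \<union> (\<Union>j\<in>{1..k}. G j) = topspace X \<and>
     (\<forall>j\<in>{1..k}. \<exists>c. homotopic_with (\<lambda>_. True) (subtopology X (G j)) X id (\<lambda>_. c))"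

definition cat_form :: "'a topology \<Rightarrow> ('a set \<times> ('a \<Rightarrow> real)) set set \<Rightarrow> nat" where
  "cat_form X \<omega> =
     (LEAST k. \<forall>N>0. \<exists>F G. cat_cover X k F G \<and> movable X \<omega> N F)"

definition ccat_form :: "'a topology \<Rightarrow> ('a set \<times> ('a \<Rightarrow> real)) set set \<Rightarrow> nat" where
  "ccat_form X \<omega> =
     (LEAST k. \<exists>C>0. \<forall>N>0. \<exists>F G. cat_cover X k F G \<and> movable_with_control X \<omega> C N F)"

definition representing_form ::
    "'a topology \<Rightarrow> (((nat \<Rightarrow> real) \<Rightarrow> 'a) \<Rightarrow> real) set \<Rightarrow> ('a set \<times> ('a \<Rightarrow> real)) set set" where
  "representing_form X \<xi> = (SOME \<omega>. \<omega> \<in> closed_forms X \<and> closed_form_class X \<omega> = \<xi>)"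

definition cat :: "'a topology \<Rightarrow> (((nat \<Rightarrow> real) \<Rightarrow> 'a) \<Rightarrow> real) set \<Rightarrow> nat" where
  "cat X \<xi> = cat_form X (representing_form X \<xi>)"

definition ccat :: "'a topology \<Rightarrow> (((nat \<Rightarrow> real) \<Rightarrow> 'a) \<Rightarrow> real) set \<Rightarrow> nat" where
  "ccat X \<xi> = ccat_form X (representing_form X \<xi>)"


section \<open>Bouquets, and the powers of the bouquet of a torus and a circle\<close>

definition wedge :: "'a topology \<Rightarrow> 'a \<Rightarrow> 'b topology \<Rightarrow> 'b \<Rightarrow> ('a \<times> 'b) topology" where
  "wedge X x Y y =
     subtopology (prod_topology X Y) (topspace X \<times> {y} \<union> {x} \<times> topspace Y)"

text \<open>
  The subspace topology used above agrees with the quotient topology on the disjoint union of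
  \<open>X\<close> and \<open>Y\<close> with \<open>x\<close> and \<open>y\<close> identified.
\<close>

lemma openin_wedge_iff:
  assumes x: "x \<in> topspace X" and y: "y \<in> topspace Y"
  shows "openin (wedge X x Y y) U \<longleftrightarrow>
     U \<subseteq> topspace X \<times> {y} \<union> {x} \<times> topspace Y \<and>
     openin X {a \<in> topspace X. (a, y) \<in> U} \<and> openin Y {b \<in> topspace Y. (x, b) \<in> U}"
    (is "?L \<longleftrightarrow> ?S \<and> openin X ?A \<and> openin Y ?B")
proof
  assume ?L
  then obtain T where T: "openin (prod_topology X Y) T"
    and U: "U = T \<inter> (topspace X \<times> {y} \<union> {x} \<times> topspace Y)"
    by (auto simp: wedge_def openin_subtopology)
  have "continuous_map X (prod_topology X Y) (\<lambda>a. (a, y))"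
       "continuous_map Y (prod_topology X Y) (\<lambda>b. (x, b))"
    using x y by (auto simp: continuous_map_pairwise o_def)
  then have "openin X {a \<in> topspace X. (a, y) \<in> T}" "openin Y {b \<in> topspace Y. (x, b) \<in> T}"
    using T by (auto intro: openin_continuous_map_preimage)
  moreover have "?A = {a \<in> topspace X. (a, y) \<in> T}" "?B = {b \<in> topspace Y. (x, b) \<in> T}"
    using U x y by auto
  ultimately show "?S \<and> openin X ?A \<and> openin Y ?B"
    using U by auto
next
  assume R: "?S \<and> openin X ?A \<and> openin Y ?B"
  define T where "T = (if (x, y) \<in> U then ?A \<times> ?B
                       else ?A \<times> topspace Y \<union> topspace X \<times> ?B)"
  have "openin (prod_topology X Y) T"
    using R by (auto simp: T_def openin_prod_Times_iff)
  moreover have "U = T \<inter> (topspace X \<times> {y} \<union> {x} \<times> topspace Y)"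
    using R x y by (auto simp: T_def)
  ultimately show ?L
    by (auto simp: wedge_def openin_subtopology)
qed

definition circle :: "complex topology" where
  "circle = top_of_set (sphere 0 1)"

definition torus :: "(complex \<times> complex) topology" where
  "torus = prod_topology circle circle"

type_synonym bouquet_point = "(complex \<times> complex) \<times> complex"

definition bouquet :: "bouquet_point topology" where
  "bouquet = wedge torus (1, 1) circle 1"

definition base_point :: bouquet_point where
  "base_point = ((1, 1), 1)"

definition torus_inclusion :: "complex \<times> complex \<Rightarrow> bouquet_point" where
  "torus_inclusion z = (z, 1)"

definition bouquet_power :: "nat \<Rightarrow> (nat \<Rightarrow> bouquet_point) topology" where
  "bouquet_power k = product_topology (\<lambda>_. bouquet) {1..k}"

definition p_map :: "nat \<Rightarrow> nat \<Rightarrow> bouquet_point \<Rightarrow> nat \<Rightarrow> bouquet_point" where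
  "p_map k i x = (\<lambda>j\<in>{1..k}. if j = i then x else base_point)"

definition q_map :: "nat \<Rightarrow> nat \<Rightarrow> complex \<times> complex \<Rightarrow> nat \<Rightarrow> bouquet_point" where
  "q_map k i = p_map k i \<circ> torus_inclusion"

definition p_pullback_zero ::
    "nat \<Rightarrow> nat \<Rightarrow> (((nat \<Rightarrow> real) \<Rightarrow> nat \<Rightarrow> bouquet_point) \<Rightarrow> real) set \<Rightarrow> bool" where
  "p_pullback_zero k i \<xi> \<longleftrightarrow>
     cohomology_pullback 1 bouquet (p_map k i) \<xi> = \<one>\<^bsub>cohomology_group 1 bouquet\<^esub>"

definition q_pullback_zero ::
    "nat \<Rightarrow> nat \<Rightarrow> (((nat \<Rightarrow> real) \<Rightarrow> nat \<Rightarrow> bouquet_point) \<Rightarrow> real) set \<Rightarrow> bool" where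
  "q_pullback_zero k i \<xi> \<longleftrightarrow>
     cohomology_pullback 1 torus (q_map k i) \<xi> = \<one>\<^bsub>cohomology_group 1 torus\<^esub>"

definition a_number ::
    "nat \<Rightarrow> (((nat \<Rightarrow> real) \<Rightarrow> nat \<Rightarrow> bouquet_point) \<Rightarrow> real) set \<Rightarrow> nat" where
  "a_number k \<xi> = card {i \<in> {1..k}. \<not> p_pullback_zero k i \<xi> \<and> q_pullback_zero k i \<xi>}"

definition b_number ::
    "nat \<Rightarrow> (((nat \<Rightarrow> real) \<Rightarrow> nat \<Rightarrow> bouquet_point) \<Rightarrow> real) set \<Rightarrow> nat" where
  "b_number k \<xi> = card {i \<in> {1..k}. p_pullback_zero k i \<xi>}"

end

theory Submission
  imports Defs "HOL-Analysis.Analysis"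
begin

text \<open>
  The class is determined by its periods on the \<open>3k\<close> coordinate loops, and for any form
  representing it the integral over a path is, up to a bounded error, the linear combination of
  the changes of the \<open>3k\<close> angles with the periods as weights. Both bounds only use this.

  Upper bound: for distinct points \<open>\<zeta>\<^sub>n \<noteq> 1\<close> of the circle, the set of points none of whose
  coordinates is \<open>\<zeta>\<^sub>n\<close> is contractible, and a point of one factor misses at most two of these
  sets. A point lying in none of \<open>1 + a + 2b\<close> such sets therefore has either two missing torus
  coordinates in a factor counted by \<open>a\<close>, or a missing coordinate in a factor where the class is
  nonzero on the torus; in both cases that factor can be moved far down, with all other
  factors moving by a bounded amount.

  Lower bound: a large cube is mapped to the power so that a primitive of the form is bounded
  above on it. A null-homotopic set yields a logarithm of any one circle coordinate, hence a
  function on the cube with the boundary signs of a cube coordinate and no zero on that set. The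
  movable set does the same for one cube coordinate in each factor with nonzero class jointly: if
  the homotopy ends on a fixed edge in all these factors, then the integral is bounded below. With
  only \<open>a + 2b\<close> null-homotopic sets these functions together contradict the theorem of Poincare
  and Miranda.
\<close>

section \<open>The bouquet and angle lifts\<close>

text \<open>The order of choices shapes the lower bound. \<open>N\<close> is fixed from the periods
  and the bounded error alone; then the cover and its homotopies are given; compact shrinkings of
  the cover bound all angle displacements by some \<open>D\<close>; only then is the size of the
  cube chosen, far beyond \<open>D\<close>. A homotopy that starts on a face of the cube is
  therefore too short to meet the fixed edge, which gives the boundary signs. On the other hand the
  primitive has to be bounded above on cubes of every size, which forces the bent line used in
  factors where the class is nonzero on the torus. Common zeros on a cube take the place of cup
  products. A factor supplies two cube coordinates if the class vanishes on its torus and one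
  otherwise; the movable set settles one coordinate in every factor with nonzero class, so
  \<open>a + 2 * b\<close> remain, one for each null-homotopic set. Since a primitive of the form
  exists only after lifting angles, and since potentials between cohomologous forms are a priori
  arbitrary functions on points, everything is reduced to estimates up to a constant.\<close>

definition crd :: "nat \<Rightarrow> bouquet_point \<Rightarrow> complex" where
  "crd j p = (if j = 0 then fst (fst p) else if j = 1 then snd (fst p) else snd p)"

definition bouquet_set :: "bouquet_point set" where
  "bouquet_set = {p. (\<forall>j<3. norm (crd j p) = 1) \<and> (crd 2 p = 1 \<or> crd 0 p = 1 \<and> crd 1 p = 1)}"

definition power_set :: "nat \<Rightarrow> (nat \<Rightarrow> bouquet_point) set" where
  "power_set k = PiE {1..k} (\<lambda>_. bouquet_set)"

definition assemble :: "nat \<Rightarrow> (nat \<Rightarrow> nat \<Rightarrow> complex) \<Rightarrow> nat \<Rightarrow> bouquet_point" where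
  "assemble k f = (\<lambda>i\<in>{1..k}. ((f i 0, f i 1), f i 2))"

lemma all_less_3: "(\<forall>j<3. P j) \<longleftrightarrow> P 0 \<and> P 1 \<and> P (2::nat)"
  by (auto simp: numeral_3_eq_3 numeral_2_eq_2 less_Suc_eq)

lemma less_3_cases: "j < 3 \<Longrightarrow> (j = 0 \<Longrightarrow> P) \<Longrightarrow> (j = 1 \<Longrightarrow> P) \<Longrightarrow> (j = (2::nat) \<Longrightarrow> P) \<Longrightarrow> P"
  by linarith

lemma sum_less_3: "(\<Sum>j<3. f j) = f 0 + f 1 + f (2::nat)"
  by (simp add: numeral_3_eq_3 numeral_2_eq_2)

lemma bouquet_eq: "bouquet = top_of_set bouquet_set"
proof -
  have "(sphere 0 1 \<times> sphere 0 1) \<times> {1::complex} \<union> {(1,1)} \<times> sphere 0 1 = bouquet_set"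
    by (auto simp: bouquet_set_def crd_def all_less_3)
  moreover have "bouquet_set \<subseteq> (sphere 0 1 \<times> sphere 0 1) \<times> sphere 0 1"
    by (auto simp: bouquet_set_def crd_def all_less_3)
  ultimately show ?thesis
    by (simp add: bouquet_def wedge_def torus_def circle_def subtopology_subtopology Int_absorb1)
qed

text \<open>Extensional functions have the constant value \<open>undefined\<close> outside
  \<open>{1..k}\<close>, so the other coordinates of the full function space add no open sets. This
  makes continuity into the power a matter of \<open>continuous_on\<close>.\<close>

lemma bouquet_power_eq: "bouquet_power k = top_of_set (power_set k)"
proof -
  let ?X = "product_topology (\<lambda>_. top_of_set bouquet_set) {1..k}"
  have ts: "topspace ?X = topspace (top_of_set (power_set k))"
    by (simp add: power_set_def)
  have 1: "continuous_map (top_of_set (power_set k)) ?X id"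
    unfolding continuous_map_componentwise
    using continuous_on_subset[OF continuous_on_product_coordinates subset_UNIV]
    by (auto simp: power_set_def PiE_iff)
  have "continuous_map ?X euclidean id"
    unfolding euclidean_product_topology[symmetric] continuous_map_componentwise_UNIV
  proof
    fix i
    show "continuous_map ?X euclidean (\<lambda>x. id x i)"
    proof (cases "i \<in> {1..k}")
      case True
      have "continuous_map ?X (top_of_set bouquet_set) (\<lambda>x. x i)"
        using True by (intro continuous_map_product_projection)
      then show ?thesis
        by (auto intro: continuous_map_into_fulltopology)
    next
      case False
      have "id x i = undefined" if "x \<in> topspace ?X" for x
        using that False unfolding topspace_product_topology id_apply by (rule PiE_arb)
      moreover have "continuous_map ?X euclidean (\<lambda>x. undefined)" by simp
      ultimately show ?thesis
        by (metis (no_types, lifting) continuous_map_eq)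
    qed
  qed
  then have 2: "continuous_map ?X (top_of_set (power_set k)) id"
    using ts by (auto simp: continuous_map_in_subtopology)
  show ?thesis
    unfolding bouquet_power_def bouquet_eq topology_eq
    using topology_finer_continuous_id[OF ts] topology_finer_continuous_id[OF ts[symmetric]] 1 2
    by blast
qed

lemma compact_power_set: "compact (power_set k)"
proof -
  have "compact (sphere (0::complex) 1)" by simp
  have eq: "(sphere 0 1 \<times> sphere 0 1) \<times> {1::complex} \<union> {(1,1)} \<times> sphere 0 1 = bouquet_set"
    by (auto simp: bouquet_set_def crd_def all_less_3)
  have "compact bouquet_set"
    unfolding eq[symmetric] by (intro compact_Un compact_Times) auto
  then have "compact_space (top_of_set bouquet_set)"
    by (simp add: compact_space_subtopology)
  then have "compact_space (bouquet_power k)"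
    unfolding bouquet_power_def bouquet_eq by (simp add: compact_space_product_topology)
  then show ?thesis
    unfolding bouquet_power_eq by (simp add: compact_space_def compactin_subtopology)
qed

lemma continuous_on_crd [continuous_intros]:
  "continuous_on S f \<Longrightarrow> continuous_on S (\<lambda>x. crd j (f x))"
  unfolding crd_def by (cases "j = 0"; cases "j = 1") (simp_all add: continuous_on_fst continuous_on_snd)

lemma continuous_on_crd_power:
  "continuous_on S f \<Longrightarrow> continuous_on S (\<lambda>x. crd j (f x i))"
  by (rule continuous_on_crd[OF continuous_on_product_then_coordinatewise])

lemma continuous_on_assemble:
  assumes "\<And>i j. i \<in> {1..k} \<Longrightarrow> j < 3 \<Longrightarrow> continuous_on S (\<lambda>x. f x i j)"
  shows "continuous_on S (\<lambda>x. assemble k (f x))"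
proof (rule continuous_on_coordinatewise_then_product)
  fix i
  show "continuous_on S (\<lambda>x. assemble k (f x) i)"
    by (cases "i \<in> {1..k}") (auto simp: assemble_def intro!: continuous_intros assms)
qed

lemma crd_assemble [simp]: "i \<in> {1..k} \<Longrightarrow> j < 3 \<Longrightarrow> crd j (assemble k f i) = f i j"
  by (auto simp: assemble_def crd_def elim!: less_3_cases)

lemma assemble_crd: "y \<in> power_set k \<Longrightarrow> assemble k (\<lambda>i j. crd j (y i)) = y"
  unfolding power_set_def assemble_def crd_def
  by (rule ext) (auto simp: PiE_iff extensional_def)

lemma assemble_cong:
  "(\<And>i j. i \<in> {1..k} \<Longrightarrow> j < 3 \<Longrightarrow> f i j = g i j) \<Longrightarrow> assemble k f = assemble k g"
  by (auto simp: assemble_def)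

lemma assemble_in_power_set_iff:
  "assemble k f \<in> power_set k \<longleftrightarrow>
    (\<forall>i\<in>{1..k}. (\<forall>j<3. norm (f i j) = 1) \<and> (f i 2 = 1 \<or> f i 0 = 1 \<and> f i 1 = 1))"
  unfolding power_set_def bouquet_set_def assemble_def crd_def all_less_3
  by (auto simp: PiE_iff)

lemma power_setD:
  assumes "y \<in> power_set k" "i \<in> {1..k}"
  shows "j < 3 \<Longrightarrow> norm (crd j (y i)) = 1"
    and "crd 2 (y i) = 1 \<or> crd 0 (y i) = 1 \<and> crd 1 (y i) = 1"
  using assms by (auto simp: power_set_def bouquet_set_def PiE_iff)

section \<open>Circle-valued maps and their angles\<close>

lemma cis_eq_1_imp:
  assumes "cis x = 1" obtains n :: int where "x = 2 * pi * of_int n"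
proof -
  have "cos x = 1" using assms by (simp add: complex_eq_iff)
  then show ?thesis using that cos_one_2pi_int[of x] by (auto simp: mult.commute mult.left_commute)
qed

lemma cis_eq_1_small: "cis x = 1 \<Longrightarrow> \<bar>x\<bar> < 2 * pi \<Longrightarrow> x = 0"
proof -
  assume "cis x = 1" "\<bar>x\<bar> < 2 * pi"
  then obtain n :: int where n: "x = 2 * pi * of_int n" by (blast elim: cis_eq_1_imp)
  with \<open>\<bar>x\<bar> < 2 * pi\<close> have "\<bar>real_of_int n\<bar> < 1" by (simp add: abs_mult)
  then show "x = 0" using n by (simp add: abs_less_iff)
qed

text \<open>Distinct values with \<open>cis = 1\<close> are at least \<open>2 * pi\<close> apart, so
  the range is discrete.\<close>

lemma continuous_cis_1_constant:
  fixes f :: "'a::topological_space \<Rightarrow> real"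
  assumes "connected S" "continuous_on S f" "\<And>x. x \<in> S \<Longrightarrow> cis (f x) = 1" "x \<in> S" "y \<in> S"
  shows "f x = f y"
proof -
  have "f constant_on S"
  proof (rule continuous_discrete_range_constant[OF assms(1,2)])
    fix x assume x: "x \<in> S"
    have "2 * pi \<le> norm (f y - f x)" if "y \<in> S" "f y \<noteq> f x" for y
    proof (rule ccontr)
      assume "\<not> ?thesis"
      moreover have "cis (f y - f x) = 1" using assms(3) x that by (simp flip: cis_divide)
      ultimately show False using cis_eq_1_small[of "f y - f x"] that by simp
    qed
    then show "\<exists>e>0. \<forall>y. y \<in> S \<and> f y \<noteq> f x \<longrightarrow> e \<le> norm (f y - f x)"
      by (intro exI[of _ "2 * pi"]) auto
  qed
  then show ?thesis using assms by (auto simp: constant_on_def)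
qed

text \<open>Only the change of angle along the homotopy is lifted; \<open>\<phi>\<close> itself may
  have no angle on \<open>C\<close>. Compactness gives a uniform mesh on which consecutive values
  are less than 1 apart, so their quotients stay off the cut of \<open>Ln\<close> and the principal
  logarithms add up to a continuous angle.\<close>

lemma homotopy_angle_lift:
  fixes \<phi> :: "real \<times> 'a::metric_space \<Rightarrow> complex"
  assumes C: "compact C" and cont: "continuous_on ({0..1} \<times> C) \<phi>"
    and unit: "\<And>p. p \<in> {0..1} \<times> C \<Longrightarrow> norm (\<phi> p) = 1"
  obtains \<theta> where "continuous_on ({0..1} \<times> C) \<theta>" "\<And>x. x \<in> C \<Longrightarrow> \<theta> (0, x) = 0"
    "\<And>t x. t \<in> {0..1} \<Longrightarrow> x \<in> C \<Longrightarrow> \<phi> (t, x) = \<phi> (0, x) * cis (\<theta> (t, x))"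
proof -
  have "uniformly_continuous_on ({0..1} \<times> C) \<phi>"
    by (intro compact_uniformly_continuous compact_Times cont C) auto
  then obtain d where d: "d > 0" "\<And>p p'. p \<in> {0..1} \<times> C \<Longrightarrow> p' \<in> {0..1} \<times> C \<Longrightarrow>
      dist p' p < d \<Longrightarrow> dist (\<phi> p') (\<phi> p) < 1"
    unfolding uniformly_continuous_on_def by (metis zero_less_one)
  obtain r :: nat where r: "r > 0" "1 / real r < d"
    using nat_approx_posE[OF d(1)] by (metis zero_less_Suc)
  \<comment> \<open>Stopping the partition at \<open>t\<close> makes the summands beyond
    \<open>t\<close> vanish, so one formula with \<open>r\<close> terms serves every
    \<open>t\<close>.\<close>
  define m where "m = (\<lambda>l t. min t (real l / real r))"
  define q where "q = (\<lambda>l (t,x). \<phi> (m (Suc l) t, x) / \<phi> (m l t, x))"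
  define \<theta> where "\<theta> = (\<lambda>p. \<Sum>l<r. Im (Ln (q l p)))"
  have m01: "m l t \<in> {0..1}" if "t \<in> {0..1}" for l t
    using that by (auto simp: m_def)
  have qn: "norm (q l p) = 1" if "p \<in> {0..1} \<times> C" for l p
    using that m01 unit by (cases p) (auto simp: q_def norm_divide)
  have q1: "norm (q l p - 1) < 1" if p: "p \<in> {0..1} \<times> C" for l p
  proof -
    obtain t x where tx: "p = (t,x)" "t \<in> {0..1}" "x \<in> C" using p by auto
    have "\<bar>m (Suc l) t - m l t\<bar> \<le> 1 / real r"
      using r(1) by (auto simp: m_def min_def field_simps)
    then have "dist (m (Suc l) t, x) (m l t, x) < d"
      using r(2) by (simp add: dist_Pair_Pair dist_real_def)
    then have "dist (\<phi> (m (Suc l) t, x)) (\<phi> (m l t, x)) < 1"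
      using d(2)[of "(m l t, x)" "(m (Suc l) t, x)"] m01 tx by auto
    moreover have n1: "norm (\<phi> (m l t, x)) = 1" using unit m01 tx by auto
    moreover have "q l p - 1 = (\<phi> (m (Suc l) t, x) - \<phi> (m l t, x)) / \<phi> (m l t, x)"
      using n1 tx by (simp add: q_def divide_simps) (use n1 in fastforce)
    ultimately show ?thesis by (simp add: norm_divide dist_norm)
  qed
  have qnn: "q l p \<notin> \<real>\<^sub>\<le>\<^sub>0" if "p \<in> {0..1} \<times> C" for l p
  proof
    assume "q l p \<in> \<real>\<^sub>\<le>\<^sub>0"
    then have "Re (q l p) \<le> 0" by (auto simp: complex_nonpos_Reals_iff)
    then have "1 \<le> \<bar>Re (q l p - 1)\<bar>" by simp
    also have "\<dots> \<le> norm (q l p - 1)" by (rule abs_Re_le_cmod)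
    finally show False using q1[OF that, of l] by simp
  qed
  have cm: "continuous_on ({0..1} \<times> C) (\<lambda>p. \<phi> (m l (fst p), snd p))" for l
  proof (rule continuous_on_compose2[OF cont])
    show "continuous_on ({0..1} \<times> C) (\<lambda>p. (m l (fst p), snd p))"
      unfolding m_def
      by (intro continuous_on_Pair continuous_on_min continuous_on_fst continuous_on_snd
          continuous_on_const continuous_on_id)
  qed (use m01 in auto)
  have cq: "continuous_on ({0..1} \<times> C) (q l)" for l
  proof -
    have "\<phi> (m l (fst p), snd p) \<noteq> 0" if "p \<in> {0..1} \<times> C" for p
    proof -
      have "norm (\<phi> (m l (fst p), snd p)) = 1" using m01 that by (intro unit) auto
      then show ?thesis by auto
    qed
    then show ?thesis
      unfolding q_def case_prod_unfold by (intro continuous_on_divide cm) auto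
  qed
  have 1: "continuous_on ({0..1} \<times> C) \<theta>"
    unfolding \<theta>_def by (intro continuous_intros cq) (use qnn in auto)
  have 2: "\<theta> (0, x) = 0" if "x \<in> C" for x
  proof -
    have "\<phi> (0,x) \<noteq> 0" using unit[of "(0,x)"] that by auto
    then show ?thesis by (simp add: \<theta>_def q_def m_def)
  qed
  have cq1: "cis (Im (Ln (q l p))) = q l p" if "p \<in> {0..1} \<times> C" for l p
  proof -
    have "q l p \<noteq> 0" using qn[OF that, of l] by auto
    then have "q l p = exp (Ln (q l p))" by simp
    also have "\<dots> = of_real (exp (Re (Ln (q l p)))) * cis (Im (Ln (q l p)))"
      by (simp add: exp_eq_polar)
    also have "Re (Ln (q l p)) = 0" using \<open>q l p \<noteq> 0\<close> qn[OF that] by simp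
    finally show ?thesis by simp
  qed
  have 3: "\<phi> (t, x) = \<phi> (0, x) * cis (\<theta> (t, x))" if "t \<in> {0..1}" "x \<in> C" for t x
  proof -
    have "\<phi> (m n t, x) = \<phi> (m 0 t, x) * cis (\<Sum>l<n. Im (Ln (q l (t,x))))" for n
    proof (induction n)
      case (Suc n)
      have "norm (\<phi> (m n t, x)) = 1" using m01 that by (intro unit) auto
      then have "\<phi> (m (Suc n) t, x) = \<phi> (m n t, x) * q n (t, x)" by (auto simp: q_def)
      then show ?case using Suc cq1[of "(t,x)" n] that by (simp flip: cis_mult)
    qed simp
    from this[of r] show ?thesis using r(1) that by (simp add: m_def \<theta>_def min.absorb1 min.absorb2)
  qed
  show ?thesis using 1 2 3 that by blast
qed

section \<open>Integrals of closed 1-forms\<close>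

lemma eventually_path_in_openin:
  assumes "continuous_map (top_of_set S) X \<gamma>" "openin X W" "s \<in> S" "\<gamma> s \<in> W"
  shows "\<forall>\<^sub>F t in at s within S. \<gamma> t \<in> W"
proof -
  have "openin (top_of_set S) {t \<in> S. \<gamma> t \<in> W}"
    using openin_continuous_map_preimage[OF assms(1,2)] by simp
  then obtain T where "open T" "{t \<in> S. \<gamma> t \<in> W} = S \<inter> T"
    by (auto simp: openin_open)
  then show ?thesis
    using assms(3,4) unfolding eventually_at_topological by blast
qed

lemma closed_forms_memberD:
  assumes "\<omega> \<in> closed_forms X" "\<F> \<in> \<omega>"
  shows "closed_form_family X \<F>"
  using assms by (auto simp: closed_forms_def quotient_def)

lemma closed_forms_nonempty:
  assumes "\<omega> \<in> closed_forms X"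
  obtains \<F> where "\<F> \<in> \<omega>" "closed_form_family X \<F>"
proof -
  obtain \<F> where "closed_form_family X \<F>"
    "\<omega> = {(\<F>, \<G>). closed_form_family X \<F> \<and> closed_form_family X \<G> \<and> closed_form_family X (\<F> \<union> \<G>)} `` {\<F>}"
    using assms unfolding closed_forms_def by (blast elim: quotientE)
  then show ?thesis by (intro that[of \<F>]) auto
qed

lemma closed_form_family_openin:
  "closed_form_family X \<F> \<Longrightarrow> (U, f) \<in> \<F> \<Longrightarrow>
    openin X U \<and> continuous_map (subtopology X U) euclideanreal f"
  unfolding closed_form_family_def by (drule conjunct1) auto

lemma closed_form_family_chart:
  assumes "closed_form_family X \<F>" "x \<in> topspace X"
  obtains U f where "(U, f) \<in> \<F>" "x \<in> U"
proof -
  have "(\<Union>(U, f) \<in> \<F>. U) = topspace X"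
    using assms(1) unfolding closed_form_family_def by (elim conjE)
  then show ?thesis using assms(2) that by auto
qed

lemma closed_form_family_overlap:
  assumes "closed_form_family X \<F>" "(U, f) \<in> \<F>" "(V, g) \<in> \<F>" "x \<in> U" "x \<in> V"
  obtains W where "openin X W" "x \<in> W" "W \<subseteq> U \<inter> V" "\<And>y. y \<in> W \<Longrightarrow> f y - g y = f x - g x"
proof -
  have "\<forall>(U, f) \<in> \<F>. \<forall>(V, g) \<in> \<F>. \<forall>x \<in> U \<inter> V.
        \<exists>W. openin X W \<and> x \<in> W \<and> W \<subseteq> U \<inter> V \<and> (\<forall>y\<in>W. f y - g y = f x - g x)"
    using assms(1) unfolding closed_form_family_def by simp
  from bspec[OF this assms(2)] have "\<forall>(V, g) \<in> \<F>. \<forall>x \<in> U \<inter> V.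
        \<exists>W. openin X W \<and> x \<in> W \<and> W \<subseteq> U \<inter> V \<and> (\<forall>y\<in>W. f y - g y = f x - g x)"
    by simp
  from bspec[OF this assms(3)] have "\<forall>x \<in> U \<inter> V.
        \<exists>W. openin X W \<and> x \<in> W \<and> W \<subseteq> U \<inter> V \<and> (\<forall>y\<in>W. f y - g y = f x - g x)"
    by simp
  then have "\<exists>W. openin X W \<and> x \<in> W \<and> W \<subseteq> U \<inter> V \<and> (\<forall>y\<in>W. f y - g y = f x - g x)"
    by (rule bspec) (simp add: assms(4,5))
  then show ?thesis by (elim exE conjE) (rule that, assumption+, erule (1) bspec)
qed

text \<open>The two families are only known to be compatible with the representative
  \<open>\<H>\<close> of the class. Both charts are compared with a chart of \<open>\<H>\<close>
  near \<open>x\<close> and the constants subtracted; this is transitivity of the relation in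
  \<open>closed_forms\<close>.\<close>

lemma closed_form_charts_overlap:
  assumes \<omega>: "\<omega> \<in> closed_forms X" and F: "\<F> \<in> \<omega>" "(U, f) \<in> \<F>" and G: "\<G> \<in> \<omega>" "(V, g) \<in> \<G>"
    and x: "x \<in> U" "x \<in> V"
  obtains W where "openin X W" "x \<in> W" "W \<subseteq> U \<inter> V" "\<And>y. y \<in> W \<Longrightarrow> f y - g y = f x - g x"
proof -
  obtain \<H> where H: "closed_form_family X \<H>"
    "\<And>\<F>. \<F> \<in> \<omega> \<Longrightarrow> closed_form_family X (\<H> \<union> \<F>)"
  proof -
    obtain \<H> where "closed_form_family X \<H>"
      "\<omega> = {(\<F>, \<G>). closed_form_family X \<F> \<and> closed_form_family X \<G> \<and> closed_form_family X (\<F> \<union> \<G>)} `` {\<H>}"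
      using \<omega> unfolding closed_forms_def by (blast elim: quotientE)
    then show ?thesis by (intro that[of \<H>]) auto
  qed
  have "openin X U"
    using closed_form_family_openin[OF closed_forms_memberD[OF \<omega> F(1)] F(2)] by blast
  then have "x \<in> topspace X" using x openin_subset by blast
  then obtain T h where T: "(T, h) \<in> \<H>" "x \<in> T"
    using closed_form_family_chart H(1) by metis
  obtain W1 where W1: "openin X W1" "x \<in> W1" "W1 \<subseteq> U \<inter> T" "\<And>y. y \<in> W1 \<Longrightarrow> f y - h y = f x - h x"
    by (rule closed_form_family_overlap[OF H(2)[OF F(1)] UnI2[OF F(2)] UnI1[OF T(1)] x(1) T(2)]) blast
  obtain W2 where W2: "openin X W2" "x \<in> W2" "W2 \<subseteq> V \<inter> T" "\<And>y. y \<in> W2 \<Longrightarrow> g y - h y = g x - h x"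
    by (rule closed_form_family_overlap[OF H(2)[OF G(1)] UnI2[OF G(2)] UnI1[OF T(1)] x(2) T(2)]) blast
  show ?thesis
  proof (rule that[of "W1 \<inter> W2"])
    show "f y - g y = f x - g x" if "y \<in> W1 \<inter> W2" for y
      using W1(4)[of y] W2(4)[of y] that by auto
  qed (use W1 W2 in auto)
qed

text \<open>A primitive of the form pulled back along the path. It involves no subdivision, which
  makes it easy to exhibit.\<close>

definition primitive_along ::
    "('a set \<times> ('a \<Rightarrow> real)) set \<Rightarrow> (real \<Rightarrow> 'a) \<Rightarrow> real set \<Rightarrow> (real \<Rightarrow> real) \<Rightarrow> bool" where
  "primitive_along \<F> \<gamma> S L \<longleftrightarrow>
     (\<forall>s\<in>S. \<exists>(U, f)\<in>\<F>. \<gamma> s \<in> U \<and> (\<forall>\<^sub>F t in at s within S. L t - f (\<gamma> t) = L s - f (\<gamma> s)))"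

lemma primitive_along_any_chart:
  assumes \<omega>: "\<omega> \<in> closed_forms X" and F: "\<F> \<in> \<omega>" "primitive_along \<F> \<gamma> S L"
    and \<gamma>: "continuous_map (top_of_set S) X \<gamma>"
    and G: "\<G> \<in> \<omega>" "(V, g) \<in> \<G>" and s: "s \<in> S" "\<gamma> s \<in> V"
  shows "\<forall>\<^sub>F t in at s within S. L t - g (\<gamma> t) = L s - g (\<gamma> s)"
proof -
  obtain U f where U: "(U, f) \<in> \<F>" "\<gamma> s \<in> U"
    "\<forall>\<^sub>F t in at s within S. L t - f (\<gamma> t) = L s - f (\<gamma> s)"
    using F(2) s(1) unfolding primitive_along_def by blast
  obtain W where W: "openin X W" "\<gamma> s \<in> W" "\<And>y. y \<in> W \<Longrightarrow> f y - g y = f (\<gamma> s) - g (\<gamma> s)"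
    by (rule closed_form_charts_overlap[OF \<omega> F(1) U(1) G U(2) s(2)]) blast
  have "\<forall>\<^sub>F t in at s within S. \<gamma> t \<in> W"
    by (rule eventually_path_in_openin[OF \<gamma> W(1) s(1) W(2)])
  with U(3) show ?thesis
  proof eventually_elim
    case (elim t)
    then show ?case using W(3)[of "\<gamma> t"] by linarith
  qed
qed

lemma partition_in_unit_interval:
  fixes t :: "nat \<Rightarrow> real"
  assumes "t 0 = 0" "t m = 1" "\<And>i. i < m \<Longrightarrow> t i < t (Suc i)" "i \<le> m"
  shows "0 \<le> t i" "t i \<le> 1"
proof -
  show "0 \<le> t i" using assms(4)
  proof (induction i)
    case (Suc i)
    then show ?case using assms(3)[of i] by simp
  qed (simp add: assms)
  show "t i \<le> 1" using assms(4)
  proof (induction rule: inc_induct)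
    case (step n)
    then show ?case using assms(3)[of n] by simp
  qed (simp add: assms)
qed

text \<open>A definite description is rewritten by showing that its whole predicate looks at the
  path on \<open>{0..1}\<close> only.\<close>

lemma path_integral_cong:
  assumes "\<And>t. t \<in> {0..1} \<Longrightarrow> \<gamma> t = \<gamma>' t"
  shows "path_integral \<omega> \<gamma> = path_integral \<omega> \<gamma>'"
proof -
  define D where "D \<F> \<gamma> m t U f v \<longleftrightarrow> t 0 = 0 \<and> t m = 1 \<and>
        (\<forall>i<m. t i < t (Suc i) \<and> (U i, f i) \<in> \<F> \<and> \<gamma> ` {t i..t (Suc i)} \<subseteq> U i) \<and>
        v = (\<Sum>i<m. f i (\<gamma> (t (Suc i))) - f i (\<gamma> (t i)))"
    for \<F> and \<gamma> :: "real \<Rightarrow> 'a" and m :: nat and t :: "nat \<Rightarrow> real" and U :: "nat \<Rightarrow> 'a set"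
      and f :: "nat \<Rightarrow> 'a \<Rightarrow> real" and v :: real
  have imp: "D \<F> \<gamma> m t U f v"
    if eq: "\<And>t. t \<in> {0..1} \<Longrightarrow> \<gamma> t = \<gamma>' t" and D: "D \<F> \<gamma>' m t U f v"
    for \<gamma> \<gamma>' :: "real \<Rightarrow> 'a" and \<F> m t U f v
  proof -
    note d = D[unfolded D_def]
    have t: "0 \<le> t i \<and> t i \<le> 1" if "i \<le> m" for i
      using partition_in_unit_interval[of t m i] d that by auto
    have "\<gamma>' ` {t i..t (Suc i)} = \<gamma> ` {t i..t (Suc i)}" if "i < m" for i
      by (intro image_cong refl eq[symmetric]) (use t[of i] t[of "Suc i"] that in auto)
    moreover have "(\<Sum>i<m. f i (\<gamma>' (t (Suc i))) - f i (\<gamma>' (t i))) =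
        (\<Sum>i<m. f i (\<gamma> (t (Suc i))) - f i (\<gamma> (t i)))"
      by (intro sum.cong refl) (use t in \<open>simp add: eq\<close>)
    ultimately show ?thesis using d by (simp add: D_def)
  qed
  have "D \<F> \<gamma> m t U f v \<longleftrightarrow> D \<F> \<gamma>' m t U f v" for \<F> m t U f v
    using imp[of \<gamma> \<gamma>'] imp[of \<gamma>' \<gamma>] assms by fastforce
  then show ?thesis unfolding path_integral_def D_def[symmetric] by simp
qed

text \<open>\<open>Bolzano\<close> replaces a Lebesgue number: subdivisions of adjacent intervals
  can be joined, and short intervals stay in one chart.\<close>

lemma chart_subdivision_exists:
  fixes \<gamma> :: "real \<Rightarrow> 'a"
  assumes F: "closed_form_family X \<F>" and \<gamma>: "continuous_map (top_of_set {0..1}) X \<gamma>"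
  obtains m :: nat and t U f where "t 0 = 0" "t m = 1"
    "\<forall>i<m. t i < t (Suc i) \<and> (U i, f i) \<in> \<F> \<and> \<gamma> ` {t i..t (Suc i)} \<subseteq> U i"
proof -
  define D where "D a b m t U f \<longleftrightarrow> t 0 = a \<and> t m = b \<and>
    (\<forall>i<m. t i < t (Suc i) \<and> (U i, f i) \<in> \<F> \<and> \<gamma> ` {t i..t (Suc i)} \<subseteq> U i)"
    for a b :: real and m :: nat and t :: "nat \<Rightarrow> real" and U f
  define P where "P a b \<longleftrightarrow> (0 \<le> a \<and> a < b \<and> b \<le> 1 \<longrightarrow> (\<exists>m t U f. D a b m t U f))" for a b
  have "P 0 1"
  proof (rule Bolzano)
    fix a b c assume ab: "P a b" and bc: "P b c" and le: "a \<le> b" "b \<le> c"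
    show "P a c"
    proof (cases "a = b \<or> b = c")
      case True then show ?thesis using ab bc by auto
    next
      case False
      show ?thesis unfolding P_def
      proof
        assume "0 \<le> a \<and> a < c \<and> c \<le> 1"
        then obtain m1 t1 U1 f1 m2 t2 U2 f2 where 1: "D a b m1 t1 U1 f1" and 2: "D b c m2 t2 U2 f2"
          using ab bc le False unfolding P_def by force
        \<comment> \<open>A subdivision has one more point than charts, hence
          \<open>i \<le> m1\<close> here but \<open>i < m1\<close> for \<open>U\<close> and
          \<open>f\<close>; both lists have the value \<open>b\<close> at the joint.\<close>
        define t where "t i = (if i \<le> m1 then t1 i else t2 (i - m1))" for i
        define U where "U i = (if i < m1 then U1 i else U2 (i - m1))" for i
        define f where "f i = (if i < m1 then f1 i else f2 (i - m1))" for i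
        have j: "t1 m1 = b" "t2 0 = b" using 1 2 by (auto simp: D_def)
        have "D a c (m1 + m2) t U f"
          unfolding D_def
        proof (intro conjI allI impI)
          show "t 0 = a" using 1 by (simp add: t_def D_def)
          show "t (m1 + m2) = c" using 1 2 by (auto simp: t_def D_def)
          fix i assume i: "i < m1 + m2"
          have "t i < t (Suc i) \<and> (U i, f i) \<in> \<F> \<and> \<gamma> ` {t i..t (Suc i)} \<subseteq> U i"
          proof (cases "i < m1")
            case True
            then show ?thesis using 1 by (auto simp: t_def U_def f_def D_def)
          next
            case False
            then have "t i = t2 (i - m1)" "t (Suc i) = t2 (Suc (i - m1))"
              using j by (auto simp: t_def Suc_diff_le)
            moreover have "i - m1 < m2" using i False by simp
            ultimately show ?thesis using 2 False by (auto simp: U_def f_def D_def)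
          qed
          then show "t i < t (Suc i)" "(U i, f i) \<in> \<F>" "\<gamma> ` {t i..t (Suc i)} \<subseteq> U i" by auto
        qed
        then show "\<exists>m t U f. D a c m t U f" by blast
      qed
    qed
  next
    fix x :: real assume x: "0 \<le> x" "x \<le> 1"
    then have "\<gamma> x \<in> topspace X" using \<gamma> by (auto simp: continuous_map_def)
    then obtain U f where U: "(U, f) \<in> \<F>" "\<gamma> x \<in> U" using closed_form_family_chart[OF F] by blast
    then have "openin X U" using closed_form_family_openin[OF F] by blast
    then have "\<forall>\<^sub>F t in at x within {0..1}. \<gamma> t \<in> U"
      using eventually_path_in_openin[OF \<gamma>] x U by simp
    then obtain d where d: "d > 0" "\<And>t. t \<in> {0..1} \<Longrightarrow> dist t x < d \<Longrightarrow> \<gamma> t \<in> U"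
      unfolding eventually_at using U(2) by metis
    have "P a b" if "a \<le> x" "x \<le> b" "b - a < d" for a b
      unfolding P_def
    proof
      assume ab: "0 \<le> a \<and> a < b \<and> b \<le> 1"
      have "\<gamma> t \<in> U" if "t \<in> {a..b}" for t
        using that ab \<open>a \<le> x\<close> \<open>x \<le> b\<close> \<open>b - a < d\<close> by (intro d(2)) (auto simp: dist_real_def)
      then have "D a b 1 (\<lambda>i. if i = 0 then a else b) (\<lambda>i. U) (\<lambda>i. f)"
        using ab U(1) by (auto simp: D_def)
      then show "\<exists>m t U f. D a b m t U f" by blast
    qed
    then show "\<exists>d>0. \<forall>a b. a \<le> x \<and> x \<le> b \<and> b - a < d \<longrightarrow> P a b" using d(1) by blast
  qed simp
  then show ?thesis using that unfolding P_def D_def by auto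
qed

text \<open>On each piece of a subdivision \<open>L\<close> minus the chart function is locally
  constant, hence constant, so every sum allowed in \<open>path_integral\<close> telescopes to
  \<open>L 1 - L 0\<close>. This makes the description single-valued, and
  \<open>chart_subdivision_exists\<close> makes it satisfiable.\<close>

lemma path_integral_primitive:
  assumes \<omega>: "\<omega> \<in> closed_forms X" and F: "\<F> \<in> \<omega>" "primitive_along \<F> \<gamma> {0..1} L"
    and \<gamma>: "continuous_map (top_of_set {0..1}) X \<gamma>"
  shows "path_integral \<omega> \<gamma> = L 1 - L 0"
proof -
  have val: "(\<Sum>i<m. f i (\<gamma> (t (Suc i))) - f i (\<gamma> (t i))) = L 1 - L 0"
    if G: "\<G> \<in> \<omega>" and t: "t 0 = 0" "t m = 1" and
      c: "\<forall>i<m. t i < t (Suc i) \<and> (U i, f i) \<in> \<G> \<and> \<gamma> ` {t i..t (Suc i)} \<subseteq> U i"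
    for \<G> and m :: nat and t U f
  proof -
    have "f i (\<gamma> (t (Suc i))) - f i (\<gamma> (t i)) = L (t (Suc i)) - L (t i)" if i: "i < m" for i
    proof -
      have sub: "{t i..t (Suc i)} \<subseteq> {0..1}"
        using partition_in_unit_interval[OF t, of i] partition_in_unit_interval[OF t, of "Suc i"] c i
        by auto
      have "L (t i) - f i (\<gamma> (t i)) = L (t (Suc i)) - f i (\<gamma> (t (Suc i)))"
      proof (rule connected_local_const[of "{t i..t (Suc i)}" _ _ "\<lambda>s. L s - f i (\<gamma> s)"])
        show "\<forall>a\<in>{t i..t (Suc i)}. \<forall>\<^sub>F b in at a within {t i..t (Suc i)}.
             L a - f i (\<gamma> a) = L b - f i (\<gamma> b)"
        proof
          fix s assume s: "s \<in> {t i..t (Suc i)}"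
          have "\<forall>\<^sub>F b in at s within {0..1}. L b - f i (\<gamma> b) = L s - f i (\<gamma> s)"
            using c i s sub by (intro primitive_along_any_chart[OF \<omega> F \<gamma> G]) (auto simp: image_subset_iff)
          then have "\<forall>\<^sub>F b in at s within {t i..t (Suc i)}. L b - f i (\<gamma> b) = L s - f i (\<gamma> s)"
            using at_le[OF sub] unfolding le_filter_def by blast
          then show "\<forall>\<^sub>F b in at s within {t i..t (Suc i)}. L s - f i (\<gamma> s) = L b - f i (\<gamma> b)"
            by eventually_elim simp
        qed
      qed (use c i in \<open>auto intro: less_imp_le\<close>)
      then show ?thesis by simp
    qed
    then have "(\<Sum>i<m. f i (\<gamma> (t (Suc i))) - f i (\<gamma> (t i))) = (\<Sum>i<m. L (t (Suc i)) - L (t i))"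
      by simp
    also have "\<dots> = L (t m) - L (t 0)" by (rule sum_lessThan_telescope)
    finally show ?thesis using t by simp
  qed
  obtain m :: nat and t U f where d: "t 0 = 0" "t m = 1"
    "\<forall>i<m. t i < t (Suc i) \<and> (U i, f i) \<in> \<F> \<and> \<gamma> ` {t i..t (Suc i)} \<subseteq> U i"
    by (rule chart_subdivision_exists[OF closed_forms_memberD[OF \<omega> F(1)] \<gamma>])
  show ?thesis
    unfolding path_integral_def
  proof (rule the_equality)
    show "\<exists>\<F>\<in>\<omega>. \<exists>(m::nat) t U f. t 0 = 0 \<and> t m = 1 \<and>
        (\<forall>i<m. t i < t (Suc i) \<and> (U i, f i) \<in> \<F> \<and> \<gamma> ` {t i..t (Suc i)} \<subseteq> U i) \<and>
        L 1 - L 0 = (\<Sum>i<m. f i (\<gamma> (t (Suc i))) - f i (\<gamma> (t i)))"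
      by (rule bexI[OF _ F(1)], rule exI[of _ m], rule exI[of _ t], rule exI[of _ U], rule exI[of _ f])
        (use d val[OF F(1) d] in simp)
  qed (elim bexE exE conjE, simp only: val)
qed

lemma path_integral_in_chart:
  assumes \<omega>: "\<omega> \<in> closed_forms X" and F: "\<F> \<in> \<omega>" "(U, f) \<in> \<F>"
    and \<gamma>: "continuous_map (top_of_set {0..1}) X \<gamma>" "\<gamma> ` {0..1} \<subseteq> U"
  shows "path_integral \<omega> \<gamma> = f (\<gamma> 1) - f (\<gamma> 0)"
proof (rule path_integral_primitive[OF \<omega> F(1) _ \<gamma>(1)])
  show "primitive_along \<F> \<gamma> {0..1} (\<lambda>t. f (\<gamma> t))"
    unfolding primitive_along_def
  proof
    fix s :: real assume "s \<in> {0..1}"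
    then have "\<gamma> s \<in> U" using \<gamma>(2) by blast
    then show "\<exists>(V, g)\<in>\<F>. \<gamma> s \<in> V \<and>
        (\<forall>\<^sub>F t in at s within {0..1}. f (\<gamma> t) - g (\<gamma> t) = f (\<gamma> s) - g (\<gamma> s))"
      by (intro bexI[OF _ F(2)]) simp
  qed
qed


section \<open>Cochains evaluated on paths\<close>

text \<open>The barycentric coordinate \<open>v 1\<close> is the parameter, as in
  \<open>closed_form_cocycle\<close>; the restriction gives the default value that singular
  simplices have off the standard simplex.\<close>

definition path_simplex :: "(real \<Rightarrow> 'a) \<Rightarrow> (nat \<Rightarrow> real) \<Rightarrow> 'a" where
  "path_simplex \<gamma> = (\<lambda>v\<in>standard_simplex 1. \<gamma> (v 1))"

definition edge_point :: "real \<Rightarrow> nat \<Rightarrow> real" where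
  "edge_point t = (\<lambda>i. if i = 0 then 1 - t else if i = 1 then t else 0)"

definition triangle_point :: "real \<times> real \<Rightarrow> nat \<Rightarrow> real" where
  "triangle_point p = (\<lambda>i. if i = 0 then 1 - fst p - snd p else if i = 1 then fst p
     else if i = 2 then snd p else 0)"

definition triangle :: "(real \<times> real) set" where
  "triangle = {(s, t). 0 \<le> s \<and> 0 \<le> t \<and> s + t \<le> 1}"

lemma standard_simplex_1: "v \<in> standard_simplex 1 \<longleftrightarrow> (\<exists>t\<in>{0..1}. v = edge_point t)"
proof
  assume v: "v \<in> standard_simplex 1"
  then have "v 0 = 1 - v 1" "v 1 \<in> {0..1}" "\<And>i. i > 1 \<Longrightarrow> v i = 0"
    by (auto simp: standard_simplex_def)
  then have "v = edge_point (v 1)" by (auto simp: edge_point_def)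
  then show "\<exists>t\<in>{0..1}. v = edge_point t" using \<open>v 1 \<in> {0..1}\<close> by blast
qed (auto simp: standard_simplex_def edge_point_def)

lemma sum_atMost_2: "(\<Sum>k\<le>2. f k) = f 0 + f 1 + f (2::nat)"
  by (simp add: numeral_2_eq_2)

lemma standard_simplex_2: "v \<in> standard_simplex 2 \<longleftrightarrow> (\<exists>p\<in>triangle. v = triangle_point p)"
proof
  assume v: "v \<in> standard_simplex 2"
  have v0: "v 0 = 1 - v 1 - v 2" and v01: "\<And>i. 0 \<le> v i" and z: "\<And>i. i > 2 \<Longrightarrow> v i = 0"
    using v by (auto simp: standard_simplex_def sum_atMost_2)
  have "v i = triangle_point (v 1, v 2) i" for i
    using v0 z[of i] by (auto simp: triangle_point_def)
  moreover have "(v 1, v 2) \<in> triangle"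
    using v0 v01[of 0] v01[of 1] v01[of 2] by (simp add: triangle_def)
  ultimately show "\<exists>p\<in>triangle. v = triangle_point p" by blast
next
  assume "\<exists>p\<in>triangle. v = triangle_point p"
  then obtain s t where st: "0 \<le> s" "0 \<le> t" "s + t \<le> 1" "v = triangle_point (s, t)"
    by (auto simp: triangle_def)
  then have "0 \<le> v i \<and> v i \<le> 1" for i by (simp add: triangle_point_def)
  moreover have "v i = 0" if "i > 2" for i using that st(4) by (simp add: triangle_point_def)
  moreover have "(\<Sum>i\<le>2. v i) = 1" unfolding sum_atMost_2 st(4) by (simp add: triangle_point_def)
  ultimately show "v \<in> standard_simplex 2" by (simp add: standard_simplex_def)
qed

lemma continuous_map_edge_point:
  "continuous_map (top_of_set {0..1}) (subtopology (powertop_real UNIV) (standard_simplex 1)) edge_point"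
proof -
  have "continuous_on {0..1} (\<lambda>t. edge_point t i)" for i
    unfolding edge_point_def
    by (cases "i = 0"; cases "i = 1") (auto intro!: continuous_on_diff continuous_on_const continuous_on_id)
  then show ?thesis
    unfolding continuous_map_in_subtopology continuous_map_componentwise_UNIV
    using standard_simplex_1 by fastforce
qed

lemma continuous_map_triangle_point:
  "continuous_map (top_of_set triangle) (subtopology (powertop_real UNIV) (standard_simplex 2)) triangle_point"
proof -
  have "continuous_on triangle (\<lambda>t. triangle_point t i)" for i
    unfolding triangle_point_def
    by (cases "i = 0"; cases "i = 1"; cases "i = 2")
      (auto intro!: continuous_on_diff continuous_on_const continuous_on_fst continuous_on_snd continuous_on_id)
  then show ?thesis
    unfolding continuous_map_in_subtopology continuous_map_componentwise_UNIV
    using standard_simplex_2 by fastforce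
qed

lemma continuous_map_simplex_coordinate:
  "continuous_map (subtopology (powertop_real UNIV) S) euclideanreal (\<lambda>v. v i)"
  by (intro continuous_map_from_subtopology continuous_map_product_projection) simp

lemma singular_simplex_path_simplex:
  assumes "continuous_map (top_of_set {0..1}) X \<gamma>"
  shows "singular_simplex 1 X (path_simplex \<gamma>)"
proof -
  let ?S = "subtopology (powertop_real UNIV) (standard_simplex 1)"
  have "continuous_map ?S (top_of_set {0..1}) (\<lambda>v. v 1)"
    unfolding continuous_map_in_subtopology
    using continuous_map_simplex_coordinate by (auto simp: standard_simplex_def)
  from continuous_map_compose[OF this assms]
  have "continuous_map ?S X (\<lambda>v. \<gamma> (v 1))" by (simp add: o_def)
  then have "continuous_map ?S X (path_simplex \<gamma>)"
    by (rule continuous_map_eq) (simp add: path_simplex_def)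
  then show ?thesis by (simp add: singular_simplex_def path_simplex_def)
qed

lemma edge_point_in: "t \<in> {0..1} \<Longrightarrow> edge_point t \<in> standard_simplex 1"
  using standard_simplex_1 by blast

lemma triangle_point_in [simp]: "p \<in> triangle \<Longrightarrow> triangle_point p \<in> standard_simplex 2"
  by (auto simp: standard_simplex_2)

lemma path_simplex_edge_point: "t \<in> {0..1} \<Longrightarrow> path_simplex \<gamma> (edge_point t) = \<gamma> t"
  using edge_point_in[of t] by (simp add: path_simplex_def del: One_nat_def) (simp add: edge_point_def)

lemma singular_simplex_1E:
  assumes "singular_simplex 1 X \<sigma>"
  shows "continuous_map (top_of_set {0..1}) X (\<lambda>t. \<sigma> (edge_point t))"
    and "\<sigma> = path_simplex (\<lambda>t. \<sigma> (edge_point t))"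
proof -
  show "continuous_map (top_of_set {0..1}) X (\<lambda>t. \<sigma> (edge_point t))"
    using continuous_map_compose[OF continuous_map_edge_point, of X \<sigma>] assms
    by (simp add: singular_simplex_def o_def)
  show "\<sigma> = path_simplex (\<lambda>t. \<sigma> (edge_point t))"
  proof
    fix v show "\<sigma> v = path_simplex (\<lambda>t. \<sigma> (edge_point t)) v"
    proof (cases "v \<in> standard_simplex 1")
      case True
      then obtain t where "t \<in> {0..1}" "v = edge_point t" using standard_simplex_1 by blast
      then show ?thesis by (simp add: path_simplex_edge_point)
    next
      case False
      then show ?thesis using assms
        by (simp add: path_simplex_def singular_simplex_def extensional_def)
    qed
  qed
qed

lemma path_simplex_cong:
  "(\<And>t. t \<in> {0..1} \<Longrightarrow> \<gamma> t = \<gamma>' t) \<Longrightarrow> path_simplex \<gamma> = path_simplex \<gamma>'"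
  unfolding path_simplex_def by (rule restrict_ext) (simp add: standard_simplex_def)

lemma simplical_face_edge_point:
  "simplical_face 0 (edge_point t) = triangle_point (1 - t, t)"
  "simplical_face 1 (edge_point t) = triangle_point (0, t)"
  "simplical_face 2 (edge_point t) = triangle_point (t, 0)"
  by (rule ext, auto simp: simplical_face_def edge_point_def triangle_point_def)+

lemma singular_face_2:
  assumes "k \<le> 2"
  shows "singular_face 2 k \<sigma> = path_simplex (\<lambda>t. \<sigma> (simplical_face k (edge_point t)))"
proof
  fix v show "singular_face 2 k \<sigma> v = path_simplex (\<lambda>t. \<sigma> (simplical_face k (edge_point t))) v"
  proof (cases "v \<in> standard_simplex 1")
    case True
    then obtain t where "t \<in> {0..1}" "v = edge_point t" using standard_simplex_1 by blast
    then show ?thesis using edge_point_in[of t]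
      by (simp add: path_simplex_edge_point) (simp add: singular_face_def)
  qed (simp add: singular_face_def path_simplex_def)
qed

lemma coboundary_map_1:
  assumes "singular_simplex 2 X \<sigma>"
  shows "coboundary_map 1 X c \<sigma> =
    c (path_simplex (\<lambda>t. \<sigma> (triangle_point (1 - t, t)))) - c (path_simplex (\<lambda>t. \<sigma> (triangle_point (0, t))))
    + c (path_simplex (\<lambda>t. \<sigma> (triangle_point (t, 0))))"
proof -
  have "singular_simplex (Suc 1) X \<sigma>" using assms by (simp add: numeral_2_eq_2)
  then have "coboundary_map 1 X c \<sigma> = c (singular_face 2 0 \<sigma>) - c (singular_face 2 1 \<sigma>) + c (singular_face 2 2 \<sigma>)"
    unfolding coboundary_map_def by (simp add: numeral_2_eq_2)
  then show ?thesis
    by (simp add: singular_face_2 simplical_face_edge_point simplical_face_edge_point(2)[unfolded One_nat_def])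
qed

text \<open>Restates the cocycle condition for maps of a plane triangle, so that later homotopies
  can be written without simplices. Face 0 is the hypotenuse.\<close>

lemma cocycle_triangle:
  assumes c: "c \<in> carrier (cocycle_group 1 X)" and \<tau>: "continuous_map (top_of_set triangle) X \<tau>"
  shows "c (path_simplex (\<lambda>t. \<tau> (t, 0))) + c (path_simplex (\<lambda>t. \<tau> (1 - t, t))) =
    c (path_simplex (\<lambda>t. \<tau> (0, t)))"
proof -
  let ?S = "subtopology (powertop_real UNIV) (standard_simplex 2)"
  define \<sigma> where "\<sigma> = (\<lambda>v\<in>standard_simplex 2. \<tau> (v 1, v 2))"
  have "continuous_map ?S (top_of_set triangle) (\<lambda>v. (v 1, v 2))"
  proof -
    have "continuous_map ?S (prod_topology euclideanreal euclideanreal) (\<lambda>v. (v 1, v 2))"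
      by (intro continuous_map_pairedI continuous_map_simplex_coordinate)
    moreover have "(v 1, v 2) \<in> triangle" if "v \<in> standard_simplex 2" for v
      using that unfolding standard_simplex_2 by (auto simp: triangle_point_def)
    ultimately show ?thesis unfolding continuous_map_in_subtopology by auto
  qed
  from continuous_map_compose[OF this \<tau>]
  have "continuous_map ?S X (\<lambda>v. \<tau> (v 1, v 2))" by (simp add: o_def)
  then have "continuous_map ?S X \<sigma>"
    by (rule continuous_map_eq) (simp add: \<sigma>_def)
  then have s: "singular_simplex 2 X \<sigma>" by (simp add: singular_simplex_def \<sigma>_def)
  have eq: "\<sigma> (triangle_point p) = \<tau> p" if "p \<in> triangle" for p
    using that unfolding \<sigma>_def by (simp, simp add: triangle_point_def)
  have "coboundary_map 1 X c \<sigma> = 0" using c by (simp add: cocycle_group_def)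
  then have "c (path_simplex (\<lambda>t. \<sigma> (triangle_point (1 - t, t)))) - c (path_simplex (\<lambda>t. \<sigma> (triangle_point (0, t))))
    + c (path_simplex (\<lambda>t. \<sigma> (triangle_point (t, 0)))) = 0"
    using coboundary_map_1[OF s] by metis
  moreover have "path_simplex (\<lambda>t. \<sigma> (triangle_point (1 - t, t))) = path_simplex (\<lambda>t. \<tau> (1 - t, t))"
    "path_simplex (\<lambda>t. \<sigma> (triangle_point (0, t))) = path_simplex (\<lambda>t. \<tau> (0, t))"
    "path_simplex (\<lambda>t. \<sigma> (triangle_point (t, 0))) = path_simplex (\<lambda>t. \<tau> (t, 0))"
    by (intro path_simplex_cong eq; simp add: triangle_def)+
  ultimately show ?thesis by simp
qed

lemma cocycleI:
  assumes c: "c \<in> carrier (cochain_group 1 X)"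
    and tri: "\<And>\<tau>. continuous_map (top_of_set triangle) X \<tau> \<Longrightarrow>
      c (path_simplex (\<lambda>t. \<tau> (t, 0))) + c (path_simplex (\<lambda>t. \<tau> (1 - t, t))) =
      c (path_simplex (\<lambda>t. \<tau> (0, t)))"
  shows "c \<in> carrier (cocycle_group 1 X)"
proof -
  have "coboundary_map 1 X c \<sigma> = 0" for \<sigma>
  proof (cases "singular_simplex 2 X \<sigma>")
    case True
    then have "continuous_map (top_of_set triangle) X (\<lambda>p. \<sigma> (triangle_point p))"
      using continuous_map_compose[OF continuous_map_triangle_point, of X \<sigma>]
      by (simp add: singular_simplex_def o_def)
    from tri[OF this] show ?thesis unfolding coboundary_map_1[OF True] by simp
  next
    case False
    then show ?thesis by (simp add: coboundary_map_def numeral_2_eq_2)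
  qed
  then show ?thesis using c by (auto simp: cocycle_group_def)
qed

lemma coboundary_map_0:
  assumes "singular_simplex 1 X \<sigma>"
  shows "coboundary_map 0 X g \<sigma> =
    g (\<lambda>v\<in>standard_simplex 0. \<sigma> (edge_point 1)) - g (\<lambda>v\<in>standard_simplex 0. \<sigma> (edge_point 0))"
proof -
  have "simplical_face 0 v = edge_point 1" "simplical_face (Suc 0) v = edge_point 0"
    if "v \<in> standard_simplex 0" for v
    using that by (auto simp: standard_simplex_0 simplical_face_def edge_point_def fun_eq_iff)
  then have "singular_face (Suc 0) 0 \<sigma> = (\<lambda>v\<in>standard_simplex 0. \<sigma> (edge_point 1))"
    "singular_face (Suc 0) (Suc 0) \<sigma> = (\<lambda>v\<in>standard_simplex 0. \<sigma> (edge_point 0))"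
    unfolding singular_face_def by (auto intro!: restrict_ext)
  then show ?thesis using assms by (simp add: coboundary_map_def)
qed

text \<open>A 0-cochain is a potential on points, because a singular 0-simplex amounts to its one
  value.\<close>

lemma coboundariesI:
  assumes c: "c \<in> carrier (cochain_group 1 X)"
    and u: "\<And>\<gamma>. continuous_map (top_of_set {0..1}) X \<gamma> \<Longrightarrow> c (path_simplex \<gamma>) = u (\<gamma> 1) - u (\<gamma> 0)"
  shows "c \<in> coboundaries 1 X"
proof -
  define g where "g \<sigma> = (if singular_simplex 0 X \<sigma> then u (\<sigma> (\<lambda>j. if j = 0 then 1 else 0)) else 0)" for \<sigma>
  have pt: "g (\<lambda>v\<in>standard_simplex 0. x) = u x" if "x \<in> topspace X" for x
  proof -
    have "continuous_map (subtopology (powertop_real UNIV) (standard_simplex 0)) X (\<lambda>v\<in>standard_simplex 0. x)"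
      by (rule continuous_map_eq[of _ _ "\<lambda>v. x"]) (use that in auto)
    then show ?thesis by (simp add: g_def singular_simplex_def standard_simplex_0)
  qed
  have "c = coboundary_map 0 X g"
  proof
    fix \<sigma> show "c \<sigma> = coboundary_map 0 X g \<sigma>"
    proof (cases "singular_simplex 1 X \<sigma>")
      case True
      note E = singular_simplex_1E[OF True]
      have "\<sigma> (edge_point t) \<in> topspace X" if "t \<in> {0..1}" for t
        using E(1) that by (auto simp: continuous_map_def)
      then show ?thesis
        using u[OF E(1)] E(2) by (simp add: coboundary_map_0[OF True] pt)
    next
      case False
      then show ?thesis using c by (simp add: cochain_group_def coboundary_map_def)
    qed
  qed
  moreover have "g \<in> carrier (cochain_group 0 X)" by (simp add: cochain_group_def g_def)
  ultimately show ?thesis by (auto simp: coboundaries_def)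
qed

lemma coboundariesE:
  assumes "c \<in> coboundaries 1 X"
  obtains u where "\<And>\<gamma>. continuous_map (top_of_set {0..1}) X \<gamma> \<Longrightarrow> c (path_simplex \<gamma>) = u (\<gamma> 1) - u (\<gamma> 0)"
proof -
  obtain g where g: "c = coboundary_map 0 X g" using assms by (auto simp: coboundaries_def)
  show ?thesis
  proof (rule that[of "\<lambda>x. g (\<lambda>v\<in>standard_simplex 0. x)"])
    fix \<gamma> :: "real \<Rightarrow> 'a" assume "continuous_map (top_of_set {0..1}) X \<gamma>"
    then have "singular_simplex 1 X (path_simplex \<gamma>)" by (rule singular_simplex_path_simplex)
    then show "c (path_simplex \<gamma>) = g (\<lambda>v\<in>standard_simplex 0. \<gamma> 1) - g (\<lambda>v\<in>standard_simplex 0. \<gamma> 0)"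
      unfolding g by (simp add: coboundary_map_0 path_simplex_edge_point)
  qed
qed

lemma closed_form_cocycle_path_simplex:
  assumes "continuous_map (top_of_set {0..1}) X \<gamma>"
  shows "closed_form_cocycle X \<omega> (path_simplex \<gamma>) = path_integral \<omega> \<gamma>"
proof -
  have "closed_form_cocycle X \<omega> (path_simplex \<gamma>) = path_integral \<omega> (\<lambda>t. path_simplex \<gamma> (edge_point t))"
    using singular_simplex_path_simplex[OF assms] by (simp add: closed_form_cocycle_def edge_point_def)
  also have "\<dots> = path_integral \<omega> \<gamma>"
    by (rule path_integral_cong) (simp add: path_simplex_edge_point)
  finally show ?thesis .
qed

lemma closed_form_cocycle_cochain: "closed_form_cocycle X \<omega> \<in> carrier (cochain_group 1 X)"
  by (simp add: closed_form_cocycle_def cochain_group_def)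

section \<open>Cocycles on subpaths and squares\<close>

lemma cocycle_constant:
  assumes c: "c \<in> carrier (cocycle_group 1 X)" and "x \<in> topspace X"
  shows "c (path_simplex (\<lambda>_. x)) = 0"
  using cocycle_triangle[OF c, of "\<lambda>_. x"] assms(2) by simp

text \<open>The triangle is mapped affinely into an interval, with vertices at \<open>a\<close>,
  \<open>b\<close> and \<open>e\<close>.\<close>

lemma cocycle_subpath:
  assumes c: "c \<in> carrier (cocycle_group 1 X)" and \<gamma>: "continuous_map (top_of_set {a..d}) X \<gamma>"
    and le: "a \<le> b" "b \<le> e" "e \<le> (d::real)"
  shows "c (path_simplex (\<lambda>t. \<gamma> (a + t * (b - a)))) + c (path_simplex (\<lambda>t. \<gamma> (b + t * (e - b)))) =
    c (path_simplex (\<lambda>t. \<gamma> (a + t * (e - a))))"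
proof -
  define q where "q p = a + fst p * (b - a) + snd p * (e - a)" for p :: "real \<times> real"
  have "q p \<in> {a..d}" if "p \<in> triangle" for p
  proof -
    obtain s t where p: "p = (s, t)" "0 \<le> s" "0 \<le> t" "s + t \<le> 1"
      using \<open>p \<in> triangle\<close> by (auto simp: triangle_def)
    have "s * (b - a) \<le> s * (e - a)" using p le by (intro mult_left_mono) auto
    moreover have "(s + t) * (e - a) \<le> 1 * (e - a)" using p le by (intro mult_right_mono) auto
    moreover have "0 \<le> s * (b - a)" "0 \<le> t * (e - a)" using p le by auto
    ultimately show ?thesis using p le by (simp add: q_def algebra_simps)
  qed
  moreover have "continuous_on triangle q"
    unfolding q_def by (intro continuous_intros)
  ultimately have "continuous_map (top_of_set triangle) (top_of_set {a..d}) q" by auto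
  from continuous_map_compose[OF this \<gamma>]
  have "continuous_map (top_of_set triangle) X (\<lambda>p. \<gamma> (q p))" by (simp add: o_def)
  from cocycle_triangle[OF c this] show ?thesis
    by (simp add: q_def algebra_simps)
qed

lemma cocycle_square:
  assumes c: "c \<in> carrier (cocycle_group 1 X)"
    and \<kappa>: "continuous_map (top_of_set ({0..1} \<times> {0..1})) X \<kappa>"
  shows "c (path_simplex (\<lambda>t. \<kappa> (t, 0))) + c (path_simplex (\<lambda>t. \<kappa> (1, t))) =
    c (path_simplex (\<lambda>t. \<kappa> (0, t))) + c (path_simplex (\<lambda>t. \<kappa> (t, 1)))"
proof -
  have sub: "continuous_map (top_of_set triangle) X (\<lambda>p. \<kappa> (q p))"
    if "continuous_on triangle q" "\<And>p. p \<in> triangle \<Longrightarrow> q p \<in> {0..1} \<times> {0..1}" for q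
  proof -
    have "continuous_map (top_of_set triangle) (top_of_set ({0..1} \<times> {0..1})) q" using that by auto
    from continuous_map_compose[OF this \<kappa>] show ?thesis by (simp add: o_def)
  qed
  have "c (path_simplex (\<lambda>t. \<kappa> (t, 0))) + c (path_simplex (\<lambda>t. \<kappa> (1, t))) = c (path_simplex (\<lambda>t. \<kappa> (t, t)))"
  proof -
    have "continuous_map (top_of_set triangle) X (\<lambda>p. \<kappa> (fst p + snd p, snd p))"
      by (rule sub) (auto intro!: continuous_intros simp: triangle_def)
    from cocycle_triangle[OF c this] show ?thesis by simp
  qed
  moreover have "c (path_simplex (\<lambda>t. \<kappa> (0, t))) + c (path_simplex (\<lambda>t. \<kappa> (t, 1))) = c (path_simplex (\<lambda>t. \<kappa> (t, t)))"
  proof -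
    have "continuous_map (top_of_set triangle) X (\<lambda>p. \<kappa> (snd p, fst p + snd p))"
      by (rule sub) (auto intro!: continuous_intros simp: triangle_def)
    from cocycle_triangle[OF c this] show ?thesis by simp
  qed
  ultimately show ?thesis by simp
qed


section \<open>Cocycles with zero periods\<close>

definition angles :: "nat \<Rightarrow> (nat \<Rightarrow> nat \<Rightarrow> real) \<Rightarrow> nat \<Rightarrow> bouquet_point" where
  "angles k a = assemble k (\<lambda>i j. cis (a i j))"

text \<open>\<open>B\<close> holds the factors placed on the circle of the bouquet. For fixed
  \<open>B\<close> the condition is linear, so straight-line families of angles stay in the
  space.\<close>

definition admissible :: "nat \<Rightarrow> nat set \<Rightarrow> (nat \<Rightarrow> nat \<Rightarrow> real) \<Rightarrow> bool" where
  "admissible k B a \<longleftrightarrow> (\<forall>i\<in>{1..k}. if i \<in> B then a i 0 = 0 \<and> a i 1 = 0 else a i 2 = 0)"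

text \<open>The branch of the angle that jumps at \<open>\<zeta>\<close>, normalised to be 0 at 1:
  for unit numbers, \<open>- z / \<zeta>\<close> meets the cut of \<open>Arg\<close> exactly when
  \<open>z = \<zeta>\<close>.\<close>

definition angle_from :: "complex \<Rightarrow> complex \<Rightarrow> real" where
  "angle_from \<zeta> z = Arg (- z / \<zeta>) - Arg (- 1 / \<zeta>)"

definition avoiding :: "nat \<Rightarrow> complex \<Rightarrow> (nat \<Rightarrow> bouquet_point) set" where
  "avoiding k \<zeta> = {y \<in> power_set k. \<forall>i\<in>{1..k}. \<forall>j<3. crd j (y i) \<noteq> \<zeta>}"

lemma crd_angles [simp]: "i \<in> {1..k} \<Longrightarrow> j < 3 \<Longrightarrow> crd j (angles k a i) = cis (a i j)"
  by (simp add: angles_def)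

lemma angles_in_power_set: "admissible k B a \<Longrightarrow> angles k a \<in> power_set k"
  unfolding angles_def assemble_in_power_set_iff admissible_def by (auto split: if_splits)

lemma angles_cong:
  "(\<And>i j. i \<in> {1..k} \<Longrightarrow> j < 3 \<Longrightarrow> cis (a i j) = cis (b i j)) \<Longrightarrow> angles k a = angles k b"
  unfolding angles_def by (rule assemble_cong)

lemma continuous_on_angles:
  assumes "\<And>i j. i \<in> {1..k} \<Longrightarrow> j < 3 \<Longrightarrow> continuous_on S (\<lambda>x. a x i j)"
  shows "continuous_on S (\<lambda>x. angles k (a x))"
  unfolding angles_def by (intro continuous_on_assemble continuous_on_cis assms)

lemma admissible_lin:
  "admissible k B a \<Longrightarrow> admissible k B b \<Longrightarrow> admissible k B (\<lambda>i j. s * a i j + t * b i j)"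
  unfolding admissible_def by (simp split: if_splits)

lemma admissible_zero: "admissible k B (\<lambda>i j. 0)"
  by (auto simp: admissible_def)

lemma admissible_add:
  "admissible k B a \<Longrightarrow> admissible k B b \<Longrightarrow> admissible k B (\<lambda>i j. a i j + b i j)"
  using admissible_lin[of k B a b 1 1] by simp

lemma admissible_scale: "admissible k B a \<Longrightarrow> admissible k B (\<lambda>i j. t * a i j)"
  using admissible_lin[of k B a a 0 t] by simp

lemma cis_angle_from:
  assumes "norm z = 1" "norm \<zeta> = 1" shows "cis (angle_from \<zeta> z) = z"
proof -
  have "z \<noteq> 0" "\<zeta> \<noteq> 0" using assms by auto
  then have "cis (Arg (- z / \<zeta>)) = - z / \<zeta>" "cis (Arg (- 1 / \<zeta>)) = - 1 / \<zeta>"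
    using assms by (simp_all add: cis_Arg sgn_eq norm_divide)
  then show ?thesis using \<open>\<zeta> \<noteq> 0\<close> by (simp add: angle_from_def flip: cis_divide)
qed

lemma angle_from_1 [simp]: "angle_from \<zeta> 1 = 0"
  by (simp add: angle_from_def)

lemma continuous_on_angle_from:
  fixes f :: "'a::topological_space \<Rightarrow> complex"
  assumes f: "continuous_on S f" and "norm \<zeta> = 1"
    and S: "\<And>x. x \<in> S \<Longrightarrow> norm (f x) = 1 \<and> f x \<noteq> \<zeta>"
  shows "continuous_on S (\<lambda>x. angle_from \<zeta> (f x))"
proof -
  have z: "\<zeta> \<noteq> 0" using assms(2) by auto
  have "- f x / \<zeta> \<notin> \<real>\<^sub>\<le>\<^sub>0" if "x \<in> S" for x
  proof
    assume "- f x / \<zeta> \<in> \<real>\<^sub>\<le>\<^sub>0"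
    then obtain r where r: "- f x / \<zeta> = of_real r" "r \<le> 0" by (rule nonpos_Reals_cases) auto
    have "norm (- f x / \<zeta>) = 1" using S[OF that] assms(2) by (simp add: norm_divide)
    then have "r = -1" unfolding r(1) using r(2) by simp
    then have "f x = \<zeta>" using r(1) z by (simp add: field_simps)
    then show False using S[OF that] by simp
  qed
  then show ?thesis
    unfolding angle_from_def using z
    by (intro continuous_on_diff continuous_on_const continuous_on_Arg' continuous_on_divide
        continuous_on_minus f) auto
qed

text \<open>The angles lie in \<open>(0, 1]\<close> and \<open>1 < pi / 3\<close>, so the real parts
  exceed \<open>1 / 2\<close>, the threshold in \<open>movable_region\<close>. There are infinitely
  many of these points, so a point with finitely many coordinates avoids one of them.\<close>

definition zeta :: "nat \<Rightarrow> complex" where "zeta n = cis (1 / real (Suc n))"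

lemma norm_zeta [simp]: "norm (zeta n) = 1"
  by (simp add: zeta_def)

lemma Re_zeta: "Re (zeta n) > 1 / 2" and zeta_neq_1: "zeta n \<noteq> 1" and inj_zeta: "inj zeta"
proof -
  have b: "0 < 1 / real (Suc n)" "1 / real (Suc n) \<le> 1" for n by auto
  have "1 / real (Suc n) < pi / 3" using b(2)[of n] pi_gt3 by linarith
  then have "cos (pi / 3) < cos (1 / real (Suc n))"
    by (intro cos_monotone_0_pi) auto
  then show "Re (zeta n) > 1 / 2" by (simp add: zeta_def cos_60)
  have "Arg (zeta n) = 1 / real (Suc n)" for n
    unfolding zeta_def by (rule Arg_cis) (use b[of n] pi_gt3 in \<open>simp only: greaterThanAtMost_iff, linarith\<close>)
  then show "inj zeta" "zeta n \<noteq> 1"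
    by (metis (no_types, lifting) injI divide_cancel_left of_nat_eq_iff Suc_inject zero_neq_one,
        metis Arg_1 b(1) less_irrefl)
qed

lemma openin_avoiding: "openin (top_of_set (power_set k)) (avoiding k \<zeta>)"
proof -
  have "avoiding k \<zeta> = power_set k \<inter> (\<Inter>i\<in>{1..k}. \<Inter>j\<in>{..<3}. (\<lambda>y. crd j (y i)) -` (- {\<zeta>}))"
    by (auto simp: avoiding_def)
  moreover have "open (\<Inter>i\<in>{1..k}. \<Inter>j\<in>{..<3}. (\<lambda>y::nat \<Rightarrow> bouquet_point. crd j (y i)) -` (- {\<zeta>}))"
    by (intro open_INT finite_lessThan finite_atLeastAtMost ballI open_vimage continuous_on_crd_power
        continuous_on_id) auto
  ultimately show ?thesis by (simp add: openin_open_Int)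
qed

lemma avoiding_exists:
  fixes y :: "nat \<Rightarrow> bouquet_point"
  assumes "y \<in> power_set k" obtains n where "y \<in> avoiding k (zeta n)"
proof -
  let ?S = "(\<lambda>(i, j). crd j (y i)) ` ({1..k} \<times> {..<3})"
  have "infinite (range zeta)" using inj_zeta by (simp add: finite_image_iff)
  then have "\<not> range zeta \<subseteq> ?S" using finite_subset[of _ ?S] by auto
  then obtain n where "zeta n \<notin> ?S" by auto
  then have "crd j (y i) \<noteq> zeta n" if "i \<in> {1..k}" "j < 3" for i j
    using that by (force simp del: atLeastAtMost_iff)
  then have "y \<in> avoiding k (zeta n)" using assms by (simp add: avoiding_def)
  then show ?thesis by (rule that)
qed

lemma angles_angle_from:
  assumes "y \<in> power_set k" "norm \<zeta> = 1"
  shows "angles k (\<lambda>i j. angle_from \<zeta> (crd j (y i))) = y"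
proof -
  have "angles k (\<lambda>i j. angle_from \<zeta> (crd j (y i))) = assemble k (\<lambda>i j. crd j (y i))"
    unfolding angles_def by (rule assemble_cong) (use assms in \<open>simp add: cis_angle_from power_setD\<close>)
  then show ?thesis by (simp add: assemble_crd assms)
qed

lemma admissible_angle_from:
  assumes "y \<in> power_set k"
  shows "admissible k {i. crd 2 (y i) \<noteq> 1} (\<lambda>i j. angle_from \<zeta> (crd j (y i)))"
  unfolding admissible_def
proof
  fix i assume "i \<in> {1..k}"
  then have "crd 2 (y i) = 1 \<or> crd 0 (y i) = 1 \<and> crd 1 (y i) = 1"
    by (rule power_setD(2)[OF assms])
  then show "if i \<in> {i. crd 2 (y i) \<noteq> 1}
         then angle_from \<zeta> (crd 0 (y i)) = 0 \<and> angle_from \<zeta> (crd 1 (y i)) = 0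
         else angle_from \<zeta> (crd 2 (y i)) = 0"
    by (cases "crd 2 (y i) = 1") simp_all
qed

text \<open>Shrinking all angles contracts \<open>avoiding k \<zeta>\<close> to the base point when
  \<open>\<zeta>\<close> is not 1. The tracks also serve as paths for building potentials.\<close>

definition cone_point :: "nat \<Rightarrow> complex \<Rightarrow> real \<Rightarrow> (nat \<Rightarrow> bouquet_point) \<Rightarrow> nat \<Rightarrow> bouquet_point" where
  "cone_point k \<zeta> t y = angles k (\<lambda>i j. t * angle_from \<zeta> (crd j (y i)))"

lemma cone_point_in: "y \<in> power_set k \<Longrightarrow> cone_point k \<zeta> t y \<in> power_set k"
  unfolding cone_point_def by (rule angles_in_power_set[OF admissible_scale[OF admissible_angle_from]])

lemma cone_point_0: "cone_point k \<zeta> 0 y = angles k (\<lambda>i j. 0)"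
  by (simp add: cone_point_def)

lemma cone_point_1: "y \<in> power_set k \<Longrightarrow> norm \<zeta> = 1 \<Longrightarrow> cone_point k \<zeta> 1 y = y"
  by (simp add: cone_point_def angles_angle_from)

lemma continuous_on_cone_point:
  assumes "norm \<zeta> = 1" "continuous_on S f" "continuous_on S g" "\<And>x. x \<in> S \<Longrightarrow> g x \<in> avoiding k \<zeta>"
  shows "continuous_on S (\<lambda>x. cone_point k \<zeta> (f x) (g x))"
  unfolding cone_point_def
proof (intro continuous_on_angles continuous_on_mult continuous_on_angle_from assms(1,2) continuous_on_crd_power assms(3))
  fix i j x assume "i \<in> {1..k}" "j < (3::nat)" "x \<in> S"
  then show "norm (crd j (g x i)) = 1 \<and> crd j (g x i) \<noteq> \<zeta>"
    using assms(4)[of x] power_setD(1)[of "g x" k i j] by (auto simp: avoiding_def)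
qed

text \<open>Take the triangle with vertices \<open>0\<close>, \<open>d\<close> and
  \<open>d + d'\<close>. As \<open>d\<close> is a lattice vector, the edge from \<open>d\<close> to
  \<open>d + d'\<close> has the same image as the segment from \<open>0\<close> to
  \<open>d'\<close>.\<close>

lemma cocycle_lattice_add:
  assumes c: "c \<in> carrier (cocycle_group 1 (top_of_set (power_set k)))"
    and adm: "admissible k B d" "admissible k B d'"
    and lat: "\<And>i j. i \<in> {1..k} \<Longrightarrow> j < 3 \<Longrightarrow> cis (d i j) = 1"
  shows "c (path_simplex (\<lambda>t. angles k (\<lambda>i j. t * (d i j + d' i j)))) =
    c (path_simplex (\<lambda>t. angles k (\<lambda>i j. t * d i j))) + c (path_simplex (\<lambda>t. angles k (\<lambda>i j. t * d' i j)))"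
proof -
  define \<tau> where "\<tau> p = angles k (\<lambda>i j. fst p * d i j + snd p * (d i j + d' i j))" for p :: "real \<times> real"
  have "continuous_on triangle \<tau>"
    unfolding \<tau>_def by (intro continuous_on_angles continuous_intros)
  moreover have "\<tau> p \<in> power_set k" for p
    unfolding \<tau>_def by (rule angles_in_power_set[OF admissible_lin[OF adm(1) admissible_add[OF adm]]])
  ultimately have "continuous_map (top_of_set triangle) (top_of_set (power_set k)) \<tau>" by auto
  note tri = cocycle_triangle[OF c this]
  have "\<tau> (1 - t, t) = angles k (\<lambda>i j. t * d' i j)" for t
    unfolding \<tau>_def
  proof (rule angles_cong)
    fix i j assume "i \<in> {1..k}" "j < (3::nat)"
    then have "cis (d i j + t * d' i j) = cis (t * d' i j)" using lat by (simp flip: cis_mult)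
    then show "cis (fst (1 - t, t) * d i j + snd (1 - t, t) * (d i j + d' i j)) = cis (t * d' i j)"
      by (simp add: algebra_simps)
  qed
  moreover have "\<tau> (t, 0) = angles k (\<lambda>i j. t * d i j)"
    "\<tau> (0, t) = angles k (\<lambda>i j. t * (d i j + d' i j))" for t
    by (simp_all add: \<tau>_def)
  ultimately show ?thesis using tri by simp
qed

definition zero_periods :: "nat \<Rightarrow> (((nat \<Rightarrow> real) \<Rightarrow> nat \<Rightarrow> bouquet_point) \<Rightarrow> real) \<Rightarrow> bool" where
  "zero_periods k c \<longleftrightarrow> (\<forall>i\<in>{1..k}. \<forall>j<3.
     c (path_simplex (\<lambda>t. angles k (\<lambda>i' j'. t * (if i' = i \<and> j' = j then 2 * pi else 0)))) = 0)"

text \<open>\<open>Q\<close> is additive on the integers, so it vanishes together with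
  \<open>Q 1\<close>.\<close>

lemma cocycle_axis_zero:
  assumes c: "c \<in> carrier (cocycle_group 1 (top_of_set (power_set k)))"
    and z: "zero_periods k c" and ij: "i \<in> {1..k}" "j < 3"
  shows "c (path_simplex (\<lambda>t. angles k (\<lambda>i' j'. t * (if i' = i \<and> j' = j then 2 * pi * of_int n else 0)))) = 0"
proof -
  define E where "E m = (\<lambda>i' j'. if i' = i \<and> j' = j then 2 * pi * of_int m else 0)" for m :: int
  define Q where "Q m = c (path_simplex (\<lambda>t. angles k (\<lambda>i' j'. t * E m i' j')))" for m
  define B where "B = (if j = 2 then {i} else {})"
  have adm: "admissible k B (E m)" for m
    using ij by (auto simp: admissible_def E_def B_def elim!: less_3_cases)
  have lat: "cis (E m i' j') = 1" for m i' j'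
    using cis_multiple_2pi[of "of_int m"] by (simp add: E_def)
  have add: "Q (m + m') = Q m + Q m'" for m m'
  proof -
    have "E (m + m') i' j' = E m i' j' + E m' i' j'" for i' j'
      by (simp add: E_def algebra_simps)
    then show ?thesis unfolding Q_def
      using cocycle_lattice_add[OF c adm[of m] adm[of m'] lat] by simp
  qed
  have Q1: "Q 1 = 0" using z ij by (simp add: Q_def E_def zero_periods_def cong: if_cong)
  have Q0: "Q 0 = 0" using add[of 0 0] by simp
  have nat: "Q (int m) = 0" for m
    by (induction m) (use Q0 Q1 add in auto)
  have "Q n = 0"
  proof (cases "0 \<le> n")
    case True then show ?thesis using nat[of "nat n"] by simp
  next
    case False then show ?thesis using nat[of "nat (-n)"] add[of n "-n"] Q0 by simp
  qed
  then show ?thesis by (simp add: Q_def E_def)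
qed

text \<open>Axis vectors are split off one position at a time; the common \<open>B\<close> keeps all
  partial sums in the space.\<close>

lemma cocycle_lattice_zero:
  assumes c: "c \<in> carrier (cocycle_group 1 (top_of_set (power_set k)))"
    and z: "zero_periods k c" and adm: "admissible k B d"
    and lat: "\<And>i j. i \<in> {1..k} \<Longrightarrow> j < 3 \<Longrightarrow> cis (d i j) = 1"
  shows "c (path_simplex (\<lambda>t. angles k (\<lambda>i j. t * d i j))) = 0"
proof -
  have part: "c (path_simplex (\<lambda>t. angles k (\<lambda>i j. t * (if (i, j) \<in> S then d i j else 0)))) = 0"
    if "finite S" "S \<subseteq> {1..k} \<times> {..<3}" for S
    using that
  proof (induction S)
    case empty
    show ?case using cocycle_constant[OF c, of "angles k (\<lambda>i j. 0)"]
      angles_in_power_set[OF admissible_zero] by simp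
  next
    case (insert p S)
    obtain i j where p: "p = (i, j)" "i \<in> {1..k}" "j < 3" using insert.prems by auto
    obtain n :: int where n: "d i j = 2 * pi * of_int n" using lat[OF p(2,3)] by (blast elim: cis_eq_1_imp)
    define d1 where "d1 = (\<lambda>i' j'. if i' = i \<and> j' = j then 2 * pi * of_int n else 0)"
    define d2 where "d2 = (\<lambda>i j. if (i, j) \<in> S then d i j else 0)"
    have "admissible k B d1" "admissible k B d2"
      using adm n by (auto simp: admissible_def d1_def d2_def)
    moreover have "cis (d1 i' j') = 1" for i' j'
      using cis_multiple_2pi[of "of_int n"] by (simp add: d1_def)
    ultimately have "c (path_simplex (\<lambda>t. angles k (\<lambda>i j. t * (d1 i j + d2 i j)))) =
      c (path_simplex (\<lambda>t. angles k (\<lambda>i j. t * d1 i j))) + c (path_simplex (\<lambda>t. angles k (\<lambda>i j. t * d2 i j)))"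
      by (intro cocycle_lattice_add[OF c]) auto
    also have "\<dots> = 0"
      using cocycle_axis_zero[OF c z p(2,3)] insert by (simp add: d1_def d2_def)
    also have "(\<lambda>i j. d1 i j + d2 i j) = (\<lambda>i j. if (i, j) \<in> insert p S then d i j else 0)"
      using insert.hyps p n by (auto simp: d1_def d2_def fun_eq_iff)
    then have "\<And>i j. d1 i j + d2 i j = (if (i, j) \<in> insert p S then d i j else 0)"
      by meson
    ultimately show ?case by simp
  qed
  have "angles k (\<lambda>i j. t * (if (i, j) \<in> {1..k} \<times> {..<3} then d i j else 0)) = angles k (\<lambda>i j. t * d i j)" for t
    by (rule angles_cong) auto
  then show ?thesis using part[of "{1..k} \<times> {..<3}"] by simp
qed

text \<open>The angle vectors of the two cone paths to \<open>y\<close> differ by a lattice vector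
  \<open>d\<close>. A triangle turns the difference of the values into the value on the segment from
  \<open>a'\<close> to \<open>a\<close>, and a square slides this segment along \<open>a'\<close> to
  the loop of \<open>d\<close>, where the cocycle is 0.\<close>

lemma cocycle_cone_independent:
  assumes c: "c \<in> carrier (cocycle_group 1 (top_of_set (power_set k)))"
    and z: "zero_periods k c" and y: "y \<in> power_set k" and n: "norm \<zeta> = 1" "norm \<eta> = 1"
  shows "c (path_simplex (\<lambda>t. cone_point k \<zeta> t y)) = c (path_simplex (\<lambda>t. cone_point k \<eta> t y))"
proof -
  define a where "a = (\<lambda>i j. angle_from \<zeta> (crd j (y i)))"
  define a' where "a' = (\<lambda>i j. angle_from \<eta> (crd j (y i)))"
  define d where "d i j = a i j - a' i j" for i j
  define B where "B = {i. crd 2 (y i) \<noteq> 1}"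
  have adm: "admissible k B a" "admissible k B a'"
    unfolding a_def a'_def B_def using admissible_angle_from[OF y] by auto
  have admd: "admissible k B d"
    using adm unfolding admissible_def d_def by (simp split: if_splits)
  have lat: "cis (d i j) = 1" if "i \<in> {1..k}" "j < 3" for i j
  proof -
    have "norm (crd j (y i)) = 1" using y that power_setD(1) by blast
    then show ?thesis unfolding d_def a_def a'_def
      using n by (auto simp: cis_angle_from simp flip: cis_divide)
  qed
  define P where "P a d = c (path_simplex (\<lambda>t. angles k (\<lambda>i j. a i j + t * d i j)))" for a d
  have zero: "P (\<lambda>i j. 0) d = 0"
    unfolding P_def using cocycle_lattice_zero[OF c z admd lat] by simp
  have cone: "c (path_simplex (\<lambda>t. cone_point k \<zeta> t y)) = P (\<lambda>i j. 0) a"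
    "c (path_simplex (\<lambda>t. cone_point k \<eta> t y)) = P (\<lambda>i j. 0) a'"
    by (simp_all add: P_def cone_point_def a_def a'_def)
  have map: "continuous_map (top_of_set S) (top_of_set (power_set k))
      (\<lambda>p. angles k (\<lambda>i j. fst p * b i j + snd p * b' i j))"
    if "admissible k B b" "admissible k B b'" for S :: "(real \<times> real) set" and b b'
    using angles_in_power_set[OF admissible_lin[OF that]]
    by (auto intro!: continuous_on_angles continuous_on_add continuous_on_mult continuous_on_fst
        continuous_on_snd continuous_on_const continuous_on_id)
  have 1: "P (\<lambda>i j. 0) a' + P a' d = P (\<lambda>i j. 0) a"
  proof -
    have "(1 - t) * a' i j + t * a i j = a' i j + t * d i j" for t i j
      by (simp add: d_def algebra_simps)
    then show ?thesis
      using cocycle_triangle[OF c map[OF adm(2,1)]] by (simp add: P_def)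
  qed
  have 2: "P (\<lambda>i j. 0) d + P (\<lambda>i j. 0) a' = P (\<lambda>i j. 0) a' + P a' d"
  proof -
    have "angles k (\<lambda>i j. d i j + t * a' i j) = angles k (\<lambda>i j. t * a' i j)" for t
      by (rule angles_cong) (simp add: lat flip: cis_mult)
    then show ?thesis
      using cocycle_square[OF c map[OF admd adm(2)]] by (simp add: P_def add.commute)
  qed
  show ?thesis using 1 2 zero cone by simp
qed

text \<open>The potential \<open>u\<close> is the value on the cone path to a point. Every
  \<open>zeta n\<close> gives the same value, so near each point one may use a cone that depends
  continuously on its end. A square then settles short paths, and \<open>Bolzano\<close> all
  others.\<close>

lemma cocycle_zero_periods_exact:
  assumes c: "c \<in> carrier (cocycle_group 1 (top_of_set (power_set k)))" and z: "zero_periods k c"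
  shows "c \<in> coboundaries 1 (top_of_set (power_set k))"
proof (rule coboundariesI)
  show "c \<in> carrier (cochain_group 1 (top_of_set (power_set k)))"
    using c by (simp add: cocycle_group_def)
next
  define u where "u y = c (path_simplex (\<lambda>t. cone_point k (zeta 0) t y))" for y
  have loc: "c (path_simplex \<gamma>) = u (\<gamma> 1) - u (\<gamma> 0)"
    if \<gamma>: "continuous_on {0..1} \<gamma>" "\<And>t. t \<in> {0..1} \<Longrightarrow> \<gamma> t \<in> avoiding k (zeta n)" for \<gamma> n
  proof -
    have in_power: "\<gamma> t \<in> power_set k" if "t \<in> {0..1}" for t
      using \<gamma>(2)[OF that] by (simp add: avoiding_def)
    have "continuous_on ({0..1} \<times> {0..1}) (\<lambda>p. cone_point k (zeta n) (fst p) (\<gamma> (snd p)))"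
    proof (rule continuous_on_cone_point)
      show "continuous_on ({0..1} \<times> {0..1}) (\<lambda>p::real \<times> real. \<gamma> (snd p))"
        by (rule continuous_on_compose2[OF \<gamma>(1)]) (auto intro!: continuous_on_snd continuous_on_id)
    qed (use \<gamma>(2) in \<open>auto intro!: continuous_on_fst continuous_on_id\<close>)
    then have "continuous_map (top_of_set ({0..1} \<times> {0..1})) (top_of_set (power_set k))
        (\<lambda>p. cone_point k (zeta n) (fst p) (\<gamma> (snd p)))"
      using in_power cone_point_in by auto
    from cocycle_square[OF c this]
    have "c (path_simplex (\<lambda>t. cone_point k (zeta n) t (\<gamma> 0))) + c (path_simplex (\<lambda>t. cone_point k (zeta n) 1 (\<gamma> t))) =
      c (path_simplex (\<lambda>t. cone_point k (zeta n) 0 (\<gamma> t))) + c (path_simplex (\<lambda>t. cone_point k (zeta n) t (\<gamma> 1)))"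
      by simp
    moreover have "path_simplex (\<lambda>t. cone_point k (zeta n) 1 (\<gamma> t)) = path_simplex \<gamma>"
      by (rule path_simplex_cong) (simp add: cone_point_1 in_power)
    moreover have "c (path_simplex (\<lambda>t. cone_point k (zeta n) 0 (\<gamma> t))) = 0"
      using cocycle_constant[OF c, of "angles k (\<lambda>i j. 0)"] angles_in_power_set[OF admissible_zero]
      by (simp add: cone_point_0)
    moreover have "c (path_simplex (\<lambda>t. cone_point k (zeta n) t y)) = u y" if "y \<in> power_set k" for y
      unfolding u_def by (rule cocycle_cone_independent[OF c z that]) auto
    ultimately show ?thesis using in_power[of 0] in_power[of 1] by simp
  qed
  fix \<gamma> :: "real \<Rightarrow> nat \<Rightarrow> bouquet_point"
  assume "continuous_map (top_of_set {0..1}) (top_of_set (power_set k)) \<gamma>"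
  then have \<gamma>: "continuous_on {0..1} \<gamma>" "\<And>t. t \<in> {0..1} \<Longrightarrow> \<gamma> t \<in> power_set k" by auto
  define P where "P a b \<longleftrightarrow> (0 \<le> a \<and> a \<le> b \<and> b \<le> 1 \<longrightarrow>
    c (path_simplex (\<lambda>t. \<gamma> (a + t * (b - a)))) = u (\<gamma> b) - u (\<gamma> a))" for a b
  have "P 0 1"
  proof (rule Bolzano)
    fix a b d assume "P a b" "P b d" "a \<le> b" "b \<le> d"
    show "P a d"
      unfolding P_def
    proof
      assume ad: "0 \<le> a \<and> a \<le> d \<and> d \<le> 1"
      have "continuous_map (top_of_set {a..d}) (top_of_set (power_set k)) \<gamma>"
        using \<gamma> ad by (auto intro: continuous_on_subset)
      from cocycle_subpath[OF c this \<open>a \<le> b\<close> \<open>b \<le> d\<close>]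
      show "c (path_simplex (\<lambda>t. \<gamma> (a + t * (d - a)))) = u (\<gamma> d) - u (\<gamma> a)"
        using \<open>P a b\<close> \<open>P b d\<close> ad \<open>a \<le> b\<close> \<open>b \<le> d\<close> by (simp add: P_def)
    qed
  next
    fix x :: real assume x: "0 \<le> x" "x \<le> 1"
    obtain n where n: "\<gamma> x \<in> avoiding k (zeta n)"
      using avoiding_exists[OF \<gamma>(2)[of x]] x by auto
    have "continuous_map (top_of_set {0..1}) (top_of_set (power_set k)) \<gamma>" using \<gamma> by auto
    from eventually_path_in_openin[OF this openin_avoiding _ n] x
    obtain e where e: "e > 0" "\<And>t. t \<in> {0..1} \<Longrightarrow> dist t x < e \<Longrightarrow> \<gamma> t \<in> avoiding k (zeta n)"
      unfolding eventually_at using n by (metis atLeastAtMost_iff)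
    have "P a b" if ab: "a \<le> x" "x \<le> b" "b - a < e" for a b
      unfolding P_def
    proof
      assume 01: "0 \<le> a \<and> a \<le> b \<and> b \<le> 1"
      have t: "a \<le> a + t * (b - a)" "a + t * (b - a) \<le> b" if "t \<in> {0..1}" for t
        using that 01 mult_right_mono[of t 1 "b - a"] by auto
      have "continuous_on {0..1} (\<lambda>t. \<gamma> (a + t * (b - a)))"
        by (rule continuous_on_compose2[OF \<gamma>(1)])
          (use t 01 in \<open>fastforce intro!: continuous_on_add continuous_on_mult continuous_on_const continuous_on_id\<close>)+
      moreover have "\<gamma> (a + t * (b - a)) \<in> avoiding k (zeta n)" if "t \<in> {0..1}" for t
        using t[OF that] 01 ab by (intro e(2)) (auto simp: dist_real_def)
      ultimately show "c (path_simplex (\<lambda>t. \<gamma> (a + t * (b - a)))) = u (\<gamma> b) - u (\<gamma> a)"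
        using loc[of "\<lambda>t. \<gamma> (a + t * (b - a))" n] by simp
    qed
    then show "\<exists>d>0. \<forall>a b. a \<le> x \<and> x \<le> b \<and> b - a < d \<longrightarrow> P a b" using e(1) by blast
  qed simp
  then show "c (path_simplex \<gamma>) = u (\<gamma> 1) - u (\<gamma> 0)" by (simp add: P_def)
qed


section \<open>Linear forms\<close>

lemma convex_angle_lift:
  fixes f :: "'a::real_normed_vector \<Rightarrow> complex"
  assumes "convex S" "continuous_on S f" "\<And>x. x \<in> S \<Longrightarrow> norm (f x) = 1"
  obtains L where "continuous_on S L" "\<And>x. x \<in> S \<Longrightarrow> f x = cis (L x)"
proof -
  have nz: "f x \<noteq> 0" if "x \<in> S" for x using assms(3)[OF that] by auto
  obtain g where g: "continuous_on S g" "\<And>x. x \<in> S \<Longrightarrow> f x = exp (g x)"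
    using continuous_logarithm_on_contractible[OF assms(2) convex_imp_contractible[OF assms(1)] nz] by blast
  show ?thesis
  proof (rule that[of "\<lambda>x. Im (g x)"])
    show "f x = cis (Im (g x))" if "x \<in> S" for x
    proof -
      have "exp (Re (g x)) = 1" using assms(3)[OF that] g(2)[OF that] by simp
      then show ?thesis using g(2)[OF that] exp_eq_polar[of "g x"] by simp
    qed
  qed (intro continuous_on_Im g(1))
qed

definition angle_sum :: "nat \<Rightarrow> (nat \<Rightarrow> nat \<Rightarrow> real) \<Rightarrow> (nat \<Rightarrow> nat \<Rightarrow> real) \<Rightarrow> real" where
  "angle_sum k W a = (\<Sum>i\<in>{1..k}. \<Sum>j<3. W i j * a i j)"

text \<open>Charts of the form \<open>\<Sum> W i j * d(angle i j)\<close>, one for each choice of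
  branch.\<close>

definition linear_family :: "nat \<Rightarrow> (nat \<Rightarrow> nat \<Rightarrow> real) \<Rightarrow>
    ((nat \<Rightarrow> bouquet_point) set \<times> ((nat \<Rightarrow> bouquet_point) \<Rightarrow> real)) set" where
  "linear_family k W = range (\<lambda>n. (avoiding k (zeta n),
     \<lambda>y. angle_sum k W (\<lambda>i j. angle_from (zeta n) (crd j (y i)))))"

lemma angle_sum_diff: "angle_sum k W a - angle_sum k W b = angle_sum k W (\<lambda>i j. a i j - b i j)"
  by (simp add: angle_sum_def sum_subtractf right_diff_distrib)

lemma angle_sum_cong:
  "(\<And>i j. i \<in> {1..k} \<Longrightarrow> j < 3 \<Longrightarrow> a i j = b i j) \<Longrightarrow> angle_sum k W a = angle_sum k W b"
  unfolding angle_sum_def by (intro sum.cong refl) auto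

lemma continuous_on_angle_sum:
  assumes "\<And>i j. i \<in> {1..k} \<Longrightarrow> j < 3 \<Longrightarrow> continuous_on S (\<lambda>x. a x i j)"
  shows "continuous_on S (\<lambda>x. angle_sum k W (a x))"
  unfolding angle_sum_def using assms
  by (intro continuous_on_sum continuous_on_mult continuous_on_const) auto

lemma avoiding_subset: "avoiding k \<zeta> \<subseteq> power_set k"
  by (auto simp: avoiding_def)

lemma continuous_on_angle_from_avoiding:
  assumes "norm \<zeta> = 1" "i \<in> {1..k}" "j < 3"
  shows "continuous_on (avoiding k \<zeta>) (\<lambda>y. angle_from \<zeta> (crd j (y i)))"
proof (rule continuous_on_angle_from[OF _ assms(1)])
  show "continuous_on (avoiding k \<zeta>) (\<lambda>y. crd j (y i))"
    by (rule continuous_on_crd_power[OF continuous_on_id])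
  show "norm (crd j (y i)) = 1 \<and> crd j (y i) \<noteq> \<zeta>" if "y \<in> avoiding k \<zeta>" for y
    using that assms power_setD(1)[of y k i j] by (auto simp: avoiding_def)
qed

text \<open>Two angle functions for the same coordinates differ by multiples of \<open>2\<pi>\<close>, so they
  have locally constant difference.\<close>

lemma angle_functions_locally_equal:
  fixes p q :: "'a::topological_space \<Rightarrow> nat \<Rightarrow> nat \<Rightarrow> real"
  assumes p: "\<And>i j. i \<in> {1..k} \<Longrightarrow> j < 3 \<Longrightarrow> continuous_on S (\<lambda>x. p x i j)"
    and q: "\<And>i j. i \<in> {1..k} \<Longrightarrow> j < 3 \<Longrightarrow> continuous_on S (\<lambda>x. q x i j)"
    and eq: "\<And>x i j. x \<in> S \<Longrightarrow> i \<in> {1..k} \<Longrightarrow> j < 3 \<Longrightarrow> cis (p x i j) = cis (q x i j)"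
    and x: "x \<in> S"
  obtains V where "openin (top_of_set S) V" "x \<in> V"
    "\<And>y W. y \<in> V \<Longrightarrow> angle_sum k W (p y) - angle_sum k W (q y) = angle_sum k W (p x) - angle_sum k W (q x)"
proof -
  define D where "D i j y = (p y i j - q y i j) - (p x i j - q x i j)" for i j y
  define h where "h y = (\<Sum>i\<in>{1..k}. \<Sum>j<3. \<bar>D i j y\<bar>)" for y
  define V where "V = S \<inter> h -` {..<2 * pi}"
  have "continuous_on S h"
    unfolding h_def D_def using p q
    by (intro continuous_on_sum continuous_on_rabs continuous_on_diff continuous_on_const) auto
  then have "openin (top_of_set S) V"
    unfolding V_def by (rule continuous_openin_preimage_gen) simp
  moreover have "x \<in> V" using x by (simp add: V_def h_def D_def)
  moreover have "angle_sum k W (p y) - angle_sum k W (q y) = angle_sum k W (p x) - angle_sum k W (q x)"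
    if y: "y \<in> V" for y W
    unfolding angle_sum_diff
  proof (rule angle_sum_cong)
    fix i j assume ij: "i \<in> {1..k}" "j < (3::nat)"
    have "\<bar>D i j y\<bar> \<le> (\<Sum>j<3. \<bar>D i j y\<bar>)" using ij by (intro member_le_sum) auto
    also have "\<dots> \<le> h y" unfolding h_def using ij by (intro member_le_sum) (auto intro: sum_nonneg)
    finally have "\<bar>D i j y\<bar> < 2 * pi" using y by (simp add: V_def)
    moreover have "cis (D i j y) = 1"
      using eq[OF _ ij, of x] eq[OF _ ij, of y] x y by (simp add: D_def V_def flip: cis_divide)
    ultimately have "D i j y = 0" by (intro cis_eq_1_small)
    then show "p y i j - q y i j = p x i j - q x i j" by (simp add: D_def)
  qed
  ultimately show ?thesis by (rule that)
qed

lemma closed_form_family_linear: "closed_form_family (top_of_set (power_set k)) (linear_family k W)"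
  unfolding closed_form_family_def
proof (intro conjI)
  let ?X = "top_of_set (power_set k)"
  let ?a = "\<lambda>n y i j. angle_from (zeta n) (crd j (y i))"
  have sub: "subtopology ?X (avoiding k (zeta n)) = top_of_set (avoiding k (zeta n))" for n
    using avoiding_subset[of k "zeta n"] by (simp add: subtopology_subtopology Int_absorb1)
  have "openin ?X (avoiding k (zeta n)) \<and>
      continuous_map (subtopology ?X (avoiding k (zeta n))) euclideanreal (\<lambda>y. angle_sum k W (?a n y))" for n
    unfolding sub using openin_avoiding
    by (auto intro!: continuous_on_angle_sum continuous_on_angle_from_avoiding)
  then show "\<forall>(U, f)\<in>linear_family k W. openin ?X U \<and> continuous_map (subtopology ?X U) euclideanreal f"
    by (simp only: linear_family_def ball_simps prod.case) blast
  have "(\<Union>n. avoiding k (zeta n)) = power_set k"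
  proof
    show "(\<Union>n. avoiding k (zeta n)) \<subseteq> power_set k" using avoiding_subset by (intro UN_least)
    show "power_set k \<subseteq> (\<Union>n. avoiding k (zeta n))"
      by (rule subsetI) (erule avoiding_exists, rule UN_I[OF UNIV_I])
  qed
  then show "(\<Union>(U, f)\<in>linear_family k W. U) = topspace ?X"
    by (simp add: linear_family_def)
  have 3: "\<exists>V. openin ?X V \<and> x \<in> V \<and> V \<subseteq> avoiding k (zeta n) \<inter> avoiding k (zeta m) \<and>
      (\<forall>y\<in>V. angle_sum k W (?a n y) - angle_sum k W (?a m y) = angle_sum k W (?a n x) - angle_sum k W (?a m x))"
    if x: "x \<in> avoiding k (zeta n) \<inter> avoiding k (zeta m)" for n m x
  proof -
    let ?S = "avoiding k (zeta n) \<inter> avoiding k (zeta m)"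
    have 1: "continuous_on ?S (\<lambda>y. ?a n y i j)" "continuous_on ?S (\<lambda>y. ?a m y i j)"
      if "i \<in> {1..k}" "j < 3" for i j
      using that by (auto intro: continuous_on_subset[OF continuous_on_angle_from_avoiding])
    have 2: "cis (?a n y i j) = cis (?a m y i j)" if "y \<in> ?S" "i \<in> {1..k}" "j < 3" for y i j
      using that power_setD(1)[of y k i j] by (simp add: cis_angle_from avoiding_def)
    obtain V where V: "openin (top_of_set ?S) V" "x \<in> V"
      "\<And>y W. y \<in> V \<Longrightarrow> angle_sum k W (?a n y) - angle_sum k W (?a m y) = angle_sum k W (?a n x) - angle_sum k W (?a m x)"
      using angle_functions_locally_equal[of k ?S "?a n" "?a m" x] 1 2 x by blast
    have "openin ?X ?S" by (intro openin_Int openin_avoiding)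
    then have "openin ?X V" using V(1) openin_trans by blast
    moreover have "V \<subseteq> ?S" using openin_imp_subset[OF V(1)] .
    ultimately show ?thesis using V(2,3) by blast
  qed
  show "\<forall>(U, f)\<in>linear_family k W. \<forall>(V, g)\<in>linear_family k W. \<forall>x\<in>U \<inter> V.
       \<exists>Wa. openin ?X Wa \<and> x \<in> Wa \<and> Wa \<subseteq> U \<inter> V \<and> (\<forall>y\<in>Wa. f y - g y = f x - g x)"
    by (simp only: linear_family_def ball_simps prod.case) (intro allI ballI, rule 3)
qed

definition linear_form :: "nat \<Rightarrow> (nat \<Rightarrow> nat \<Rightarrow> real) \<Rightarrow>
    ((nat \<Rightarrow> bouquet_point) set \<times> ((nat \<Rightarrow> bouquet_point) \<Rightarrow> real)) set set" where
  "linear_form k W = {(\<F>, \<G>). closed_form_family (top_of_set (power_set k)) \<F> \<and>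
     closed_form_family (top_of_set (power_set k)) \<G> \<and>
     closed_form_family (top_of_set (power_set k)) (\<F> \<union> \<G>)} `` {linear_family k W}"

lemma linear_form_in: "linear_form k W \<in> closed_forms (top_of_set (power_set k))"
  unfolding linear_form_def closed_forms_def
  by (intro quotientI) (simp add: closed_form_family_linear)

lemma linear_family_in: "linear_family k W \<in> linear_form k W"
  by (simp add: linear_form_def closed_form_family_linear)

text \<open>Any continuous lifts of the coordinates will do, since they differ from the branch used
  in a chart by locally constant multiples of \<open>2 * pi\<close>.\<close>

lemma primitive_along_linear:
  assumes \<gamma>: "continuous_on {0..1} \<gamma>" "\<And>t. t \<in> {0..1} \<Longrightarrow> \<gamma> t \<in> power_set k"
    and L: "\<And>i j. i \<in> {1..k} \<Longrightarrow> j < 3 \<Longrightarrow> continuous_on {0..1} (L i j)"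
    and lift: "\<And>i j t. i \<in> {1..k} \<Longrightarrow> j < 3 \<Longrightarrow> t \<in> {0..1} \<Longrightarrow> crd j (\<gamma> t i) = cis (L i j t)"
  shows "primitive_along (linear_family k W) \<gamma> {0..1} (\<lambda>t. angle_sum k W (\<lambda>i j. L i j t))"
  unfolding primitive_along_def
proof
  fix s :: real assume s: "s \<in> {0..1}"
  obtain n where n: "\<gamma> s \<in> avoiding k (zeta n)" using avoiding_exists[OF \<gamma>(2)[OF s]] .
  let ?a = "\<lambda>y i j. angle_from (zeta n) (crd j (y i))"
  let ?T = "{t \<in> {0..1}. \<gamma> t \<in> avoiding k (zeta n)}"
  have \<gamma>': "continuous_map (top_of_set {0..1}) (top_of_set (power_set k)) \<gamma>" using \<gamma> by auto
  have T: "openin (top_of_set {0..1}) ?T"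
    using openin_continuous_map_preimage[OF \<gamma>' openin_avoiding] by simp
  have 1: "continuous_on ?T (\<lambda>t. L i j t)" if "i \<in> {1..k}" "j < 3" for i j
    using L[OF that] by (rule continuous_on_subset) auto
  have 2: "continuous_on ?T (\<lambda>t. ?a (\<gamma> t) i j)" if "i \<in> {1..k}" "j < 3" for i j
    by (rule continuous_on_compose2[OF continuous_on_angle_from_avoiding[OF norm_zeta that]
        continuous_on_subset[OF \<gamma>(1)]]) auto
  have 3: "cis (L i j t) = cis (?a (\<gamma> t) i j)" if "t \<in> ?T" "i \<in> {1..k}" "j < 3" for t i j
    using that lift[of i j t] power_setD(1)[of "\<gamma> t" k i j] \<gamma>(2)[of t] by (simp add: cis_angle_from)
  have "s \<in> ?T" using s n by simp
  then obtain V where V: "openin (top_of_set ?T) V" "s \<in> V"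
    "\<And>t W. t \<in> V \<Longrightarrow> angle_sum k W (\<lambda>i j. L i j t) - angle_sum k W (?a (\<gamma> t)) =
       angle_sum k W (\<lambda>i j. L i j s) - angle_sum k W (?a (\<gamma> s))"
    using angle_functions_locally_equal[of k ?T "\<lambda>t i j. L i j t" "\<lambda>t. ?a (\<gamma> t)" s] 1 2 3 by blast
  have "openin (top_of_set {0..1}) V" using V(1) T openin_trans by blast
  then obtain O' where O': "open O'" "V = {0..1} \<inter> O'" by (auto simp: openin_open)
  have "\<forall>\<^sub>F t in at s within {0..1}. t \<in> V"
    unfolding eventually_at_topological using O' V(2) by blast
  then have "\<forall>\<^sub>F t in at s within {0..1}. angle_sum k W (\<lambda>i j. L i j t) - angle_sum k W (?a (\<gamma> t)) =
       angle_sum k W (\<lambda>i j. L i j s) - angle_sum k W (?a (\<gamma> s))"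
    by (rule eventually_mono) (rule V(3))
  moreover have "(avoiding k (zeta n), \<lambda>y. angle_sum k W (?a y)) \<in> linear_family k W"
    unfolding linear_family_def by blast
  ultimately show "\<exists>(U, f)\<in>linear_family k W. \<gamma> s \<in> U \<and>
     (\<forall>\<^sub>F t in at s within {0..1}. angle_sum k W (\<lambda>i j. L i j t) - f (\<gamma> t) = angle_sum k W (\<lambda>i j. L i j s) - f (\<gamma> s))"
    using n by (intro bexI[of _ "(avoiding k (zeta n), \<lambda>y. angle_sum k W (?a y))"]) auto
qed

lemma linear_form_cocycle_value:
  assumes \<gamma>: "continuous_on {0..1} \<gamma>" "\<And>t. t \<in> {0..1} \<Longrightarrow> \<gamma> t \<in> power_set k"
    and L: "\<And>i j. i \<in> {1..k} \<Longrightarrow> j < 3 \<Longrightarrow> continuous_on {0..1} (L i j)"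
    and lift: "\<And>i j t. i \<in> {1..k} \<Longrightarrow> j < 3 \<Longrightarrow> t \<in> {0..1} \<Longrightarrow> crd j (\<gamma> t i) = cis (L i j t)"
  shows "closed_form_cocycle (top_of_set (power_set k)) (linear_form k W) (path_simplex \<gamma>) =
    angle_sum k W (\<lambda>i j. L i j 1 - L i j 0)"
proof -
  have \<gamma>': "continuous_map (top_of_set {0..1}) (top_of_set (power_set k)) \<gamma>" using \<gamma> by auto
  have "closed_form_cocycle (top_of_set (power_set k)) (linear_form k W) (path_simplex \<gamma>) =
      path_integral (linear_form k W) \<gamma>"
    by (rule closed_form_cocycle_path_simplex[OF \<gamma>'])
  also have "\<dots> = angle_sum k W (\<lambda>i j. L i j 1) - angle_sum k W (\<lambda>i j. L i j 0)"
    using path_integral_primitive[OF linear_form_in linear_family_in primitive_along_linear[OF assms] \<gamma>'] .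
  also have "\<dots> = angle_sum k W (\<lambda>i j. L i j 1 - L i j 0)" by (rule angle_sum_diff)
  finally show ?thesis .
qed

lemma convex_triangle: "convex triangle"
proof (rule convexI)
  fix x y :: "real \<times> real" and u v :: real
  assume "x \<in> triangle" "y \<in> triangle" "0 \<le> u" "0 \<le> v" "u + v = 1"
  moreover from this have "u * (fst x + snd x) + v * (fst y + snd y) \<le> u * 1 + v * 1"
    by (intro add_mono mult_left_mono) (auto simp: triangle_def)
  ultimately show "u *\<^sub>R x + v *\<^sub>R y \<in> triangle"
    by (auto simp: triangle_def case_prod_unfold algebra_simps)
qed

text \<open>Angles lift over the convex triangle, so the edge values are differences of one function
  at the vertices.\<close>

lemma linear_form_cocycle:
  "closed_form_cocycle (top_of_set (power_set k)) (linear_form k W)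
    \<in> carrier (cocycle_group 1 (top_of_set (power_set k)))"
proof (rule cocycleI[OF closed_form_cocycle_cochain])
  fix \<tau> assume "continuous_map (top_of_set triangle) (top_of_set (power_set k)) \<tau>"
  then have \<tau>: "continuous_on triangle \<tau>" "\<And>p. p \<in> triangle \<Longrightarrow> \<tau> p \<in> power_set k" by auto
  have "\<exists>L. continuous_on triangle L \<and> (\<forall>p\<in>triangle. crd j (\<tau> p i) = cis (L p))"
    if "i \<in> {1..k}" "j < 3" for i j
    using convex_angle_lift[OF convex_triangle continuous_on_crd_power[OF \<tau>(1)], of j i]
      power_setD(1)[OF \<tau>(2) that] by metis
  then obtain L where L: "\<And>i j. i \<in> {1..k} \<Longrightarrow> j < 3 \<Longrightarrow> continuous_on triangle (L i j)"
    "\<And>i j p. i \<in> {1..k} \<Longrightarrow> j < 3 \<Longrightarrow> p \<in> triangle \<Longrightarrow> crd j (\<tau> p i) = cis (L i j p)"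
    by metis
  have edge: "closed_form_cocycle (top_of_set (power_set k)) (linear_form k W) (path_simplex (\<lambda>t. \<tau> (e t))) =
      angle_sum k W (\<lambda>i j. L i j (e 1)) - angle_sum k W (\<lambda>i j. L i j (e 0))"
    if e: "continuous_on {0..1} e" "\<And>t. t \<in> {0..1} \<Longrightarrow> e t \<in> triangle" for e :: "real \<Rightarrow> real \<times> real"
    unfolding angle_sum_diff
  proof (rule linear_form_cocycle_value[of "\<lambda>t. \<tau> (e t)" k "\<lambda>i j t. L i j (e t)"])
    show "continuous_on {0..1} (\<lambda>t. \<tau> (e t))"
      by (rule continuous_on_compose2[OF \<tau>(1) e(1)]) (use e(2) in auto)
    show "continuous_on {0..1} (\<lambda>t. L i j (e t))" if "i \<in> {1..k}" "j < 3" for i j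
      by (rule continuous_on_compose2[OF L(1)[OF that] e(1)]) (use e(2) in auto)
  qed (use e \<tau> L(2) in auto)
  show "closed_form_cocycle (top_of_set (power_set k)) (linear_form k W) (path_simplex (\<lambda>t. \<tau> (t, 0))) +
    closed_form_cocycle (top_of_set (power_set k)) (linear_form k W) (path_simplex (\<lambda>t. \<tau> (1 - t, t))) =
    closed_form_cocycle (top_of_set (power_set k)) (linear_form k W) (path_simplex (\<lambda>t. \<tau> (0, t)))"
    using edge[of "\<lambda>t. (t, 0)"] edge[of "\<lambda>t. (1 - t, t)"] edge[of "\<lambda>t. (0, t)"]
    by (simp add: triangle_def continuous_on_Pair continuous_on_diff)
qed


section \<open>Classes of closed 1-forms\<close>

lemma coset_cocycle_group: "B #>\<^bsub>cocycle_group p X\<^esub> c = (\<lambda>b \<sigma>. b \<sigma> + c \<sigma>) ` B"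
  by (auto simp: r_coset_def cocycle_group_def cochain_group_def)

lemma coboundaries_lin:
  assumes "b \<in> coboundaries 1 X" "b' \<in> coboundaries 1 X"
  shows "(\<lambda>\<sigma>. s * b \<sigma> + t * b' \<sigma>) \<in> coboundaries 1 X"
proof -
  obtain g g' where g: "g \<in> carrier (cochain_group 0 X)" "b = coboundary_map 0 X g"
    "g' \<in> carrier (cochain_group 0 X)" "b' = coboundary_map 0 X g'"
    using assms by (auto simp: coboundaries_def)
  have "(\<lambda>\<sigma>. s * b \<sigma> + t * b' \<sigma>) = coboundary_map 0 X (\<lambda>\<sigma>. s * g \<sigma> + t * g' \<sigma>)"
    unfolding g by (auto simp: coboundary_map_def fun_eq_iff algebra_simps)
  moreover have "(\<lambda>\<sigma>. s * g \<sigma> + t * g' \<sigma>) \<in> carrier (cochain_group 0 X)"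
    using g by (simp add: cochain_group_def)
  ultimately show ?thesis by (auto simp: coboundaries_def)
qed

lemma coboundaries_zero: "(\<lambda>\<sigma>. 0) \<in> coboundaries 1 X"
proof -
  have "(\<lambda>\<sigma>. 0) = coboundary_map 0 X (\<lambda>\<sigma>. 0)" by (auto simp: coboundary_map_def fun_eq_iff)
  moreover have "(\<lambda>\<sigma>. 0) \<in> carrier (cochain_group 0 X)" by (simp add: cochain_group_def)
  ultimately show ?thesis by (auto simp: coboundaries_def)
qed

lemma mem_coset: "c \<in> coboundaries 1 X #>\<^bsub>cocycle_group 1 X\<^esub> c"
  unfolding coset_cocycle_group using coboundaries_zero by (intro image_eqI[of _ _ "\<lambda>\<sigma>. 0"]) auto

lemma coset_eqI:
  assumes "(\<lambda>\<sigma>. c \<sigma> - c' \<sigma>) \<in> coboundaries 1 X"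
  shows "coboundaries 1 X #>\<^bsub>cocycle_group 1 X\<^esub> c = coboundaries 1 X #>\<^bsub>cocycle_group 1 X\<^esub> c'"
  unfolding coset_cocycle_group
proof (intro subset_antisym image_subsetI)
  fix b assume b: "b \<in> coboundaries 1 X"
  have "(\<lambda>\<sigma>. b \<sigma> + (c \<sigma> - c' \<sigma>)) \<in> coboundaries 1 X"
    using coboundaries_lin[OF b assms, of 1 1] by simp
  then show "(\<lambda>\<sigma>. b \<sigma> + c \<sigma>) \<in> (\<lambda>b \<sigma>. b \<sigma> + c' \<sigma>) ` coboundaries 1 X"
    by (rule rev_image_eqI) auto
  have "(\<lambda>\<sigma>. b \<sigma> - (c \<sigma> - c' \<sigma>)) \<in> coboundaries 1 X"
    using coboundaries_lin[OF b assms, of 1 "-1"] by (simp add: algebra_simps)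
  then show "(\<lambda>\<sigma>. b \<sigma> + c' \<sigma>) \<in> (\<lambda>b \<sigma>. b \<sigma> + c \<sigma>) ` coboundaries 1 X"
    by (rule rev_image_eqI) auto
qed

lemma cocycle_group_diff:
  assumes "c \<in> carrier (cocycle_group 1 X)" "c' \<in> carrier (cocycle_group 1 X)"
  shows "(\<lambda>\<sigma>. c \<sigma> - c' \<sigma>) \<in> carrier (cocycle_group 1 X)"
proof (rule cocycleI)
  show "(\<lambda>\<sigma>. c \<sigma> - c' \<sigma>) \<in> carrier (cochain_group 1 X)"
    using assms by (simp add: cocycle_group_def cochain_group_def)
qed (use assms[THEN cocycle_triangle] in \<open>simp add: algebra_simps\<close>)

section \<open>Periods and the class they determine\<close>

definition axis_loop :: "nat \<Rightarrow> nat \<Rightarrow> nat \<Rightarrow> real \<Rightarrow> nat \<Rightarrow> bouquet_point" where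
  "axis_loop k i j t = angles k (\<lambda>i' j'. t * (if i' = i \<and> j' = j then 2 * pi else 0))"

lemma axis_loop_in: "axis_loop k i j t \<in> power_set k"
proof -
  have "admissible k (if j = 2 then {i} else {}) (\<lambda>i' j'. t * (if i' = i \<and> j' = j then 2 * pi else 0))"
    by (simp add: admissible_def)
  then show ?thesis unfolding axis_loop_def by (rule angles_in_power_set)
qed

lemma continuous_axis_loop: "continuous_map (top_of_set {0..1}) (top_of_set (power_set k)) (axis_loop k i j)"
proof -
  have "continuous_on {0..1} (\<lambda>t. axis_loop k i j t)"
    unfolding axis_loop_def by (intro continuous_on_angles continuous_on_mult continuous_on_id continuous_on_const)
  then show ?thesis using axis_loop_in by auto
qed

lemma axis_loop_ends: "axis_loop k i j 1 = angles k (\<lambda>i j. 0)" "axis_loop k i j 0 = angles k (\<lambda>i j. 0)"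
  unfolding axis_loop_def by (rule angles_cong, simp)+

lemma linear_form_axis_loop:
  assumes "i \<in> {1..k}" "j < 3"
  shows "closed_form_cocycle (top_of_set (power_set k)) (linear_form k W) (path_simplex (axis_loop k i j)) =
    2 * pi * W i j"
proof -
  define L where "L i' j' t = t * (if i' = i \<and> j' = j then 2 * pi else 0)" for i' j' :: nat and t :: real
  have "closed_form_cocycle (top_of_set (power_set k)) (linear_form k W) (path_simplex (axis_loop k i j)) =
    angle_sum k W (\<lambda>i' j'. L i' j' 1 - L i' j' 0)"
  proof (rule linear_form_cocycle_value)
    show "continuous_on {0..1} (axis_loop k i j)" using continuous_axis_loop by auto
    show "continuous_on {0..1} (L i' j')" for i' j'
      unfolding L_def by (intro continuous_on_mult continuous_on_id continuous_on_const)
  qed (auto simp: axis_loop_in, auto simp: axis_loop_def L_def)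
  also have "\<dots> = (\<Sum>i'\<in>{1..k}. \<Sum>j'<3. if j' = j then if i' = i then 2 * pi * W i j else 0 else 0)"
    unfolding angle_sum_def L_def by (intro sum.cong refl) auto
  also have "\<dots> = 2 * pi * W i j" using assms by (simp add: sum.delta)
  finally show ?thesis .
qed

lemma carrier_cohomologyE:
  assumes "\<xi> \<in> carrier (cohomology_group 1 X)"
  obtains c where "c \<in> carrier (cocycle_group 1 X)" "\<xi> = coboundaries 1 X #>\<^bsub>cocycle_group 1 X\<^esub> c"
  using assms unfolding cohomology_group_def FactGroup_def RCOSETS_def by auto

text \<open>\<open>W\<close> is the vector of periods divided by \<open>2 * pi\<close>; the
  difference of the two cocycles has zero periods and is exact. In particular the class is
  represented by some form, on which the choice in \<open>representing_form\<close> relies.\<close>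

lemma cohomology_class_linear:
  assumes "\<xi> \<in> carrier (cohomology_group 1 (top_of_set (power_set k)))"
  obtains W where "closed_form_class (top_of_set (power_set k)) (linear_form k W) = \<xi>"
proof -
  let ?X = "top_of_set (power_set k)"
  obtain c where c: "c \<in> carrier (cocycle_group 1 ?X)" "\<xi> = coboundaries 1 ?X #>\<^bsub>cocycle_group 1 ?X\<^esub> c"
    by (rule carrier_cohomologyE[OF assms])
  define W where "W i j = c (path_simplex (axis_loop k i j)) / (2 * pi)" for i j
  let ?c = "closed_form_cocycle ?X (linear_form k W)"
  have "zero_periods k (\<lambda>\<sigma>. ?c \<sigma> - c \<sigma>)"
    unfolding zero_periods_def
  proof (intro ballI allI impI)
    fix i j assume ij: "i \<in> {1..k}" "j < (3::nat)"
    have "?c (path_simplex (axis_loop k i j)) - c (path_simplex (axis_loop k i j)) = 0"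
      unfolding linear_form_axis_loop[OF ij] by (simp add: W_def)
    then show "?c (path_simplex (\<lambda>t. angles k (\<lambda>i' j'. t * (if i' = i \<and> j' = j then 2 * pi else 0)))) -
        c (path_simplex (\<lambda>t. angles k (\<lambda>i' j'. t * (if i' = i \<and> j' = j then 2 * pi else 0)))) = 0"
      unfolding axis_loop_def .
  qed
  then have "(\<lambda>\<sigma>. ?c \<sigma> - c \<sigma>) \<in> coboundaries 1 ?X"
    by (intro cocycle_zero_periods_exact cocycle_group_diff linear_form_cocycle c(1))
  then have "closed_form_class ?X (linear_form k W) = \<xi>"
    unfolding c(2) closed_form_class_def by (rule coset_eqI)
  then show ?thesis by (rule that)
qed

section \<open>Potentials between cohomologous forms\<close>

lemma class_memberE:
  assumes "c \<in> closed_form_class X \<omega>"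
  obtains u where "\<And>\<gamma>. continuous_map (top_of_set {0..1}) X \<gamma> \<Longrightarrow>
    c (path_simplex \<gamma>) = closed_form_cocycle X \<omega> (path_simplex \<gamma>) + (u (\<gamma> 1) - u (\<gamma> 0))"
proof -
  obtain b where b: "b \<in> coboundaries 1 X" "c = (\<lambda>\<sigma>. b \<sigma> + closed_form_cocycle X \<omega> \<sigma>)"
    using assms unfolding closed_form_class_def coset_cocycle_group by auto
  obtain u where "\<And>\<gamma>. continuous_map (top_of_set {0..1}) X \<gamma> \<Longrightarrow> b (path_simplex \<gamma>) = u (\<gamma> 1) - u (\<gamma> 0)"
    by (rule coboundariesE[OF b(1)]) blast
  then show ?thesis using b(2) that by simp
qed

text \<open>Potential differences cancel around a triangle. This is how an arbitrary form in the
  class of a linear one inherits the cocycle identity.\<close>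

lemma coboundaries_cocycle:
  assumes "c \<in> carrier (cochain_group 1 X)" "c' \<in> carrier (cocycle_group 1 X)"
    and u: "\<And>\<gamma>. continuous_map (top_of_set {0..1}) X \<gamma> \<Longrightarrow>
      c (path_simplex \<gamma>) = c' (path_simplex \<gamma>) + (u (\<gamma> 1) - u (\<gamma> 0))"
  shows "c \<in> carrier (cocycle_group 1 X)"
proof (rule cocycleI[OF assms(1)])
  fix \<tau> assume \<tau>: "continuous_map (top_of_set triangle) X \<tau>"
  have e: "continuous_map (top_of_set {0..1}) X (\<lambda>t. \<tau> (e t))"
    if "continuous_on {0..1} e" "\<And>t. t \<in> {0..1} \<Longrightarrow> e t \<in> triangle" for e :: "real \<Rightarrow> real \<times> real"
  proof -
    have "continuous_map (top_of_set {0..1}) (top_of_set triangle) e" using that by auto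
    from continuous_map_compose[OF this \<tau>] show ?thesis by (simp add: o_def)
  qed
  have 1: "c (path_simplex (\<lambda>t. \<tau> (t, 0))) = c' (path_simplex (\<lambda>t. \<tau> (t, 0))) + (u (\<tau> (1, 0)) - u (\<tau> (0, 0)))"
    by (rule u[OF e]) (auto simp: triangle_def intro!: continuous_on_Pair continuous_on_id continuous_on_const)
  have 2: "c (path_simplex (\<lambda>t. \<tau> (0, t))) = c' (path_simplex (\<lambda>t. \<tau> (0, t))) + (u (\<tau> (0, 1)) - u (\<tau> (0, 0)))"
    by (rule u[OF e]) (auto simp: triangle_def intro!: continuous_on_Pair continuous_on_id continuous_on_const)
  have 3: "c (path_simplex (\<lambda>t. \<tau> (1 - t, t))) = c' (path_simplex (\<lambda>t. \<tau> (1 - t, t))) + (u (\<tau> (0, 1)) - u (\<tau> (1, 0)))"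
    using u[OF e[of "\<lambda>t. (1 - t, t)"]]
    by (simp add: triangle_def continuous_on_Pair continuous_on_diff)
  show "c (path_simplex (\<lambda>t. \<tau> (t, 0))) + c (path_simplex (\<lambda>t. \<tau> (1 - t, t))) = c (path_simplex (\<lambda>t. \<tau> (0, t)))"
    using cocycle_triangle[OF assms(2) \<tau>] unfolding 1 2 3 by simp
qed

lemma locally_bounded_compact:
  fixes u :: "'a::topological_space \<Rightarrow> real"
  assumes "compact S" and loc: "\<And>x. x \<in> S \<Longrightarrow> \<exists>V M. openin (top_of_set S) V \<and> x \<in> V \<and> (\<forall>y\<in>V. \<bar>u y\<bar> \<le> M)"
  obtains K where "\<And>x. x \<in> S \<Longrightarrow> \<bar>u x\<bar> \<le> K"
proof -
  let ?C = "{V. openin (top_of_set S) V \<and> (\<exists>M. \<forall>y\<in>V. \<bar>u y\<bar> \<le> M)}"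
  have "S \<subseteq> \<Union>?C" using loc by blast
  then obtain D where D: "D \<subseteq> ?C" "finite D" "S \<subseteq> \<Union>D"
    using assms(1) unfolding compact_eq_openin_cover by (metis (no_types, lifting) mem_Collect_eq)
  have "\<forall>V\<in>D. \<exists>M. \<forall>y\<in>V. \<bar>u y\<bar> \<le> M" using D(1) by blast
  then obtain M where M: "\<And>V y. V \<in> D \<Longrightarrow> y \<in> V \<Longrightarrow> \<bar>u y\<bar> \<le> M V" by metis
  have "\<bar>u x\<bar> \<le> (\<Sum>V\<in>D. \<bar>M V\<bar>)" if "x \<in> S" for x
  proof -
    obtain V where "V \<in> D" "x \<in> V" using D(3) \<open>x \<in> S\<close> by auto
    then have "\<bar>u x\<bar> \<le> \<bar>M V\<bar>" using M by fastforce
    also have "\<dots> \<le> (\<Sum>V\<in>D. \<bar>M V\<bar>)" using \<open>V \<in> D\<close> D(2) by (intro member_le_sum) auto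
    finally show ?thesis .
  qed
  then show ?thesis by (rule that)
qed

text \<open>Over a short parameter interval the tracks of all points near \<open>y\<close> stay
  where one chart function varies by less than 2; \<open>Bolzano\<close> adds up such bounds over
  adjacent intervals.\<close>

lemma track_value_locally_bounded:
  assumes \<omega>: "\<omega> \<in> closed_forms X" and c: "closed_form_cocycle X \<omega> \<in> carrier (cocycle_group 1 X)"
    and h: "continuous_map (prod_topology (top_of_set {0..1}) Y) X h" and y: "y \<in> topspace Y"
  obtains V M where "openin Y V" "y \<in> V" "\<And>z. z \<in> V \<Longrightarrow> \<bar>closed_form_cocycle X \<omega> (path_simplex (\<lambda>t. h (t, z)))\<bar> \<le> M"
proof -
  let ?c = "closed_form_cocycle X \<omega>"
  define E where "E z a b = ?c (path_simplex (\<lambda>t. h (a + t * (b - a), z)))" for z a b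
  define P where "P a b \<longleftrightarrow> (0 \<le> a \<and> a \<le> b \<and> b \<le> 1 \<longrightarrow>
    (\<exists>V M. openin Y V \<and> y \<in> V \<and> (\<forall>z\<in>V. \<bar>E z a b\<bar> \<le> M)))" for a b
  have track: "continuous_map (top_of_set {0..1}) X (\<lambda>t. h (t, z))" if "z \<in> topspace Y" for z
  proof -
    have "continuous_map (top_of_set {0..1}) (prod_topology (top_of_set {0..1}) Y) (\<lambda>t. (t, z))"
      using that by (intro continuous_map_pairedI) auto
    from continuous_map_compose[OF this h] show ?thesis by (simp add: o_def)
  qed
  have "P 0 1"
  proof (rule Bolzano)
    fix a b d assume ab: "P a b" "P b d" "a \<le> b" "b \<le> d"
    show "P a d"
      unfolding P_def
    proof
      assume ad: "0 \<le> a \<and> a \<le> d \<and> d \<le> 1"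
      obtain V M V' M' where V: "openin Y V" "y \<in> V" "\<And>z. z \<in> V \<Longrightarrow> \<bar>E z a b\<bar> \<le> M"
        "openin Y V'" "y \<in> V'" "\<And>z. z \<in> V' \<Longrightarrow> \<bar>E z b d\<bar> \<le> M'"
        using ab ad unfolding P_def by (meson order_trans)
      have "\<bar>E z a d\<bar> \<le> M + M'" if z: "z \<in> V \<inter> V'" for z
      proof -
        have "z \<in> topspace Y" using z V(1) openin_subset by blast
        then have "continuous_map (top_of_set {a..d}) X (\<lambda>t. h (t, z))"
          using track[of z] continuous_map_from_subtopology_mono[of euclidean "{0..1}" X _ "{a..d}"] ad by auto
        from cocycle_subpath[OF c this ab(3,4)] have "E z a b + E z b d = E z a d" by (simp add: E_def)
        then show ?thesis using V(3)[of z] V(6)[of z] z by auto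
      qed
      then show "\<exists>V M. openin Y V \<and> y \<in> V \<and> (\<forall>z\<in>V. \<bar>E z a d\<bar> \<le> M)"
        using V by (intro exI[of _ "V \<inter> V'"] exI[of _ "M + M'"]) auto
    qed
  next
    fix x :: real assume x: "0 \<le> x" "x \<le> 1"
    have hx: "h (x, y) \<in> topspace X" using track[OF y] x by (auto simp: continuous_map_def)
    obtain \<F> where F: "\<F> \<in> \<omega>" "closed_form_family X \<F>" by (rule closed_forms_nonempty[OF \<omega>])
    obtain U f where U: "(U, f) \<in> \<F>" "h (x, y) \<in> U" by (rule closed_form_family_chart[OF F(2) hx])
    note U' = closed_form_family_openin[OF F(2) U(1)]
    define V0 where "V0 = {p \<in> U. f p \<in> ball (f (h (x, y))) 1}"
    have "openin (subtopology X U) {p \<in> topspace (subtopology X U). f p \<in> ball (f (h (x, y))) 1}"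
      using U' by (intro openin_continuous_map_preimage[of _ euclideanreal]) auto
    moreover have "topspace (subtopology X U) = U"
      using U' openin_subset by (intro topspace_subtopology_subset) blast
    ultimately have "openin (subtopology X U) V0" unfolding V0_def by (simp only:)
    then have "openin X V0" using U' openin_trans_full by blast
    then have "openin (prod_topology (top_of_set {0..1}) Y)
        {q \<in> topspace (prod_topology (top_of_set {0..1}) Y). h q \<in> V0}"
      by (rule openin_continuous_map_preimage[OF h])
    moreover have "(x, y) \<in> {q \<in> topspace (prod_topology (top_of_set {0..1}) Y). h q \<in> V0}"
      using x y U by (simp add: V0_def)
    ultimately obtain T V where TV: "openin (top_of_set {0..1}) T" "openin Y V" "x \<in> T" "y \<in> V"
      "T \<times> V \<subseteq> {q \<in> topspace (prod_topology (top_of_set {0..1}) Y). h q \<in> V0}"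
      unfolding openin_prod_topology_alt by meson
    obtain e where e: "e > 0" "ball x e \<inter> {0..1} \<subseteq> T"
      using TV(1,3) unfolding openin_contains_ball by blast
    have "P a b" if ab: "a \<le> x" "x \<le> b" "b - a < e" for a b
      unfolding P_def
    proof
      assume 01: "0 \<le> a \<and> a \<le> b \<and> b \<le> 1"
      have "\<bar>E z a b\<bar> \<le> 2" if z: "z \<in> V" for z
      proof -
        have "h (t, z) \<in> V0" if "t \<in> {a..b}" for t
        proof -
          have "t \<in> T" using e(2) that ab 01 by (auto simp: dist_real_def subset_iff)
          then show ?thesis using TV(5) z by auto
        qed
        moreover have t: "a + t * (b - a) \<in> {a..b}" if "t \<in> {0..1}" for t
          using that 01 mult_right_mono[of t 1 "b - a"] by auto
        ultimately have in_V0: "h (a + t * (b - a), z) \<in> V0" if "t \<in> {0..1}" for t using that by blast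
        have zY: "z \<in> topspace Y" using z TV(2) openin_subset by blast
        have "continuous_map (top_of_set {0..1}) (top_of_set {0..1}) (\<lambda>t. a + t * (b - a))"
          using t 01 by (force intro!: continuous_on_add continuous_on_mult continuous_on_const continuous_on_id)
        from continuous_map_compose[OF this track[OF zY]]
        have path: "continuous_map (top_of_set {0..1}) X (\<lambda>t. h (a + t * (b - a), z))" by (simp add: o_def)
        have "(\<lambda>t. h (a + t * (b - a), z)) ` {0..1} \<subseteq> U" using in_V0 by (auto simp: V0_def)
        then have "E z a b = f (h (a + 1 * (b - a), z)) - f (h (a + 0 * (b - a), z))"
          unfolding E_def closed_form_cocycle_path_simplex[OF path]
          by (rule path_integral_in_chart[OF \<omega> F(1) U(1) path])
        then show ?thesis using in_V0[of 0] in_V0[of 1] by (auto simp: V0_def dist_real_def)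
      qed
      then show "\<exists>V M. openin Y V \<and> y \<in> V \<and> (\<forall>z\<in>V. \<bar>E z a b\<bar> \<le> M)" using TV by blast
    qed
    then show "\<exists>d>0. \<forall>a b. a \<le> x \<and> x \<le> b \<and> b - a < d \<longrightarrow> P a b" using e(1) by blast
  qed simp
  then show ?thesis using that unfolding P_def E_def by auto
qed


section \<open>Comparison with linear forms\<close>

text \<open>All that both bounds use of the form. The error \<open>K\<close> is uniform over paths
  and lifts, and is absorbed because \<open>N\<close> may be arbitrarily large.\<close>

definition approximates :: "nat \<Rightarrow> ((nat \<Rightarrow> bouquet_point) set \<times> ((nat \<Rightarrow> bouquet_point) \<Rightarrow> real)) set set \<Rightarrow>
    (nat \<Rightarrow> nat \<Rightarrow> real) \<Rightarrow> real \<Rightarrow> bool" where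
  "approximates k \<omega> W K \<longleftrightarrow> (\<forall>\<gamma> L. continuous_on {0..1} \<gamma> \<longrightarrow> (\<forall>t\<in>{0..1}. \<gamma> t \<in> power_set k) \<longrightarrow>
    (\<forall>i\<in>{1..k}. \<forall>j<3. continuous_on {0..1} (L i j)) \<longrightarrow>
    (\<forall>i\<in>{1..k}. \<forall>j<3. \<forall>t\<in>{0..1}. crd j (\<gamma> t i) = cis (L i j t)) \<longrightarrow>
    \<bar>path_integral \<omega> \<gamma> - angle_sum k W (\<lambda>i j. L i j 1 - L i j 0)\<bar> \<le> K)"

text \<open>The potential \<open>u\<close> relating the two cocycles is just some function on
  points. Relative to its value at the base point it is the difference of two integrals along a cone
  path, hence locally bounded, and the space is compact.\<close>

lemma class_difference_bounded:
  assumes \<omega>: "\<omega> \<in> closed_forms (top_of_set (power_set k))"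
    and eq: "closed_form_class (top_of_set (power_set k)) \<omega> =
      closed_form_class (top_of_set (power_set k)) (linear_form k W)"
  obtains K where "approximates k \<omega> W K"
proof -
  let ?X = "top_of_set (power_set k)"
  let ?c = "closed_form_cocycle ?X \<omega>" and ?l = "closed_form_cocycle ?X (linear_form k W)"
  have "?c \<in> closed_form_class ?X \<omega>"
    unfolding closed_form_class_def by (rule mem_coset)
  then have "?c \<in> closed_form_class ?X (linear_form k W)" by (simp only: eq)
  then obtain u where u: "\<And>\<gamma>. continuous_map (top_of_set {0..1}) ?X \<gamma> \<Longrightarrow>
      ?c (path_simplex \<gamma>) = ?l (path_simplex \<gamma>) + (u (\<gamma> 1) - u (\<gamma> 0))"
    by (rule class_memberE) blast
  have c: "?c \<in> carrier (cocycle_group 1 ?X)"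
    by (rule coboundaries_cocycle[where u = u, OF closed_form_cocycle_cochain linear_form_cocycle[of k W]])
      (rule u)
  have loc: "\<exists>V M. openin ?X V \<and> x \<in> V \<and> (\<forall>y\<in>V. \<bar>u y\<bar> \<le> M)" if x: "x \<in> power_set k" for x
  proof -
    obtain n where n: "x \<in> avoiding k (zeta n)" by (rule avoiding_exists[OF x])
    let ?A = "avoiding k (zeta n)"
    define h where "h p = cone_point k (zeta n) (fst p) (snd p)" for p
    have h: "continuous_map (prod_topology (top_of_set {0..1}) (top_of_set ?A)) ?X h"
      unfolding prod_topology_subtopology_eu h_def
      using cone_point_in avoiding_subset[of k "zeta n"]
      by (auto intro!: continuous_on_cone_point continuous_on_fst continuous_on_snd continuous_on_id)
    have xA: "x \<in> topspace (top_of_set ?A)" using n by simp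
    obtain V M where V: "openin (top_of_set ?A) V" "x \<in> V" "\<And>z. z \<in> V \<Longrightarrow> \<bar>?c (path_simplex (\<lambda>t. h (t, z)))\<bar> \<le> M"
      by (rule track_value_locally_bounded[OF \<omega> c h xA]) blast
    obtain V' M' where V': "openin (top_of_set ?A) V'" "x \<in> V'" "\<And>z. z \<in> V' \<Longrightarrow> \<bar>?l (path_simplex (\<lambda>t. h (t, z)))\<bar> \<le> M'"
      by (rule track_value_locally_bounded[OF linear_form_in linear_form_cocycle h xA]) blast
    have "\<bar>u y\<bar> \<le> M + M' + \<bar>u (angles k (\<lambda>i j. 0))\<bar>" if y: "y \<in> V \<inter> V'" for y
    proof -
      have yA: "y \<in> ?A" using y openin_imp_subset[OF V(1)] by blast
      then have yP: "y \<in> power_set k" using avoiding_subset by blast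
      have "continuous_map (top_of_set {0..1}) (prod_topology (top_of_set {0..1}) (top_of_set ?A)) (\<lambda>t. (t, y))"
        using yA by (intro continuous_map_pairedI) auto
      from continuous_map_compose[OF this h]
      have "continuous_map (top_of_set {0..1}) ?X (\<lambda>t. h (t, y))" by (simp add: o_def)
      from u[OF this] have "?c (path_simplex (\<lambda>t. h (t, y))) =
          ?l (path_simplex (\<lambda>t. h (t, y))) + (u y - u (angles k (\<lambda>i j. 0)))"
        by (simp add: h_def cone_point_0 cone_point_1 yP)
      then show ?thesis using V(3)[of y] V'(3)[of y] y by auto
    qed
    moreover have "openin ?X (V \<inter> V')"
      using openin_trans[OF V(1) openin_avoiding] openin_trans[OF V'(1) openin_avoiding] by (rule openin_Int)
    ultimately show ?thesis using V(2) V'(2) by blast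
  qed
  have "\<exists>K. \<forall>x\<in>power_set k. \<bar>u x\<bar> \<le> K"
    by (rule locally_bounded_compact[where u = u, OF compact_power_set loc]) blast+
  then obtain K where K: "\<And>x. x \<in> power_set k \<Longrightarrow> \<bar>u x\<bar> \<le> K" by blast
  show ?thesis
  proof (rule that[of "2 * K"], unfold approximates_def, intro allI impI)
    fix \<gamma> :: "real \<Rightarrow> nat \<Rightarrow> bouquet_point" and L :: "nat \<Rightarrow> nat \<Rightarrow> real \<Rightarrow> real"
    assume "continuous_on {0..1} \<gamma>" "\<forall>t\<in>{0..1}. \<gamma> t \<in> power_set k"
      "\<forall>i\<in>{1..k}. \<forall>j<3. continuous_on {0..1} (L i j)"
      "\<forall>i\<in>{1..k}. \<forall>j<3. \<forall>t\<in>{0..1}. crd j (\<gamma> t i) = cis (L i j t)"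
    then have \<gamma>: "continuous_on {0..1} \<gamma>" "\<And>t. t \<in> {0..1} \<Longrightarrow> \<gamma> t \<in> power_set k"
      and L: "\<And>i j. i \<in> {1..k} \<Longrightarrow> j < 3 \<Longrightarrow> continuous_on {0..1} (L i j)"
        "\<And>i j t. i \<in> {1..k} \<Longrightarrow> j < 3 \<Longrightarrow> t \<in> {0..1} \<Longrightarrow> crd j (\<gamma> t i) = cis (L i j t)"
      by blast+
    have \<gamma>': "continuous_map (top_of_set {0..1}) ?X \<gamma>" using \<gamma> by auto
    have "path_integral \<omega> \<gamma> = ?c (path_simplex \<gamma>)"
      by (rule closed_form_cocycle_path_simplex[OF \<gamma>', symmetric])
    also have "\<dots> = angle_sum k W (\<lambda>i j. L i j 1 - L i j 0) + (u (\<gamma> 1) - u (\<gamma> 0))"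
      using u[OF \<gamma>'] linear_form_cocycle_value[where W = W, OF \<gamma> L] by simp
    finally show "\<bar>path_integral \<omega> \<gamma> - angle_sum k W (\<lambda>i j. L i j 1 - L i j 0)\<bar> \<le> 2 * K"
      using K[OF \<gamma>(2)[of 0]] K[OF \<gamma>(2)[of 1]] by auto
  qed
qed

section \<open>Restriction to one factor and to its torus\<close>

lemma simplex_map_path_simplex: "simplex_map 1 f (path_simplex \<gamma>) = path_simplex (\<lambda>t. f (\<gamma> t))"
  unfolding simplex_map_def path_simplex_def by (rule restrict_ext) simp

lemma cochain_pullback_path_simplex:
  assumes "continuous_map (top_of_set {0..1}) Y \<gamma>"
  shows "cochain_pullback 1 Y f c (path_simplex \<gamma>) = c (path_simplex (\<lambda>t. f (\<gamma> t)))"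
  using singular_simplex_path_simplex[OF assms]
  unfolding cochain_pullback_def simplex_map_path_simplex by simp

lemma cochain_pullback_cochain: "cochain_pullback 1 Y f c \<in> carrier (cochain_group 1 Y)"
  by (simp add: cochain_pullback_def cochain_group_def)

lemma cochain_pullback_cocycle:
  assumes f: "continuous_map Y X f" and c: "c \<in> carrier (cocycle_group 1 X)"
  shows "cochain_pullback 1 Y f c \<in> carrier (cocycle_group 1 Y)"
proof (rule cocycleI[OF cochain_pullback_cochain])
  fix \<tau> assume \<tau>: "continuous_map (top_of_set triangle) Y \<tau>"
  have e: "cochain_pullback 1 Y f c (path_simplex (\<lambda>t. \<tau> (e t))) = c (path_simplex (\<lambda>t. f (\<tau> (e t))))"
    if "continuous_on {0..1} e" "\<And>t. t \<in> {0..1} \<Longrightarrow> e t \<in> triangle" for e :: "real \<Rightarrow> real \<times> real"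
  proof (rule cochain_pullback_path_simplex)
    have "continuous_map (top_of_set {0..1}) (top_of_set triangle) e" using that by auto
    from continuous_map_compose[OF this \<tau>] show "continuous_map (top_of_set {0..1}) Y (\<lambda>t. \<tau> (e t))"
      by (simp add: o_def)
  qed
  have "continuous_map (top_of_set triangle) X (\<lambda>p. f (\<tau> p))"
    using continuous_map_compose[OF \<tau> f] by (simp add: o_def)
  note tri = cocycle_triangle[OF c this]
  show "cochain_pullback 1 Y f c (path_simplex (\<lambda>t. \<tau> (t, 0))) +
    cochain_pullback 1 Y f c (path_simplex (\<lambda>t. \<tau> (1 - t, t))) =
    cochain_pullback 1 Y f c (path_simplex (\<lambda>t. \<tau> (0, t)))"
    using tri e[of "\<lambda>t. (t, 0)"] e[of "\<lambda>t. (1 - t, t)"] e[of "\<lambda>t. (0, t)"]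
    by (simp add: triangle_def continuous_on_Pair continuous_on_diff)
qed

lemma one_cohomology_group: "\<one>\<^bsub>cohomology_group 1 X\<^esub> = coboundaries 1 X"
  by (simp add: cohomology_group_def FactGroup_def)

lemma coset_coboundary:
  assumes "b \<in> coboundaries 1 X"
  shows "coboundaries 1 X #>\<^bsub>cocycle_group 1 X\<^esub> b = coboundaries 1 X"
proof -
  have "coboundaries 1 X #>\<^bsub>cocycle_group 1 X\<^esub> b = coboundaries 1 X #>\<^bsub>cocycle_group 1 X\<^esub> (\<lambda>\<sigma>. 0)"
    by (rule coset_eqI) (use assms in simp)
  also have "\<dots> = coboundaries 1 X" unfolding coset_cocycle_group by simp
  finally show ?thesis .
qed

lemma class_member_cochain:
  assumes "c \<in> closed_form_class X \<omega>" shows "c \<in> carrier (cochain_group 1 X)"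
proof -
  obtain g where "c = (\<lambda>\<sigma>. coboundary_map 0 X g \<sigma> + closed_form_cocycle X \<omega> \<sigma>)"
    using assms unfolding closed_form_class_def coset_cocycle_group coboundaries_def by auto
  then show ?thesis by (simp add: cochain_group_def coboundary_map_def closed_form_cocycle_def)
qed

text \<open>As \<open>Y\<close> is a retract, the pullback to \<open>Y\<close> vanishes iff the
  pullback along the composite of \<open>power_set k\<close> with itself does, and there axis loops
  detect vanishing.\<close>

lemma cohomology_pullback_retract_zero_iff:
  assumes f: "continuous_map Y (top_of_set (power_set k)) f" and g: "continuous_map (top_of_set (power_set k)) Y g"
    and gf: "\<And>y. y \<in> topspace Y \<Longrightarrow> g (f y) = y"
  shows "cohomology_pullback 1 Y f (closed_form_class (top_of_set (power_set k)) (linear_form k W)) =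
      \<one>\<^bsub>cohomology_group 1 Y\<^esub> \<longleftrightarrow>
    (\<forall>i\<in>{1..k}. \<forall>j<3. closed_form_cocycle (top_of_set (power_set k)) (linear_form k W)
       (path_simplex (\<lambda>t. f (g (axis_loop k i j t)))) = 0)"
    (is "?lhs \<longleftrightarrow> ?rhs")
proof
  let ?X = "top_of_set (power_set k)"
  let ?l = "closed_form_cocycle ?X (linear_form k W)" and ?\<xi> = "closed_form_class ?X (linear_form k W)"
  assume ?lhs
  have "?l \<in> ?\<xi>" unfolding closed_form_class_def by (rule mem_coset)
  then have "cochain_pullback 1 Y f ?l \<in> cohomology_pullback 1 Y f ?\<xi>"
    unfolding cohomology_pullback_def using mem_coset by blast
  then have "cochain_pullback 1 Y f ?l \<in> coboundaries 1 Y"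
    using \<open>?lhs\<close> by (simp only: one_cohomology_group)
  then obtain v where v: "\<And>\<gamma>. continuous_map (top_of_set {0..1}) Y \<gamma> \<Longrightarrow>
      cochain_pullback 1 Y f ?l (path_simplex \<gamma>) = v (\<gamma> 1) - v (\<gamma> 0)"
    by (rule coboundariesE) blast
  show ?rhs
  proof (intro ballI allI impI)
    fix i j :: nat
    have "continuous_map (top_of_set {0..1}) Y (\<lambda>t. g (axis_loop k i j t))"
      using continuous_map_compose[OF continuous_axis_loop g] by (simp add: o_def)
    from v[OF this] cochain_pullback_path_simplex[OF this, of f ?l]
    show "?l (path_simplex (\<lambda>t. f (g (axis_loop k i j t)))) = 0"
      by (simp add: axis_loop_ends)
  qed
next
  let ?X = "top_of_set (power_set k)"
  let ?l = "closed_form_cocycle ?X (linear_form k W)" and ?\<xi> = "closed_form_class ?X (linear_form k W)"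
  assume R: ?rhs
  have fg: "continuous_map ?X ?X (\<lambda>x. f (g x))"
    using continuous_map_compose[OF g f] by (simp add: o_def)
  have "cochain_pullback 1 Y f c \<in> coboundaries 1 Y" if c: "c \<in> ?\<xi>" for c
  proof -
    obtain u where u: "\<And>\<gamma>. continuous_map (top_of_set {0..1}) ?X \<gamma> \<Longrightarrow>
        c (path_simplex \<gamma>) = ?l (path_simplex \<gamma>) + (u (\<gamma> 1) - u (\<gamma> 0))"
      by (rule class_memberE[OF c]) blast
    have cc: "c \<in> carrier (cocycle_group 1 ?X)"
      by (rule coboundaries_cocycle[where u = u, OF class_member_cochain[OF c] linear_form_cocycle[of k W]])
        (rule u)
    let ?d = "cochain_pullback 1 ?X (\<lambda>x. f (g x)) c"
    have "zero_periods k ?d"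
      unfolding zero_periods_def axis_loop_def[symmetric]
    proof (intro ballI allI impI)
      fix i j assume ij: "i \<in> {1..k}" "j < (3::nat)"
      have "continuous_map (top_of_set {0..1}) ?X (\<lambda>t. f (g (axis_loop k i j t)))"
        using continuous_map_compose[OF continuous_axis_loop fg] by (simp add: o_def)
      from u[OF this] have "c (path_simplex (\<lambda>t. f (g (axis_loop k i j t)))) = 0"
        using R ij by (simp add: axis_loop_ends)
      then show "?d (path_simplex (axis_loop k i j)) = 0"
        by (simp only: cochain_pullback_path_simplex[OF continuous_axis_loop])
    qed
    then have "?d \<in> coboundaries 1 ?X"
      by (rule cocycle_zero_periods_exact[OF cochain_pullback_cocycle[OF fg cc]])
    then obtain v where v: "\<And>\<gamma>. continuous_map (top_of_set {0..1}) ?X \<gamma> \<Longrightarrow>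
        ?d (path_simplex \<gamma>) = v (\<gamma> 1) - v (\<gamma> 0)"
      by (rule coboundariesE) blast
    show ?thesis
    proof (rule coboundariesI[OF cochain_pullback_cochain])
      fix \<gamma> :: "real \<Rightarrow> 'a" assume \<gamma>: "continuous_map (top_of_set {0..1}) Y \<gamma>"
      have f\<gamma>: "continuous_map (top_of_set {0..1}) ?X (\<lambda>t. f (\<gamma> t))"
        using continuous_map_compose[OF \<gamma> f] by (simp add: o_def)
      have "path_simplex (\<lambda>t. f (g (f (\<gamma> t)))) = path_simplex (\<lambda>t. f (\<gamma> t))"
        by (rule path_simplex_cong) (use \<gamma> gf in \<open>auto simp: continuous_map_def Pi_iff\<close>)
      then show "cochain_pullback 1 Y f c (path_simplex \<gamma>) = v (f (\<gamma> 1)) - v (f (\<gamma> 0))"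
        using v[OF f\<gamma>] cochain_pullback_path_simplex[OF f\<gamma>, of "\<lambda>x. f (g x)" c]
          cochain_pullback_path_simplex[OF \<gamma>, of f c] by simp
    qed
  qed
  then have "cohomology_pullback 1 Y f ?\<xi> = (\<Union>c\<in>?\<xi>. coboundaries 1 Y)"
    unfolding cohomology_pullback_def by (intro SUP_cong refl coset_coboundary)
  moreover have "?\<xi> \<noteq> {}" unfolding closed_form_class_def using mem_coset by blast
  ultimately show ?lhs by (simp only: one_cohomology_group) simp
qed

lemma p_map_eq: "p_map k i x = assemble k (\<lambda>i' j. if i' = i then crd j x else 1)"
  by (auto simp: p_map_def assemble_def base_point_def crd_def fun_eq_iff)

lemma q_map_eq: "q_map k i z = assemble k (\<lambda>i' j. if i' = i then (if j = 0 then fst z else if j = 1 then snd z else 1) else 1)"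
  by (auto simp: q_map_def p_map_eq torus_inclusion_def crd_def intro!: assemble_cong)

lemma linear_form_constant:
  assumes "\<And>t. \<gamma> t = angles k (\<lambda>i j. 0)"
  shows "closed_form_cocycle (top_of_set (power_set k)) (linear_form k W) (path_simplex \<gamma>) = 0"
proof -
  have "\<gamma> = (\<lambda>_. angles k (\<lambda>i j. 0))" using assms by auto
  then show ?thesis
    using cocycle_constant[OF linear_form_cocycle, of "angles k (\<lambda>i j. 0)" k W]
      angles_in_power_set[OF admissible_zero] by simp
qed

text \<open>The retraction is the projection to factor \<open>i\<close>: the composite fixes the
  axis loops of this factor and makes the others constant.\<close>

lemma p_pullback_zero_iff:
  assumes i: "i \<in> {1..k}"
  shows "p_pullback_zero k i (closed_form_class (top_of_set (power_set k)) (linear_form k W)) \<longleftrightarrow>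
    (\<forall>j<3. W i j = 0)"
proof -
  have f: "continuous_map bouquet (top_of_set (power_set k)) (p_map k i)"
  proof -
    have "continuous_on bouquet_set (p_map k i)"
      unfolding p_map_eq
    proof (rule continuous_on_assemble)
      show "continuous_on bouquet_set (\<lambda>x. if i' = i then crd j x else 1)" for i' j
        by (cases "i' = i") (auto intro: continuous_on_crd continuous_on_id)
    qed
    moreover have "p_map k i x \<in> power_set k" if "x \<in> bouquet_set" for x
      using that unfolding p_map_eq assemble_in_power_set_iff by (auto simp: bouquet_set_def)
    ultimately show ?thesis unfolding bouquet_eq by auto
  qed
  have g: "continuous_map (top_of_set (power_set k)) bouquet (\<lambda>y. y i)"
    unfolding bouquet_eq using i by (auto simp: power_set_def intro: continuous_on_product_then_coordinatewise)
  have gf: "p_map k i y i = y" for y using i by (simp add: p_map_def)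
  have loop: "p_map k i (axis_loop k i' j t i) = (if i' = i then axis_loop k i j t else angles k (\<lambda>i j. 0))"
    for i' j t
    using i by (auto simp: p_map_eq axis_loop_def angles_def intro!: assemble_cong)
  have val: "closed_form_cocycle (top_of_set (power_set k)) (linear_form k W)
      (path_simplex (\<lambda>t. p_map k i (axis_loop k i' j t i))) = (if i' = i then 2 * pi * W i j else 0)"
    if "j < 3" for i' j
    unfolding loop using linear_form_axis_loop[OF i that] by (simp add: linear_form_constant)
  show ?thesis
    unfolding p_pullback_zero_def
    by (subst cohomology_pullback_retract_zero_iff[OF f g gf]) (use i val in auto)
qed

text \<open>The retraction now forgets the circle as well, so only the two torus loops
  survive.\<close>

lemma q_pullback_zero_iff:
  assumes i: "i \<in> {1..k}"
  shows "q_pullback_zero k i (closed_form_class (top_of_set (power_set k)) (linear_form k W)) \<longleftrightarrow>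
    W i 0 = 0 \<and> W i 1 = 0"
proof -
  have torus: "torus = top_of_set (sphere 0 1 \<times> sphere 0 1)"
    by (simp add: torus_def circle_def)
  have f: "continuous_map torus (top_of_set (power_set k)) (q_map k i)"
  proof -
    have "continuous_on (sphere 0 1 \<times> sphere 0 1) (q_map k i)"
      unfolding q_map_eq
    proof (rule continuous_on_assemble)
      show "continuous_on (sphere 0 1 \<times> sphere 0 1)
          (\<lambda>x. if i' = i then (if j = 0 then fst x else if j = 1 then snd x else 1) else 1)" for i' and j :: nat
        by (cases "i' = i"; cases "j = 0"; cases "j = 1")
          (simp_all add: continuous_on_fst continuous_on_snd)
    qed
    moreover have "q_map k i x \<in> power_set k" if "x \<in> sphere 0 1 \<times> sphere 0 1" for x
      using that unfolding q_map_eq assemble_in_power_set_iff by (auto simp: all_less_3)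
    ultimately show ?thesis unfolding torus by auto
  qed
  have g: "continuous_map (top_of_set (power_set k)) torus (\<lambda>y. (crd 0 (y i), crd 1 (y i)))"
  proof -
    have "continuous_on (power_set k) (\<lambda>y. (crd 0 (y i), crd 1 (y i)))"
      by (intro continuous_on_Pair continuous_on_crd_power continuous_on_id)
    then show ?thesis unfolding torus using power_setD(1)[OF _ i, of _ 0] power_setD(1)[OF _ i, of _ 1] by auto
  qed
  have gf: "(crd 0 (q_map k i z i), crd 1 (q_map k i z i)) = z" for z using i by (simp add: q_map_eq)
  have loop: "q_map k i (crd 0 (axis_loop k i' j t i), crd 1 (axis_loop k i' j t i)) =
      (if i' = i \<and> j \<noteq> 2 then axis_loop k i j t else angles k (\<lambda>i j. 0))" for i' j t
    using i by (auto simp: q_map_eq axis_loop_def angles_def intro!: assemble_cong elim!: less_3_cases)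
  have val: "closed_form_cocycle (top_of_set (power_set k)) (linear_form k W)
      (path_simplex (\<lambda>t. q_map k i (crd 0 (axis_loop k i' j t i), crd 1 (axis_loop k i' j t i)))) =
      (if i' = i \<and> j \<noteq> 2 then 2 * pi * W i j else 0)"
    if "j < 3" for i' j
    unfolding loop using linear_form_axis_loop[OF i that]
    by (cases "i' = i \<and> j \<noteq> 2") (auto simp: linear_form_constant)
  show ?thesis
    unfolding q_pullback_zero_def
    by (subst cohomology_pullback_retract_zero_iff[OF f g gf]) (use i val in \<open>auto simp: all_less_3\<close>)
qed

lemma representing_form_approximates:
  assumes "\<xi> \<in> carrier (cohomology_group 1 (bouquet_power k))"
  obtains W K where "approximates k (representing_form (bouquet_power k) \<xi>) W K"
    "\<And>i. i \<in> {1..k} \<Longrightarrow> p_pullback_zero k i \<xi> \<longleftrightarrow> (\<forall>j<3. W i j = 0)"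
    "\<And>i. i \<in> {1..k} \<Longrightarrow> q_pullback_zero k i \<xi> \<longleftrightarrow> W i 0 = 0 \<and> W i 1 = 0"
proof -
  obtain W where W: "closed_form_class (top_of_set (power_set k)) (linear_form k W) = \<xi>"
    by (rule cohomology_class_linear[OF assms[unfolded bouquet_power_eq]])
  let ?\<omega> = "representing_form (bouquet_power k) \<xi>"
  have "?\<omega> \<in> closed_forms (bouquet_power k) \<and> closed_form_class (bouquet_power k) ?\<omega> = \<xi>"
    unfolding representing_form_def bouquet_power_eq
    by (rule someI[of _ "linear_form k W"]) (simp add: W linear_form_in)
  then have \<omega>: "?\<omega> \<in> closed_forms (top_of_set (power_set k))"
    "closed_form_class (top_of_set (power_set k)) ?\<omega> = closed_form_class (top_of_set (power_set k)) (linear_form k W)"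
    by (simp_all add: W bouquet_power_eq)
  obtain K where "approximates k ?\<omega> W K"
    by (rule class_difference_bounded[OF \<omega>])
  then show ?thesis
    by (rule that) (simp_all add: W[symmetric] p_pullback_zero_iff q_pullback_zero_iff)
qed


section \<open>The upper bound\<close>

text \<open>The indices counted by \<open>a(\<xi>)\<close>, those counted by \<open>b(\<xi>)\<close>, and the remaining ones.\<close>

definition torus_free :: "nat \<Rightarrow> (nat \<Rightarrow> nat \<Rightarrow> real) \<Rightarrow> nat set" where
  "torus_free k W = {i \<in> {1..k}. W i 0 = 0 \<and> W i 1 = 0 \<and> W i 2 \<noteq> 0}"

definition all_free :: "nat \<Rightarrow> (nat \<Rightarrow> nat \<Rightarrow> real) \<Rightarrow> nat set" where
  "all_free k W = {i \<in> {1..k}. W i 0 = 0 \<and> W i 1 = 0 \<and> W i 2 = 0}"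

definition torus_active :: "nat \<Rightarrow> (nat \<Rightarrow> nat \<Rightarrow> real) \<Rightarrow> nat set" where
  "torus_active k W = {i \<in> {1..k}. W i 0 \<noteq> 0 \<or> W i 1 \<noteq> 0}"

lemma index_cases:
  assumes "i \<in> {1..k}"
  obtains "i \<in> torus_free k W" | "i \<in> all_free k W" | "i \<in> torus_active k W"
  using assms by (auto simp: torus_free_def all_free_def torus_active_def)

text \<open>On the right half circle \<open>arcsin (Im z)\<close> is the angle of \<open>z\<close>.
  The rotation removes it, and its formula remains continuous on the whole circle.\<close>

lemma collapse_half_circle:
  assumes "norm z = 1" "0 \<le> Re z" shows "z * cis (- arcsin (Im z)) = 1"
proof -
  have sq: "(Re z)\<^sup>2 + (Im z)\<^sup>2 = 1" using assms(1) by (simp add: cmod_def)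
  have im: "\<bar>Im z\<bar> \<le> 1" using abs_Im_le_cmod[of z] assms(1) by simp
  have "cos (arcsin (Im z)) = sqrt (1 - (Im z)\<^sup>2)" using im by (simp add: cos_arcsin)
  also have "1 - (Im z)\<^sup>2 = (Re z)\<^sup>2" using sq by simp
  also have "sqrt ((Re z)\<^sup>2) = Re z" using assms(2) by simp
  finally have "cis (arcsin (Im z)) = z" using im by (simp add: complex_eq_iff)
  then have "z * cis (- arcsin (Im z)) = cis (arcsin (Im z)) * cis (- arcsin (Im z))" by simp
  then show ?thesis by (simp add: cis_mult)
qed

text \<open>
  The homotopy has two stages. On a factor where the class vanishes on the torus but not on the
  circle, the first stage collapses the arcs \<open>Re z \<ge> 0\<close> of both circles of the torus, and
  the second one drags the collapsed points around the circle of the bouquet. On a factor where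
  the class is nonzero on the torus the roles are exchanged: the arc \<open>Re b \<ge> 0\<close> of the circle
  is collapsed, then carried along the linear flow of the torus on which the form decreases.
\<close>

definition rotation :: "(nat \<Rightarrow> nat \<Rightarrow> real) \<Rightarrow> real \<Rightarrow> nat \<Rightarrow> nat \<Rightarrow> real \<Rightarrow> bouquet_point \<Rightarrow> real" where
  "rotation W M i j t p =
    (if W i 0 = 0 \<and> W i 1 = 0
     then if W i 2 = 0 then 0
       else if j = 2 then - (max 0 (2 * t - 1) * (M / W i 2) * (max 0 (Re (crd 0 p)) * max 0 (Re (crd 1 p))))
       else - (min 1 (2 * t) * arcsin (Im (crd j p)))
     else if j = 2 then - (min 1 (2 * t) * arcsin (Im (crd 2 p)))
       else - (max 0 (2 * t - 1) * (M / ((W i 0)\<^sup>2 + (W i 1)\<^sup>2) * W i j) * max 0 (Re (crd 2 p))))"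

definition push :: "nat \<Rightarrow> (nat \<Rightarrow> nat \<Rightarrow> real) \<Rightarrow> real \<Rightarrow> real \<Rightarrow> (nat \<Rightarrow> bouquet_point) \<Rightarrow> nat \<Rightarrow> bouquet_point" where
  "push k W M t y = assemble k (\<lambda>i j. crd j (y i) * cis (rotation W M i j t (y i)))"

lemma Im_crd_bounds:
  assumes "y \<in> power_set k" "i \<in> {1..k}" "j < 3"
  shows "-1 \<le> Im (crd j (y i))" "Im (crd j (y i)) \<le> 1"
  using abs_Im_le_cmod[of "crd j (y i)"] power_setD(1)[OF assms] by auto

lemma continuous_on_rotation:
  assumes "i \<in> {1..k}" "j < 3"
  shows "continuous_on ({0..1::real} \<times> power_set k) (\<lambda>p. rotation W M i j (fst p) (snd p i))"
proof -
  have c: "continuous_on ({0..1::real} \<times> power_set k) (\<lambda>p. crd j (snd p i))" for j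
    by (intro continuous_on_crd_power continuous_on_snd continuous_on_id)
  have a: "continuous_on ({0..1::real} \<times> power_set k) (\<lambda>p. arcsin (Im (crd j (snd p i))))" if "j < 3" for j
    using Im_crd_bounds[OF _ assms(1) that]
    by (intro continuous_on_arcsin continuous_on_Im c) auto
  have m: "continuous_on ({0..1::real} \<times> power_set k) (\<lambda>p. max 0 (Re (crd j (snd p i))))" for j
    by (intro continuous_on_max continuous_on_const continuous_on_Re c)
  have t1: "continuous_on ({0..1::real} \<times> power_set k) (\<lambda>p. min 1 (2 * fst p))"
    by (intro continuous_on_min continuous_on_const continuous_on_mult continuous_on_fst continuous_on_id)
  have t2: "continuous_on ({0..1::real} \<times> power_set k) (\<lambda>p. max 0 (2 * fst p - 1))"
    by (intro continuous_on_max continuous_on_const continuous_on_mult continuous_on_diff continuous_on_fst continuous_on_id)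
  have c1: "continuous_on ({0..1::real} \<times> power_set k) (\<lambda>p. - (max 0 (2 * fst p - 1) * (M / W i 2) *
      (max 0 (Re (crd 0 (snd p i))) * max 0 (Re (crd 1 (snd p i))))))"
    by (intro continuous_on_minus continuous_on_mult t2 m continuous_on_const)
  have c2: "continuous_on ({0..1::real} \<times> power_set k) (\<lambda>p. - (min 1 (2 * fst p) * arcsin (Im (crd j (snd p i)))))"
    if "j < 3" for j
    by (intro continuous_on_minus continuous_on_mult t1 a that)
  have c3: "continuous_on ({0..1::real} \<times> power_set k) (\<lambda>p. - (max 0 (2 * fst p - 1) *
      (M / ((W i 0)\<^sup>2 + (W i 1)\<^sup>2) * W i j) * max 0 (Re (crd 2 (snd p i)))))"
    by (intro continuous_on_minus continuous_on_mult t2 m continuous_on_const)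
  show ?thesis
  proof (cases "W i 0 = 0 \<and> W i 1 = 0")
    case A: True
    consider "W i 2 = 0" | "W i 2 \<noteq> 0" "j = 2" | "W i 2 \<noteq> 0" "j \<noteq> 2" by blast
    then show ?thesis
    proof cases
      case 1
      then show ?thesis using A
        by (intro continuous_on_eq[OF continuous_on_const[of _ 0]]) (simp add: rotation_def)
    next
      case 2
      then show ?thesis using A by (intro continuous_on_eq[OF c1]) (simp add: rotation_def)
    next
      case 3
      then show ?thesis using A by (intro continuous_on_eq[OF c2[OF assms(2)]]) (simp add: rotation_def)
    qed
  next
    case A: False
    show ?thesis
    proof (cases "j = 2")
      case True
      then show ?thesis using A by (intro continuous_on_eq[OF c2[of 2]]) (auto simp: rotation_def)
    next
      case False
      then show ?thesis using A by (intro continuous_on_eq[OF c3]) (auto simp: rotation_def)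
    qed
  qed
qed

lemma rotation_0: "rotation W M i j 0 p = 0"
  by (simp add: rotation_def)

text \<open>Second-stage rotations are nonzero only if \<open>t > 1 / 2\<close> and their cutoff is
  positive; by then the first stage has brought the other part of the factor to 1. First-stage
  rotations leave the coordinate 1 fixed.\<close>

lemma push_in_power_set:
  assumes y: "y \<in> power_set k" and t: "t \<in> {0..1}"
  shows "push k W M t y \<in> power_set k"
  unfolding push_def assemble_in_power_set_iff
proof (intro ballI conjI allI impI)
  fix i assume i: "i \<in> {1..k}"
  show "norm (crd j (y i) * cis (rotation W M i j t (y i))) = 1" if "j < 3" for j
    using power_setD(1)[OF y i that] by (simp add: norm_mult)
  have n: "norm (crd 0 (y i)) = 1" "norm (crd 1 (y i)) = 1" "norm (crd 2 (y i)) = 1"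
    using power_setD(1)[OF y i] by auto
  have half: "t > 1 / 2 \<Longrightarrow> min 1 (2 * t) = 1" by auto
  from power_setD(2)[OF y i]
  show "crd 2 (y i) * cis (rotation W M i 2 t (y i)) = 1 \<or>
    crd 0 (y i) * cis (rotation W M i 0 t (y i)) = 1 \<and>
    crd 1 (y i) * cis (rotation W M i 1 t (y i)) = 1"
  proof
    assume b: "crd 2 (y i) = 1"
    show ?thesis
    proof (cases "W i 0 = 0 \<and> W i 1 = 0 \<and> W i 2 \<noteq> 0 \<and> t > 1 / 2 \<and> Re (crd 0 (y i)) > 0 \<and> Re (crd 1 (y i)) > 0")
      case True
      then have "crd 0 (y i) * cis (rotation W M i 0 t (y i)) = 1"
        "crd 1 (y i) * cis (rotation W M i 1 t (y i)) = 1"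
        using collapse_half_circle[OF n(1)] collapse_half_circle[OF n(2)] half by (simp_all add: rotation_def)
      then show ?thesis by blast
    next
      case False
      then have "rotation W M i 2 t (y i) = 0"
        using b by (auto simp: rotation_def max_def)
      then show ?thesis using b by simp
    qed
  next
    assume zw: "crd 0 (y i) = 1 \<and> crd 1 (y i) = 1"
    show ?thesis
    proof (cases "(W i 0 \<noteq> 0 \<or> W i 1 \<noteq> 0) \<and> t > 1 / 2 \<and> Re (crd 2 (y i)) > 0")
      case True
      then have "crd 2 (y i) * cis (rotation W M i 2 t (y i)) = 1"
        using collapse_half_circle[OF n(3)] half by (auto simp: rotation_def)
      then show ?thesis by blast
    next
      case False
      then have "rotation W M i 0 t (y i) = 0" "rotation W M i 1 t (y i) = 0"
        using zw by (auto simp: rotation_def max_def)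
      then show ?thesis using zw by simp
    qed
  qed
qed

text \<open>The speeds are normalised so that at \<open>t = 1\<close> the second stage contributes
  \<open>- M\<close> times the cutoff. In the first stage collapsed torus arcs have weight 0, and
  collapsing the circle costs at most \<open>\<bar>W i 2\<bar> * pi / 2\<close>, rounded up to
  \<open>2 * \<bar>W i 2\<bar>\<close>. The \<open>1 / 4\<close> bounds the cutoff below in the
  movable region.\<close>

lemma rotation_weight_le:
  assumes y: "y \<in> power_set k" "i \<in> {1..k}" and t: "t \<in> {0..1}" and M: "M \<ge> 0"
  shows "(\<Sum>j<3. W i j * rotation W M i j t (y i)) \<le> 2 * \<bar>W i 2\<bar>"
    and "i \<in> torus_free k W \<Longrightarrow> t = 1 \<Longrightarrow> Re (crd 0 (y i)) > 1 / 2 \<Longrightarrow> Re (crd 1 (y i)) > 1 / 2 \<Longrightarrow>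
      (\<Sum>j<3. W i j * rotation W M i j t (y i)) \<le> 2 * \<bar>W i 2\<bar> - M / 4"
    and "i \<in> torus_active k W \<Longrightarrow> t = 1 \<Longrightarrow> Re (crd 2 (y i)) > 1 / 2 \<Longrightarrow>
      (\<Sum>j<3. W i j * rotation W M i j t (y i)) \<le> 2 * \<bar>W i 2\<bar> - M / 4"
proof -
  let ?S = "\<Sum>j<3. W i j * rotation W M i j t (y i)"
  define lam where "lam = max 0 (Re (crd 0 (y i))) * max 0 (Re (crd 1 (y i)))"
  define mu where "mu = max 0 (Re (crd 2 (y i)))"
  define t2 where "t2 = max 0 (2 * t - 1)"
  have nn: "0 \<le> lam" "0 \<le> mu" "0 \<le> t2" by (auto simp: lam_def mu_def t2_def)
  have as: "\<bar>min 1 (2 * t) * arcsin (Im (crd 2 (y i)))\<bar> \<le> 2"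
  proof -
    have "\<bar>arcsin (Im (crd 2 (y i)))\<bar> \<le> pi / 2"
      using arcsin_bounded[of "Im (crd 2 (y i))"] Im_crd_bounds[OF y, of 2] by linarith
    also have "\<dots> \<le> 2" using pi_less_4 by simp
    finally have "\<bar>min 1 (2 * t)\<bar> * \<bar>arcsin (Im (crd 2 (y i)))\<bar> \<le> 1 * 2"
      using t by (intro mult_mono) auto
    then show ?thesis by (simp add: abs_mult)
  qed
  have free: "?S = - (t2 * M * lam)" if "i \<in> torus_free k W"
    using that by (simp add: torus_free_def sum_less_3 rotation_def lam_def t2_def field_simps)
  have act: "?S \<le> 2 * \<bar>W i 2\<bar> - t2 * M * mu" if "i \<in> torus_active k W"
  proof -
    have nz: "(W i 0)\<^sup>2 + (W i 1)\<^sup>2 \<noteq> 0" "\<not> (W i 0 = 0 \<and> W i 1 = 0)"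
      using that by (auto simp: torus_active_def sum_power2_eq_zero_iff)
    have "?S = - (t2 * (M / ((W i 0)\<^sup>2 + (W i 1)\<^sup>2)) * mu * ((W i 0)\<^sup>2 + (W i 1)\<^sup>2))
        - W i 2 * (min 1 (2 * t) * arcsin (Im (crd 2 (y i))))"
      using nz(2) unfolding sum_less_3 rotation_def mu_def t2_def
      by (simp only: if_False) (simp add: algebra_simps power2_eq_square add_divide_distrib)
    also have "\<dots> = - (t2 * M * mu) - W i 2 * (min 1 (2 * t) * arcsin (Im (crd 2 (y i))))"
      using nz(1) by simp
    also have "\<dots> \<le> - (t2 * M * mu) + \<bar>W i 2\<bar> * 2"
      using mult_left_mono[OF as, of "\<bar>W i 2\<bar>"]
        abs_ge_minus_self[of "W i 2 * (min 1 (2 * t) * arcsin (Im (crd 2 (y i))))"]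
      by (simp add: abs_mult)
    finally show ?thesis by simp
  qed
  have zero: "?S = 0" if "i \<in> all_free k W"
    using that by (simp add: all_free_def sum_less_3)
  show "?S \<le> 2 * \<bar>W i 2\<bar>"
  proof (rule index_cases[OF y(2), of W])
    assume "i \<in> torus_free k W"
    moreover have "0 \<le> t2 * M * lam" using nn M by simp
    ultimately show ?thesis using free by linarith
  next
    assume "i \<in> all_free k W" then show ?thesis using zero by simp
  next
    assume "i \<in> torus_active k W"
    moreover have "0 \<le> t2 * M * mu" using nn M by simp
    ultimately show ?thesis using act by linarith
  qed
  show "?S \<le> 2 * \<bar>W i 2\<bar> - M / 4"
    if "i \<in> torus_free k W" "t = 1" "Re (crd 0 (y i)) > 1 / 2" "Re (crd 1 (y i)) > 1 / 2"
  proof -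
    have "1 / 2 * (1 / 2) \<le> lam" unfolding lam_def using that by (intro mult_mono) auto
    then have "M * (1 / 4) \<le> M * lam" using M by (intro mult_left_mono) auto
    then show ?thesis using free[OF that(1)] that(2) by (simp add: t2_def)
  qed
  show "?S \<le> 2 * \<bar>W i 2\<bar> - M / 4" if "i \<in> torus_active k W" "t = 1" "Re (crd 2 (y i)) > 1 / 2"
  proof -
    have "1 / 4 \<le> mu" unfolding mu_def using that by auto
    then have "M * (1 / 4) \<le> M * mu" using M by (intro mult_left_mono) auto
    then show ?thesis using act[OF that(1)] that(2) by (simp add: t2_def)
  qed
qed

lemma push_integral:
  assumes \<omega>: "approximates k \<omega> W K" and y: "y \<in> power_set k" and t: "t \<in> {0..1}"
  shows "path_integral \<omega> (\<lambda>\<tau>. push k W M (t * \<tau>) y) \<le> angle_sum k W (\<lambda>i j. rotation W M i j t (y i)) + K"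
proof -
  \<comment> \<open>\<open>angle_from 1\<close> enters only as a constant in \<open>\<tau>\<close>,
    so its jump at 1 does no harm.\<close>
  define L where "L i j \<tau> = angle_from 1 (crd j (y i)) + rotation W M i j (t * \<tau>) (y i)" for i j \<tau>
  have t\<tau>: "t * \<tau> \<in> {0..1}" if "\<tau> \<in> {0..1}" for \<tau>
    using t that by (auto intro: mult_le_one)
  have in1: "(\<lambda>\<tau>. (t * \<tau>, y)) ` {0..1} \<subseteq> {0..1} \<times> power_set k"
    using t\<tau> y by auto
  have ct: "continuous_on {0..1} (\<lambda>\<tau>. (t * \<tau>, y))"
    by (intro continuous_on_Pair continuous_on_mult continuous_on_const continuous_on_id)
  have rot: "continuous_on {0..1} (\<lambda>\<tau>. rotation W M i j (t * \<tau>) (y i))" if "i \<in> {1..k}" "j < 3" for i j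
    using continuous_on_compose2[OF continuous_on_rotation[OF that] ct in1, of W M] by simp
  have "continuous_on {0..1} (\<lambda>\<tau>. push k W M (t * \<tau>) y)"
    unfolding push_def using rot
    by (intro continuous_on_assemble continuous_on_mult continuous_on_const continuous_on_cis) auto
  moreover have "\<forall>\<tau>\<in>{0..1}. push k W M (t * \<tau>) y \<in> power_set k"
    using push_in_power_set[OF y] t\<tau> by blast
  moreover have "\<forall>i\<in>{1..k}. \<forall>j<3. continuous_on {0..1} (L i j)"
    unfolding L_def using rot by (auto intro!: continuous_on_add continuous_on_const)
  moreover have "\<forall>i\<in>{1..k}. \<forall>j<3. \<forall>\<tau>\<in>{0..1}. crd j (push k W M (t * \<tau>) y i) = cis (L i j \<tau>)"
    using power_setD(1)[OF y] by (auto simp: push_def L_def cis_angle_from simp flip: cis_mult)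
  ultimately have "\<bar>path_integral \<omega> (\<lambda>\<tau>. push k W M (t * \<tau>) y) - angle_sum k W (\<lambda>i j. L i j 1 - L i j 0)\<bar> \<le> K"
    using \<omega> unfolding approximates_def by blast
  moreover have "angle_sum k W (\<lambda>i j. L i j 1 - L i j 0) = angle_sum k W (\<lambda>i j. rotation W M i j t (y i))"
    by (rule angle_sum_cong) (simp add: L_def rotation_0)
  ultimately show ?thesis by linarith
qed

section \<open>The cover\<close>

lemma avoiding_nullhomotopic:
  "homotopic_with (\<lambda>_. True) (subtopology (top_of_set (power_set k)) (avoiding k (zeta n)))
     (top_of_set (power_set k)) id (\<lambda>_. angles k (\<lambda>i j. 0))"
proof -
  have sub: "subtopology (top_of_set (power_set k)) (avoiding k (zeta n)) = top_of_set (avoiding k (zeta n))"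
    using avoiding_subset[of k "zeta n"] by (simp add: subtopology_subtopology Int_absorb1)
  have "continuous_on ({0..1} \<times> avoiding k (zeta n)) (\<lambda>p. cone_point k (zeta n) (1 - fst p) (snd p))"
    by (rule continuous_on_cone_point)
      (auto intro!: continuous_on_diff continuous_on_const continuous_on_fst continuous_on_snd continuous_on_id)
  moreover have "cone_point k (zeta n) t y \<in> power_set k" if "y \<in> avoiding k (zeta n)" for t y
    using cone_point_in avoiding_subset that by blast
  ultimately have "continuous_map (prod_topology (top_of_set {0..1}) (top_of_set (avoiding k (zeta n))))
      (top_of_set (power_set k)) (\<lambda>p. cone_point k (zeta n) (1 - fst p) (snd p))"
    by (auto simp: prod_topology_subtopology_eu)
  then show ?thesis
    unfolding sub
    by (subst homotopic_with, simp)
      (rule exI[of _ "\<lambda>p. cone_point k (zeta n) (1 - fst p) (snd p)"],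
       use avoiding_subset[of k "zeta n"] in \<open>auto simp: cone_point_0 cone_point_1\<close>)
qed

text \<open>The threshold \<open>1 / 2\<close> lies inside the half circle \<open>Re \<ge> 0\<close>
  that is collapsed, which keeps the cutoffs away from 0, and below the real parts of all
  \<open>zeta n\<close>.\<close>

definition movable_region :: "nat \<Rightarrow> (nat \<Rightarrow> nat \<Rightarrow> real) \<Rightarrow> (nat \<Rightarrow> bouquet_point) set" where
  "movable_region k W = {y \<in> power_set k. \<exists>i\<in>{1..k}.
     i \<in> torus_free k W \<and> Re (crd 0 (y i)) > 1 / 2 \<and> Re (crd 1 (y i)) > 1 / 2 \<or>
     i \<in> torus_active k W \<and> Re (crd 2 (y i)) > 1 / 2}"

lemma openin_movable_region: "openin (top_of_set (power_set k)) (movable_region k W)"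
proof -
  have o: "open {y::nat \<Rightarrow> bouquet_point. Re (crd j (y i)) > 1 / 2}" for i j
    by (intro open_Collect_less continuous_on_const continuous_on_Re continuous_on_crd_power continuous_on_id)
  have "movable_region k W = power_set k \<inter>
    ((\<Union>i\<in>torus_free k W \<inter> {1..k}. {y. Re (crd 0 (y i)) > 1 / 2} \<inter> {y. Re (crd 1 (y i)) > 1 / 2}) \<union>
     (\<Union>i\<in>torus_active k W \<inter> {1..k}. {y. Re (crd 2 (y i)) > 1 / 2}))"
    unfolding movable_region_def by blast
  then show ?thesis using o by (auto intro!: openin_open_Int open_Un open_UN open_Int)
qed

text \<open>At most two coordinates of a bouquet point differ from 1, and if there are two they are
  torus coordinates. If both were some \<open>zeta n\<close> in a \<open>torus_free\<close> factor,
  the point would be movable. In a \<open>torus_active\<close> factor the circle coordinate has real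
  part at most \<open>1 / 2\<close>, so it is no \<open>zeta n\<close> and not 1, which makes the
  torus coordinates 1.\<close>

lemma missed_coordinates_card:
  assumes y: "y \<in> power_set k" "y \<notin> movable_region k W" and i: "i \<in> {1..k}"
  shows "card {j. j < 3 \<and> crd j (y i) \<in> range zeta} \<le>
    (if i \<in> torus_free k W then 1 else 0) + (if i \<in> all_free k W then 2 else 0)"
    (is "card ?J \<le> _")
proof -
  have z: "Re z > 1 / 2" "z \<noteq> 1" if "z \<in> range zeta" for z
    using that Re_zeta zeta_neq_1 by auto
  have b: "crd 2 (y i) = 1 \<or> crd 0 (y i) = 1 \<and> crd 1 (y i) = 1" by (rule power_setD(2)[OF y(1) i])
  have circ: "?J \<subseteq> {2}" if "2 \<in> ?J"
  proof -
    have "crd 0 (y i) = 1" "crd 1 (y i) = 1" using b z(2) that by auto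
    then show ?thesis using z(2) by (auto elim!: less_3_cases)
  qed
  have sub: "?J \<subseteq> {0, 1}" if "2 \<notin> ?J" using that by (auto elim!: less_3_cases)
  have two: "card ?J \<le> 2"
    using circ sub card_mono[of "{2}" ?J] card_mono[of "{0, 1::nat}" ?J] by (cases "2 \<in> ?J") auto
  show ?thesis
  proof (rule index_cases[OF i, of W])
    assume a: "i \<in> torus_free k W"
    have "\<not> (0 \<in> ?J \<and> 1 \<in> ?J)"
    proof
      assume "0 \<in> ?J \<and> 1 \<in> ?J"
      then have "Re (crd 0 (y i)) > 1 / 2" "Re (crd 1 (y i)) > 1 / 2" using z(1) by auto
      then show False using y a i unfolding movable_region_def by blast
    qed
    then have "?J \<subseteq> {0} \<or> ?J \<subseteq> {1} \<or> ?J \<subseteq> {2}"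
      using circ sub by (cases "2 \<in> ?J") blast+
    then have "card ?J \<le> 1" using card_mono[of "{_}" ?J] by force
    then show ?thesis using a by simp
  next
    assume "i \<in> all_free k W" then show ?thesis using two by simp
  next
    assume c: "i \<in> torus_active k W"
    then have r: "\<not> Re (crd 2 (y i)) > 1 / 2" using y i unfolding movable_region_def by blast
    then have "crd 2 (y i) \<noteq> 1" by auto
    then have "crd 0 (y i) = 1" "crd 1 (y i) = 1" using b by auto
    then have "?J = {}" using z r by (auto elim!: less_3_cases)
    then have "card ?J = 0" by (simp only: card.empty)
    then show ?thesis by linarith
  qed
qed

text \<open>Pigeonhole: a point left uncovered has coordinates equal to \<open>?m\<close> distinct
  \<open>zeta n\<close>, at distinct positions, one more than \<open>missed_coordinates_card\<close>
  permits in total.\<close>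

lemma cat_cover_exists:
  "cat_cover (top_of_set (power_set k)) (1 + card (torus_free k W) + 2 * card (all_free k W))
     (movable_region k W) (\<lambda>n. avoiding k (zeta n))"
proof -
  let ?m = "1 + card (torus_free k W) + 2 * card (all_free k W)"
  have "y \<in> movable_region k W \<union> (\<Union>n\<in>{1..?m}. avoiding k (zeta n))" if y: "y \<in> power_set k" for y
  proof (rule ccontr)
    assume n: "y \<notin> movable_region k W \<union> (\<Union>n\<in>{1..?m}. avoiding k (zeta n))"
    let ?J = "\<lambda>i. {j. j < 3 \<and> crd j (y i) \<in> range zeta}"
    have "\<forall>n\<in>{1..?m}. \<exists>p. fst p \<in> {1..k} \<and> snd p < 3 \<and> crd (snd p) (y (fst p)) = zeta n"
      using n y by (fastforce simp: avoiding_def)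
    then obtain p where p: "\<And>n. n \<in> {1..?m} \<Longrightarrow>
        fst (p n) \<in> {1..k} \<and> snd (p n) < 3 \<and> crd (snd (p n)) (y (fst (p n))) = zeta n"
      by metis
    have "inj_on p {1..?m}"
    proof (rule inj_onI)
      fix a b assume ab: "a \<in> {1..?m}" "b \<in> {1..?m}" "p a = p b"
      then have "zeta a = zeta b" using p[of a] p[of b] by metis
      then show "a = b" using inj_zeta by (simp add: inj_eq)
    qed
    then have "?m = card (p ` {1..?m})" by (simp add: card_image)
    also have "\<dots> \<le> card (Sigma {1..k} ?J)"
    proof (rule card_mono)
      show "p ` {1..?m} \<subseteq> Sigma {1..k} ?J"
      proof
        fix q assume "q \<in> p ` {1..?m}"
        then obtain n where n: "n \<in> {1..?m}" "q = p n" by blast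
        then show "q \<in> Sigma {1..k} ?J" using p[OF n(1)] n(2) by (cases "p n") auto
      qed
    qed auto
    also have "\<dots> = (\<Sum>i\<in>{1..k}. card (?J i))" by (simp add: card_SigmaI)
    also have "\<dots> \<le> (\<Sum>i\<in>{1..k}. (if i \<in> torus_free k W then 1 else 0) + (if i \<in> all_free k W then 2 else 0))"
      using n y by (intro sum_mono missed_coordinates_card) auto
    also have "\<dots> = card ({1..k} \<inter> torus_free k W) + 2 * card ({1..k} \<inter> all_free k W)"
      by (simp add: sum.distrib sum.If_cases Int_def)
    also have "{1..k} \<inter> torus_free k W = torus_free k W" by (auto simp: torus_free_def)
    also have "{1..k} \<inter> all_free k W = all_free k W" by (auto simp: all_free_def)
    finally show False by simp
  qed
  then have "power_set k \<subseteq> movable_region k W \<union> (\<Union>n\<in>{1..?m}. avoiding k (zeta n))" by (rule subsetI)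
  moreover have "movable_region k W \<subseteq> power_set k" by (auto simp: movable_region_def)
  ultimately have "movable_region k W \<union> (\<Union>n\<in>{1..?m}. avoiding k (zeta n)) = power_set k"
    using avoiding_subset by (intro subset_antisym Un_least UN_least)
  then show ?thesis
    unfolding cat_cover_def topspace_euclidean_subtopology
    by (intro conjI ballI exI[of _ "angles k (\<lambda>i j. 0)"] openin_movable_region openin_avoiding
        avoiding_nullhomotopic)
qed

lemma ccat_upper_bound:
  assumes \<omega>: "approximates k \<omega> W K"
  shows "\<exists>C>0. \<forall>N>0. \<exists>F G. cat_cover (top_of_set (power_set k)) (1 + card (torus_free k W) + 2 * card (all_free k W)) F G \<and>
    movable_with_control (top_of_set (power_set k)) \<omega> C N F"
proof -
  define C where "C = (\<Sum>i\<in>{1..k}. 2 * \<bar>W i 2\<bar>)"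
  have C0: "0 \<le> C" by (simp add: C_def sum_nonneg)
  have "movable_with_control (top_of_set (power_set k)) \<omega> (C + \<bar>K\<bar> + 1) N (movable_region k W)" if N: "N > 0" for N
  proof -
    let ?F = "movable_region k W"
    \<comment> \<open>A quarter of \<open>M\<close> has to beat the first-stage cost
      \<open>C\<close>, the error \<open>K\<close> and the target \<open>N\<close>; the control
      constant involves only \<open>C\<close> and \<open>K\<close>.\<close>
    define M where "M = 4 * (N + C + \<bar>K\<bar> + 1)"
    have M: "M \<ge> 0" using N C0 by (simp add: M_def)
    have sub: "?F \<subseteq> power_set k" by (auto simp: movable_region_def)
    then have subt: "subtopology (top_of_set (power_set k)) ?F = top_of_set ?F"
      by (simp add: subtopology_subtopology Int_absorb1)
    have ctrl: "path_integral \<omega> (\<lambda>\<tau>. push k W M (t * \<tau>) y) \<le> C + \<bar>K\<bar> + 1" if "y \<in> ?F" "t \<in> {0..1}" for y t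
    proof -
      have y: "y \<in> power_set k" using that sub by blast
      have "angle_sum k W (\<lambda>i j. rotation W M i j t (y i)) \<le> C"
        unfolding angle_sum_def C_def using rotation_weight_le(1)[OF y _ that(2) M] by (intro sum_mono)
      then show ?thesis using push_integral[OF \<omega> y that(2), of M] by linarith
    qed
    have move: "path_integral \<omega> (\<lambda>\<tau>. push k W M \<tau> y) < - N" if yF: "y \<in> ?F" for y
    proof -
      have y: "y \<in> power_set k" using that sub by blast
      obtain i where i: "i \<in> {1..k}"
        "i \<in> torus_free k W \<and> Re (crd 0 (y i)) > 1 / 2 \<and> Re (crd 1 (y i)) > 1 / 2 \<or>
         i \<in> torus_active k W \<and> Re (crd 2 (y i)) > 1 / 2"
      proof -
        have "\<exists>i\<in>{1..k}. i \<in> torus_free k W \<and> Re (crd 0 (y i)) > 1 / 2 \<and> Re (crd 1 (y i)) > 1 / 2 \<or>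
            i \<in> torus_active k W \<and> Re (crd 2 (y i)) > 1 / 2"
          using yF unfolding movable_region_def mem_Collect_eq by (rule conjunct2)
        then show ?thesis by (elim bexE) (rule that, assumption+)
      qed
      let ?S = "\<lambda>i. \<Sum>j<3. W i j * rotation W M i j 1 (y i)"
      have 1: "?S i \<le> 2 * \<bar>W i 2\<bar> - M / 4"
        using i(2) rotation_weight_le(2,3)[OF y i(1) _ M, of 1 W] by auto
      have "angle_sum k W (\<lambda>i j. rotation W M i j 1 (y i)) = ?S i + (\<Sum>i\<in>{1..k} - {i}. ?S i)"
        unfolding angle_sum_def using i(1) by (intro sum.remove) auto
      also have "\<dots> \<le> (2 * \<bar>W i 2\<bar> - M / 4) + (\<Sum>i\<in>{1..k} - {i}. 2 * \<bar>W i 2\<bar>)"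
        using rotation_weight_le(1)[OF y _ _ M, of _ 1 W] by (intro add_mono 1 sum_mono) auto
      also have "\<dots> = C - M / 4"
        unfolding C_def using i(1) sum.remove[of "{1..k}" i "\<lambda>i. 2 * \<bar>W i 2\<bar>"] by simp
      finally have "angle_sum k W (\<lambda>i j. rotation W M i j 1 (y i)) \<le> C - M / 4" .
      then have "path_integral \<omega> (\<lambda>\<tau>. push k W M (1 * \<tau>) y) \<le> C - M / 4 + K"
        using push_integral[OF \<omega> y, of 1 M] by simp
      moreover have "M / 4 = N + C + \<bar>K\<bar> + 1" by (simp add: M_def)
      ultimately show ?thesis by simp
    qed
    have "continuous_on ({0..1} \<times> power_set k) (\<lambda>p. push k W M (fst p) (snd p))"
      unfolding push_def
      by (intro continuous_on_assemble continuous_on_mult continuous_on_cis continuous_on_rotation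
          continuous_on_crd_power continuous_on_snd continuous_on_id)
    then have "continuous_on ({0..1} \<times> ?F) (\<lambda>p. push k W M (fst p) (snd p))"
      by (rule continuous_on_subset) (use sub in auto)
    then have "continuous_map (prod_topology (top_of_set {0..1}) (subtopology (top_of_set (power_set k)) ?F))
        (top_of_set (power_set k)) (\<lambda>p. push k W M (fst p) (snd p))"
      unfolding subt prod_topology_subtopology_eu using push_in_power_set sub by auto
    moreover have "push k W M 0 y = y" if "y \<in> ?F" for y
      using assemble_crd[of y k] that sub by (auto simp: push_def rotation_0)
    ultimately show ?thesis
      unfolding movable_with_control_def using sub ctrl move
      by (intro conjI exI[of _ "\<lambda>p. push k W M (fst p) (snd p)"]) auto
  qed
  then show ?thesis
    using cat_cover_exists C0 by (intro exI[of _ "C + \<bar>K\<bar> + 1"] conjI allI impI exI) auto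
qed


section \<open>Cubes and edge crossings\<close>

definition cube :: "nat \<Rightarrow> real \<Rightarrow> (nat \<Rightarrow> real) set" where
  "cube n M = {y. (\<forall>i<n. \<bar>y i\<bar> \<le> M) \<and> (\<forall>i\<ge>n. y i = 0)}"

lemma compact_cube: "compact (cube n M)"
proof -
  have "cube n M = PiE UNIV (\<lambda>i. if i < n then {-M..M} else {0})"
  proof (intro equalityI subsetI)
    fix y assume y: "y \<in> cube n M"
    show "y \<in> PiE UNIV (\<lambda>i. if i < n then {-M..M} else {0})"
    proof (rule PiE_I)
      show "y i \<in> (if i < n then {-M..M} else {0})" for i
        using y by (cases "i < n") (auto simp: cube_def abs_le_iff minus_le_iff)
    qed simp
  next
    fix y assume "y \<in> PiE UNIV (\<lambda>i. if i < n then {-M..M} else {0})"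
    then have y: "y i \<in> (if i < n then {-M..M} else {0})" for i by (rule PiE_mem) simp
    have "\<bar>y i\<bar> \<le> M" if "i < n" for i using y[of i] that by auto
    moreover have "y i = 0" if "i \<ge> n" for i using y[of i] that by auto
    ultimately show "y \<in> cube n M" by (simp add: cube_def)
  qed
  moreover have "compactin (powertop_real UNIV) (PiE UNIV (\<lambda>i. if i < n then {-M..M} else {0}))"
    by (simp add: compactin_PiE)
  ultimately show ?thesis by (simp add: euclidean_product_topology)
qed

section \<open>Common zeros on a cube\<close>

lemma tendsto_coordinatewise:
  fixes f :: "'a \<Rightarrow> nat \<Rightarrow> real"
  shows "(f \<longlongrightarrow> l) F \<longleftrightarrow> (\<forall>i. ((\<lambda>x. f x i) \<longlongrightarrow> l i) F)"
  using limitin_componentwise[of "\<lambda>_. euclideanreal" UNIV f l F]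
  by (simp add: euclidean_product_topology)

text \<open>Kuhn's lemma gives grid cells of size \<open>2 * M / (m + 1)\<close> in which every
  \<open>g i\<close> is nonpositive at one vertex, \<open>R m i\<close>, and nonnegative at another,
  \<open>S m i\<close>. By compactness the cells accumulate at a common zero.\<close>

lemma poincare_miranda:
  fixes g :: "nat \<Rightarrow> (nat \<Rightarrow> real) \<Rightarrow> real"
  assumes M: "M > 0" and cont: "\<And>i. i < n \<Longrightarrow> continuous_on (cube n M) (g i)"
    and neg: "\<And>i y. i < n \<Longrightarrow> y \<in> cube n M \<Longrightarrow> y i = - M \<Longrightarrow> g i y \<le> 0"
    and pos: "\<And>i y. i < n \<Longrightarrow> y \<in> cube n M \<Longrightarrow> y i = M \<Longrightarrow> 0 \<le> g i y"
  obtains y where "y \<in> cube n M" "\<And>i. i < n \<Longrightarrow> g i y = 0"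
proof -
  define pt where "pt m x = (\<lambda>i. if i < n then - M + 2 * M * (real (x i) / real (Suc m)) else 0)"
    for m :: nat and x :: "nat \<Rightarrow> nat"
  \<comment> \<open>Kuhn's lemma prescribes the labels on opposite faces; there \<open>neg\<close>
    and \<open>pos\<close> make them agree with the weak sign of \<open>g i\<close>.\<close>
  define lab where "lab m x i = (if x i = 0 then 0 else if x i = Suc m then 1
      else if g i (pt m x) \<le> 0 then 0 else 1 :: nat)" for m x i
  have pt_in: "pt m x \<in> cube n M" if "\<forall>i<n. x i \<le> Suc m" for m x
  proof -
    have "\<bar>- M + 2 * M * (real (x i) / real (Suc m))\<bar> \<le> M" if "i < n" for i
    proof -
      have "0 \<le> real (x i) / real (Suc m)" "real (x i) / real (Suc m) \<le> 1"
        using \<open>\<forall>i<n. x i \<le> Suc m\<close> that by (auto simp: divide_le_eq_1)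
      then have "0 \<le> M * (real (x i) / real (Suc m))" "M * (real (x i) / real (Suc m)) \<le> M * 1"
        using M by (intro mult_nonneg_nonneg mult_left_mono; linarith)+
      then show ?thesis by (simp add: abs_le_iff)
    qed
    then show ?thesis by (simp add: cube_def pt_def)
  qed
  have lab0: "g i (pt m x) \<le> 0" if "\<forall>i<n. x i \<le> Suc m" "i < n" "lab m x i = 0" for m x i
  proof (cases "x i = 0")
    case True
    then show ?thesis using neg[OF that(2) pt_in[OF that(1)]] that(2) by (simp add: pt_def)
  next
    case False then show ?thesis using that(3) by (auto simp: lab_def split: if_splits)
  qed
  have lab1: "0 \<le> g i (pt m x)" if "\<forall>i<n. x i \<le> Suc m" "i < n" "lab m x i = 1" for m x i
  proof (cases "x i = Suc m")
    case True
    then have "pt m x i = M" using that(2) by (simp add: pt_def)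
    then show ?thesis using pos[OF that(2) pt_in[OF that(1)]] by simp
  next
    case False then show ?thesis using that(3) by (auto simp: lab_def split: if_splits)
  qed
  have "\<exists>q R S. (\<forall>i<n. q i < Suc m) \<and> (\<forall>i<n. (\<forall>j<n. q j \<le> R i j \<and> R i j \<le> q j + 1) \<and>
      (\<forall>j<n. q j \<le> S i j \<and> S i j \<le> q j + 1) \<and> lab m (R i) i = 0 \<and> lab m (S i) i = 1)" for m
  proof -
    obtain q where q: "\<forall>i<n. q i < Suc m"
      "\<forall>i<n. \<exists>r s. (\<forall>j<n. q j \<le> r j \<and> r j \<le> q j + 1) \<and>
        (\<forall>j<n. q j \<le> s j \<and> s j \<le> q j + 1) \<and> lab m r i \<noteq> lab m s i"
      by (rule kuhn_lemma[of "Suc m" n "lab m"]) (auto simp: lab_def)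
    have l: "lab m x i = 0 \<or> lab m x i = 1" for x i by (simp add: lab_def)
    have "\<exists>r s. (\<forall>j<n. q j \<le> r j \<and> r j \<le> q j + 1) \<and>
        (\<forall>j<n. q j \<le> s j \<and> s j \<le> q j + 1) \<and> lab m r i = 0 \<and> lab m s i = 1" if i: "i < n" for i
    proof -
      obtain r s where rs: "\<forall>j<n. q j \<le> r j \<and> r j \<le> q j + 1"
        "\<forall>j<n. q j \<le> s j \<and> s j \<le> q j + 1" "lab m r i \<noteq> lab m s i"
        using q(2) i by blast
      then consider "lab m r i = 0" "lab m s i = 1" | "lab m s i = 0" "lab m r i = 1"
        using l[of r i] l[of s i] by metis
      then show ?thesis using rs(1,2) by cases blast+
    qed
    then obtain R S where "\<forall>i<n. (\<forall>j<n. q j \<le> R i j \<and> R i j \<le> q j + 1) \<and>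
        (\<forall>j<n. q j \<le> S i j \<and> S i j \<le> q j + 1) \<and> lab m (R i) i = 0 \<and> lab m (S i) i = 1"
      by metis
    then show ?thesis using q(1) by blast
  qed
  then obtain q R S where q: "\<And>m i. i < n \<Longrightarrow> q m i < Suc m"
    and R: "\<And>m i j. i < n \<Longrightarrow> j < n \<Longrightarrow> q m j \<le> R m i j \<and> R m i j \<le> q m j + 1"
    and S: "\<And>m i j. i < n \<Longrightarrow> j < n \<Longrightarrow> q m j \<le> S m i j \<and> S m i j \<le> q m j + 1"
    and lab: "\<And>m i. i < n \<Longrightarrow> lab m (R m i) i = 0 \<and> lab m (S m i) i = 1"
    by metis
  have bound: "\<forall>j<n. x j \<le> Suc m" if "\<And>j. j < n \<Longrightarrow> x j \<le> q m j + 1" for m x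
    using q[of _ m] that by (metis Suc_eq_plus1 Suc_leI le_trans)
  have qc: "\<forall>m. pt m (q m) \<in> cube n M" by (intro allI pt_in bound) simp
  obtain y \<sigma> where y: "y \<in> cube n M" "strict_mono \<sigma>" "((\<lambda>m. pt m (q m)) \<circ> \<sigma>) \<longlonglongrightarrow> y"
    by (rule seq_compactE[OF compact_imp_seq_compact[OF compact_cube] qc])
  have lim: "(\<lambda>m. pt (\<sigma> m) (X (\<sigma> m))) \<longlonglongrightarrow> y"
    if X: "\<And>m j. j < n \<Longrightarrow> q m j \<le> X m j \<and> X m j \<le> q m j + 1" for X
    unfolding tendsto_coordinatewise
  proof
    fix j
    have yj: "(\<lambda>m. pt (\<sigma> m) (q (\<sigma> m)) j) \<longlonglongrightarrow> y j"
      using y(3) unfolding tendsto_coordinatewise o_def by blast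
    have "(\<lambda>m. pt (\<sigma> m) (X (\<sigma> m)) j - pt (\<sigma> m) (q (\<sigma> m)) j) \<longlonglongrightarrow> 0"
    proof (rule tendsto_rabs_zero_cancel, rule tendsto_sandwich[of "\<lambda>_. 0"])
      have "(\<lambda>m. 2 * M * (1 / real (Suc m))) \<longlonglongrightarrow> 2 * M * 0"
        by (intro tendsto_mult tendsto_const LIMSEQ_Suc lim_1_over_n)
      then show "(\<lambda>m. 2 * M * (1 / real (Suc (\<sigma> m)))) \<longlonglongrightarrow> 0"
        using LIMSEQ_subseq_LIMSEQ[OF _ y(2)] by (auto simp: o_def)
      show "\<forall>\<^sub>F m in sequentially. \<bar>pt (\<sigma> m) (X (\<sigma> m)) j - pt (\<sigma> m) (q (\<sigma> m)) j\<bar>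
          \<le> 2 * M * (1 / real (Suc (\<sigma> m)))"
      proof (rule always_eventually, rule allI)
        fix m
        show "\<bar>pt (\<sigma> m) (X (\<sigma> m)) j - pt (\<sigma> m) (q (\<sigma> m)) j\<bar> \<le> 2 * M * (1 / real (Suc (\<sigma> m)))"
        proof (cases "j < n")
          case True
          define w where "w = (real (X (\<sigma> m) j) - real (q (\<sigma> m) j)) / real (Suc (\<sigma> m))"
          have "pt (\<sigma> m) (X (\<sigma> m)) j - pt (\<sigma> m) (q (\<sigma> m)) j = 2 * M * w"
            using True by (simp add: pt_def w_def diff_divide_distrib right_diff_distrib)
          moreover have "\<bar>w\<bar> \<le> 1 / real (Suc (\<sigma> m))"
            using X[OF True, of "\<sigma> m"] unfolding w_def abs_divide by (intro divide_mono) auto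
          then have "2 * M * \<bar>w\<bar> \<le> 2 * M * (1 / real (Suc (\<sigma> m)))"
            using M by (intro mult_left_mono) auto
          ultimately show ?thesis using M by (simp add: abs_mult)
        next
          case False then show ?thesis using M by (simp add: pt_def)
        qed
      qed
    qed auto
    from tendsto_add[OF this yj] show "(\<lambda>m. pt (\<sigma> m) (X (\<sigma> m)) j) \<longlonglongrightarrow> y j" by simp
  qed
  have limg: "(\<lambda>m. g i (pt (\<sigma> m) (X (\<sigma> m)))) \<longlonglongrightarrow> g i y"
    if "i < n" and X: "\<And>m j. j < n \<Longrightarrow> q m j \<le> X m j \<and> X m j \<le> q m j + 1" for X i
    by (rule continuous_on_tendsto_compose[OF cont[OF \<open>i < n\<close>] lim[OF X] y(1)])
      (use X in \<open>auto intro!: always_eventually pt_in bound\<close>)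
  have "g i y = 0" if i: "i < n" for i
  proof (rule antisym)
    show "g i y \<le> 0"
      by (rule LIMSEQ_le_const2[OF limg[OF i, of "\<lambda>m. R m i"]])
        (use R i lab in \<open>auto intro!: lab0 bound\<close>)
    show "0 \<le> g i y"
      by (rule LIMSEQ_le_const[OF limg[OF i, of "\<lambda>m. S m i"]])
        (use S i lab in \<open>auto intro!: lab1 bound\<close>)
  qed
  then show ?thesis using that y(1) by blast
qed

text \<open>The compact shrinkings \<open>C s\<close> will bound lifted homotopies. That some cutoff
  equals 1 at each point lets the function of one cover set appear undamped there.\<close>

lemma open_cover_cutoffs:
  fixes S :: "'a::metric_space set" and U :: "nat \<Rightarrow> 'a set"
  assumes S: "compact S" and U: "\<And>s. s \<le> m \<Longrightarrow> openin (top_of_set S) (U s)" and cov: "S \<subseteq> (\<Union>s\<in>{..m}. U s)"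
  obtains \<psi> C where "\<And>s. s \<le> m \<Longrightarrow> continuous_on S (\<psi> s)" "\<And>s. s \<le> m \<Longrightarrow> compact (C s)"
    "\<And>s. s \<le> m \<Longrightarrow> C s \<subseteq> U s" "\<And>s x. s \<le> m \<Longrightarrow> x \<in> S \<Longrightarrow> x \<notin> C s \<Longrightarrow> \<psi> s x = 0"
    "\<And>s x. s \<le> m \<Longrightarrow> x \<in> S \<Longrightarrow> 0 \<le> \<psi> s x \<and> \<psi> s x \<le> (1::real)"
    "\<And>x. x \<in> S \<Longrightarrow> \<exists>s\<le>m. \<psi> s x = 1"
proof -
  \<comment> \<open>\<open>infdist\<close> to the empty set is 0 by convention, which would lose
    positivity, hence the separate case.\<close>
  define \<delta> where "\<delta> s x = (if S \<subseteq> U s then 1 else infdist x (S - U s))" for s x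
  have nn: "0 \<le> \<delta> s x" for s x by (simp add: \<delta>_def infdist_nonneg)
  have cont: "continuous_on S (\<delta> s)" for s
    by (cases "S \<subseteq> U s") (auto simp: \<delta>_def intro: continuous_on_infdist continuous_on_id)
  have closed: "closed (S - U s)" if "s \<le> m" for s
  proof -
    have "closedin (top_of_set S) (S - U s)"
      using closedin_diff[OF closedin_topspace U[OF that], of ] by (simp add: Diff_eq)
    then show ?thesis using S by (metis closedin_compact compact_imp_closed)
  qed
  have pos: "0 < \<delta> s x" if "s \<le> m" "x \<in> S" "x \<in> U s" for s x
    using that closed[OF that(1)] by (auto simp: \<delta>_def intro: infdist_pos_not_in_closed)
  have zero: "x \<in> U s" if "s \<le> m" "x \<in> S" "0 < \<delta> s x" for s x
  proof (rule ccontr)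
    assume "x \<notin> U s"
    then have "x \<in> S - U s" "\<not> S \<subseteq> U s" using that(2) by auto
    then show False using that(3) by (simp add: \<delta>_def)
  qed
  obtain \<epsilon> where \<epsilon>: "\<epsilon> > 0" "\<And>x. x \<in> S \<Longrightarrow> \<epsilon> \<le> (\<Sum>s\<le>m. \<delta> s x)"
  proof (cases "S = {}")
    case True then show ?thesis using that[of 1] by simp
  next
    case False
    obtain x where x: "x \<in> S" "\<And>y. y \<in> S \<Longrightarrow> (\<Sum>s\<le>m. \<delta> s x) \<le> (\<Sum>s\<le>m. \<delta> s y)"
      using continuous_attains_inf[OF S False, of "\<lambda>x. \<Sum>s\<le>m. \<delta> s x"] cont
      by (auto intro: continuous_on_sum)
    obtain s where s: "s \<le> m" "x \<in> U s" using cov x(1) by auto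
    have "0 < (\<Sum>s\<le>m. \<delta> s x)"
      by (rule sum_pos2[of _ s]) (use s pos[OF s(1) x(1) s(2)] nn in auto)
    then show ?thesis using that x(2) by blast
  qed
  \<comment> \<open>Of the \<open>m + 1\<close> distances with sum at least
    \<open>\<epsilon>\<close>, one is at least \<open>\<eta>\<close>; the cutoff rises from 0 to 1
    between \<open>\<eta> / 2\<close> and \<open>\<eta>\<close>.\<close>
  define \<eta> where "\<eta> = \<epsilon> / real (Suc m)"
  have \<eta>: "\<eta> > 0" using \<epsilon>(1) by (simp add: \<eta>_def)
  define \<psi> where "\<psi> s x = max 0 (min 1 (2 * \<delta> s x / \<eta> - 1))" for s x
  define C where "C s = S \<inter> \<delta> s -` {\<eta> / 2..}" for s
  show ?thesis
  proof (rule that[of \<psi> C])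
    fix s assume s: "s \<le> m"
    show "continuous_on S (\<psi> s)"
      unfolding \<psi>_def using \<eta>
      by (intro continuous_on_max continuous_on_min continuous_on_const continuous_on_diff
          continuous_on_divide continuous_on_mult cont) auto
    have "closedin (top_of_set S) (C s)"
      unfolding C_def by (rule continuous_closedin_preimage[OF cont]) simp
    then show "compact (C s)" using S closedin_compact by blast
    show "C s \<subseteq> U s" using zero[OF s] \<eta> by (force simp: C_def)
    fix x assume x: "x \<in> S"
    show "\<psi> s x = 0" if "x \<notin> C s"
      using that x \<eta> by (simp add: C_def \<psi>_def divide_simps)
    show "0 \<le> \<psi> s x \<and> \<psi> s x \<le> 1" by (simp add: \<psi>_def)
  next
    fix x assume x: "x \<in> S"
    have "\<exists>s\<le>m. \<eta> \<le> \<delta> s x"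
    proof (rule ccontr)
      assume "\<not> ?thesis"
      then have "(\<Sum>s\<le>m. \<delta> s x) < (\<Sum>s\<le>m. \<eta>)" by (intro sum_strict_mono) auto
      also have "\<dots> = \<epsilon>" by (simp add: \<eta>_def)
      finally show False using \<epsilon>(2)[OF x] by simp
    qed
    then obtain s where s: "s \<le> m" "\<eta> \<le> \<delta> s x" by blast
    then have "1 \<le> 2 * \<delta> s x / \<eta> - 1" using \<eta> by (simp add: le_divide_eq)
    then show "\<exists>s\<le>m. \<psi> s x = 1" using s(1) by (auto simp: \<psi>_def intro!: exI[of _ s])
  qed
qed

text \<open>The function is pasted from the closed sets \<open>D\<close> and the zero set of
  \<open>\<psi>\<close>, which cover \<open>Q\<close>.\<close>

lemma continuous_on_cutoff:
  fixes f \<psi> :: "'a::t2_space \<Rightarrow> real"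
  assumes Q: "closed Q" and D: "compact D" "D \<subseteq> Q" and f: "continuous_on D f" and \<psi>: "continuous_on Q \<psi>"
    and zero: "\<And>x. x \<in> Q \<Longrightarrow> x \<notin> D \<Longrightarrow> \<psi> x = 0"
  shows "continuous_on Q (\<lambda>x. if x \<in> D then \<psi> x * f x else 0)"
proof -
  let ?Z = "{x \<in> Q. \<psi> x = 0}"
  have "continuous_on (D \<union> ?Z) (\<lambda>x. if x \<in> D then \<psi> x * f x else 0)"
  proof (rule continuous_on_closed_Un)
    show "closed D" using D(1) by (rule compact_imp_closed)
    show "closed ?Z" using continuous_closed_preimage_constant[OF \<psi> Q] .
    have "continuous_on D (\<lambda>x. \<psi> x * f x)"
      by (intro continuous_on_mult f continuous_on_subset[OF \<psi> D(2)])
    then show "continuous_on D (\<lambda>x. if x \<in> D then \<psi> x * f x else 0)"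
      by (rule continuous_on_eq) simp
    show "continuous_on ?Z (\<lambda>x. if x \<in> D then \<psi> x * f x else 0)"
      by (rule continuous_on_eq[OF continuous_on_const[of _ 0]]) simp
  qed
  moreover have "D \<union> ?Z = Q" using D(2) zero by auto
  ultimately show ?thesis by simp
qed

text \<open>\<open>D\<close> is the displacement that the size of the cube will have to
  beat.\<close>

lemma homotopy_coordinate_lifts:
  fixes h :: "real \<times> (nat \<Rightarrow> bouquet_point) \<Rightarrow> nat \<Rightarrow> bouquet_point"
  assumes C: "compact C" and h: "continuous_on ({0..1} \<times> C) h"
    and in_power: "\<And>p. p \<in> {0..1} \<times> C \<Longrightarrow> h p \<in> power_set k"
    and h0: "\<And>x. x \<in> C \<Longrightarrow> h (0, x) = x"
  obtains \<theta> D where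
    "\<And>i j. i \<in> {1..k} \<Longrightarrow> j < 3 \<Longrightarrow> continuous_on ({0..1} \<times> C) (\<theta> i j)"
    "\<And>i j x. i \<in> {1..k} \<Longrightarrow> j < 3 \<Longrightarrow> x \<in> C \<Longrightarrow> \<theta> i j (0, x) = 0"
    "\<And>i j t x. i \<in> {1..k} \<Longrightarrow> j < 3 \<Longrightarrow> t \<in> {0..1} \<Longrightarrow> x \<in> C \<Longrightarrow>
       crd j (h (t, x) i) = crd j (x i) * cis (\<theta> i j (t, x))"
    "\<And>i j p. i \<in> {1..k} \<Longrightarrow> j < 3 \<Longrightarrow> p \<in> {0..1} \<times> C \<Longrightarrow> \<bar>\<theta> i j p\<bar> \<le> D"
proof -
  have ex: "\<exists>\<theta> B. continuous_on ({0..1} \<times> C) \<theta> \<and> (\<forall>x\<in>C. \<theta> (0, x) = 0) \<and>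
      (\<forall>t\<in>{0..1}. \<forall>x\<in>C. crd j (h (t, x) i) = crd j (x i) * cis (\<theta> (t, x))) \<and>
      (\<forall>p\<in>{0..1} \<times> C. \<bar>\<theta> p\<bar> \<le> B)"
    if ij: "i \<in> {1..k}" "j < 3" for i j
  proof -
    obtain \<theta> where \<theta>: "continuous_on ({0..1} \<times> C) \<theta>" "\<And>x. x \<in> C \<Longrightarrow> \<theta> (0, x) = 0"
      "\<And>t x. t \<in> {0..1} \<Longrightarrow> x \<in> C \<Longrightarrow> crd j (h (t, x) i) = crd j (h (0, x) i) * cis (\<theta> (t, x))"
      using homotopy_angle_lift[OF C continuous_on_crd_power[OF h, of j i] power_setD(1)[OF in_power ij]]
      by metis
    have "compact (\<theta> ` ({0..1} \<times> C))"
      by (intro compact_continuous_image \<theta>(1) compact_Times C) auto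
    then have "bounded (\<theta> ` ({0..1} \<times> C))" by (rule compact_imp_bounded)
    then obtain B where "\<forall>p\<in>{0..1} \<times> C. \<bar>\<theta> p\<bar> \<le> B" unfolding bounded_iff by auto
    then show ?thesis using \<theta> h0 by (intro exI[of _ \<theta>] exI[of _ B]) simp
  qed
  then obtain \<theta> B where
    th: "\<And>i j. i \<in> {1..k} \<Longrightarrow> j < 3 \<Longrightarrow> continuous_on ({0..1} \<times> C) (\<theta> i j) \<and> (\<forall>x\<in>C. \<theta> i j (0, x) = 0) \<and>
      (\<forall>t\<in>{0..1}. \<forall>x\<in>C. crd j (h (t, x) i) = crd j (x i) * cis (\<theta> i j (t, x))) \<and>
      (\<forall>p\<in>{0..1} \<times> C. \<bar>\<theta> i j p\<bar> \<le> B i j)"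
    by metis
  have "\<bar>\<theta> i j p\<bar> \<le> (\<Sum>i\<in>{1..k}. \<Sum>j<3. \<bar>B i j\<bar>)" if "i \<in> {1..k}" "j < 3" "p \<in> {0..1} \<times> C" for i j p
  proof -
    have "\<bar>\<theta> i j p\<bar> \<le> B i j" using th that by blast
    also have "\<dots> \<le> \<bar>B i j\<bar>" by simp
    also have "\<dots> \<le> (\<Sum>j<3. \<bar>B i j\<bar>)" using that by (intro member_le_sum) auto
    also have "\<dots> \<le> (\<Sum>i\<in>{1..k}. \<Sum>j<3. \<bar>B i j\<bar>)"
      using that by (intro member_le_sum) (auto intro: sum_nonneg)
    finally show ?thesis .
  qed
  then show ?thesis using that[of \<theta>] th by blast
qed

definition clamp_angle :: "real \<Rightarrow> real" where
  "clamp_angle x = max 0 (min (2 * pi) x)"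

lemma cis_clamp_angle: "cis x = 1 \<Longrightarrow> cis (clamp_angle x) = 1"
  by (auto simp: clamp_angle_def max_def min_def)

lemma cis_eq_minus_1:
  assumes "cis x = -1" "0 \<le> x" "x \<le> 2 * pi" shows "x = pi"
proof -
  have "cis (x - pi) = 1" using assms(1) by (simp flip: cis_divide)
  moreover have "\<bar>x - pi\<bar> < 2 * pi" using assms(2,3) pi_gt_zero by (simp only: abs_less_iff) linarith
  ultimately have "x - pi = 0" by (rule cis_eq_1_small)
  then show ?thesis by simp
qed

text \<open>
  The lift counts, with signs, the crossings of the edge on which \<open>e\<close> runs from \<open>0\<close> to \<open>2\<pi>\<close> and
  the remaining coordinates, measured by \<open>d\<close>, are trivial. Lifting to the abelian cover first
  and then counting crossings of a single edge there replaces the universal cover.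
\<close>

lemma edge_lift:
  fixes e d :: "real \<times> 'a::metric_space \<Rightarrow> real"
  assumes Q: "compact Q" and e: "continuous_on ({0..1} \<times> Q) e" and d: "continuous_on ({0..1} \<times> Q) d"
    and glue: "\<And>p. p \<in> {0..1} \<times> Q \<Longrightarrow> d p = pi \<Longrightarrow> cis (e p) = 1"
  obtains P where "continuous_on Q P"
    "\<And>y. y \<in> Q \<Longrightarrow> d (0, y) \<le> pi \<or> cis (clamp_angle (e (0, y))) = 1 \<Longrightarrow>
       clamp_angle (e (0, y)) + P y = pi \<Longrightarrow> d (1, y) \<le> pi \<and> e (1, y) = pi"
    "\<And>y. y \<in> Q \<Longrightarrow> (\<And>t. t \<in> {0..1} \<Longrightarrow> d (t, y) > pi \<or> e (t, y) \<le> 0 \<or> 2 * pi \<le> e (t, y)) \<Longrightarrow> P y = 0"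
proof -
  \<comment> \<open>The circle-valued map winds once along the edge and is 1 elsewhere; on
    \<open>d = pi\<close> the two formulas agree by \<open>glue\<close>. It takes the value
    \<open>-1\<close> only at the middle of the edge.\<close>
  define \<phi> where "\<phi> p = (if d p \<le> pi then cis (clamp_angle (e p)) else 1)" for p
  have "continuous_on ({0..1} \<times> Q) \<phi>"
    unfolding \<phi>_def
  proof (rule continuous_on_cases_le[OF _ continuous_on_const d])
    have "continuous_on ({0..1} \<times> Q) (\<lambda>p. cis (clamp_angle (e p)))"
      unfolding clamp_angle_def
      by (intro continuous_on_cis continuous_on_max continuous_on_min continuous_on_const e)
    then show "continuous_on {p \<in> {0..1} \<times> Q. d p \<le> pi} (\<lambda>p. cis (clamp_angle (e p)))"
      by (rule continuous_on_subset) auto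
  qed (use glue cis_clamp_angle in blast)
  moreover have "norm (\<phi> p) = 1" for p by (simp add: \<phi>_def)
  ultimately obtain P where P: "continuous_on ({0..1} \<times> Q) P" "\<And>y. y \<in> Q \<Longrightarrow> P (0, y) = 0"
    "\<And>t y. t \<in> {0..1} \<Longrightarrow> y \<in> Q \<Longrightarrow> \<phi> (t, y) = \<phi> (0, y) * cis (P (t, y))"
    using homotopy_angle_lift[OF Q, of \<phi>] by metis
  have cy: "continuous_on {0..1} (\<lambda>t. P (t, y))" if "y \<in> Q" for y
    by (rule continuous_on_compose2[OF P(1)])
      (use that in \<open>auto intro!: continuous_on_Pair continuous_on_id continuous_on_const\<close>)
  show ?thesis
  proof (rule that[of "\<lambda>y. P (1, y)"])
    show "continuous_on Q (\<lambda>y. P (1, y))"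
      by (rule continuous_on_compose2[OF P(1)])
        (auto intro!: continuous_on_Pair continuous_on_id continuous_on_const)
  next
    fix y assume y: "y \<in> Q" and start: "d (0, y) \<le> pi \<or> cis (clamp_angle (e (0, y))) = 1"
      and mid: "clamp_angle (e (0, y)) + P (1, y) = pi"
    \<comment> \<open>The start condition excludes \<open>d > pi\<close> with
      \<open>0 < e < 2 * pi\<close>, the only place where \<open>\<phi>\<close> is not given by the
      clamped angle.\<close>
    have "\<phi> (0, y) = cis (clamp_angle (e (0, y)))" using start by (auto simp: \<phi>_def)
    then have "\<phi> (1, y) = cis (clamp_angle (e (0, y)) + P (1, y))"
      using P(3)[of 1 y] y by (simp add: cis_mult)
    then have "\<phi> (1, y) = - 1" unfolding mid by simp
    then have 1: "d (1, y) \<le> pi" "cis (clamp_angle (e (1, y))) = -1"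
      by (auto simp: \<phi>_def split: if_splits)
    have "clamp_angle (e (1, y)) = pi"
      by (rule cis_eq_minus_1[OF 1(2)]) (auto simp: clamp_angle_def)
    then have "e (1, y) = pi" using pi_gt_zero by (auto simp: clamp_angle_def max_def min_def split: if_splits)
    then show "d (1, y) \<le> pi \<and> e (1, y) = pi" using 1 by blast
  next
    fix y assume y: "y \<in> Q" and off: "\<And>t. t \<in> {0..1} \<Longrightarrow> d (t, y) > pi \<or> e (t, y) \<le> 0 \<or> 2 * pi \<le> e (t, y)"
    have one: "\<phi> (t, y) = 1" if "t \<in> {0..1}" for t
      using off[OF that] pi_gt_zero by (auto simp: \<phi>_def clamp_angle_def max_def min_def)
    have "cis (P (t, y)) = 1" if "t \<in> {0..1}" for t
      using P(3)[OF that y] one[OF that] one[of 0] by simp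
    then have "P (1, y) = P (0, y)"
      by (intro continuous_cis_1_constant[OF _ cy[OF y]]) auto
    then show "P (1, y) = 0" using P(2)[OF y] by simp
  qed
qed


section \<open>The lower bound\<close>

text \<open>
  Cube coordinates \<open>i\<close> and \<open>k + i\<close> belong to factor \<open>i\<close>. Where the class vanishes on the torus they
  are the two angles of the torus. Otherwise coordinate \<open>i\<close> describes a line which comes up from
  \<open>-\<infinity>\<close> in the torus, runs once around the circle, and goes down again in the torus, while
  coordinate \<open>k + i\<close> is idle, as is coordinate \<open>0\<close>.
\<close>

definition tent :: "real \<Rightarrow> real" where
  "tent s = min s 0 - max (s - 2 * pi) 0"

definition tent_angles :: "nat \<Rightarrow> (nat \<Rightarrow> nat \<Rightarrow> real) \<Rightarrow> (nat \<Rightarrow> real) \<Rightarrow> nat \<Rightarrow> nat \<Rightarrow> real" where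
  "tent_angles k W y i j =
    (if W i 0 = 0 \<and> W i 1 = 0 then if j = 0 then y i else if j = 1 then y (k + i) else 0
     else if j = 2 then clamp_angle (y i) else W i j * tent (y i))"

text \<open>With torus angles \<open>W i j * tent s\<close> the torus part of the primitive is
  \<open>(W i 0)^2 + (W i 1)^2\<close> times \<open>tent s\<close>, so this sign is the upper bound
  for the primitive on cubes of every size.\<close>

lemma tent_nonpos: "tent s \<le> 0"
  by (simp add: tent_def)

text \<open>The torus angles move only while the circle coordinate is 1, which keeps the line in the
  bouquet.\<close>

lemma tent_0_or_clamp: "tent s = 0 \<or> cis (clamp_angle s) = 1"
proof (cases "0 \<le> s \<and> s \<le> 2 * pi")
  case True then show ?thesis by (simp add: tent_def)
next
  case False
  then have "clamp_angle s = 0 \<or> clamp_angle s = 2 * pi" by (auto simp: clamp_angle_def max_def min_def)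
  then show ?thesis by auto
qed

lemma clamp_angle_bounds: "0 \<le> clamp_angle s" "clamp_angle s \<le> 2 * pi"
  by (auto simp: clamp_angle_def)

lemma clamp_angle_idem: "clamp_angle (clamp_angle s) = clamp_angle s"
  by (auto simp: clamp_angle_def)

lemma angles_tent_in_power_set: "angles k (tent_angles k W y) \<in> power_set k"
  unfolding angles_def assemble_in_power_set_iff
proof (intro ballI conjI allI impI)
  fix i
  show "cis (tent_angles k W y i 2) = 1 \<or> cis (tent_angles k W y i 0) = 1 \<and> cis (tent_angles k W y i 1) = 1"
    using tent_0_or_clamp[of "y i"] by (auto simp: tent_angles_def)
qed simp

lemma continuous_on_tent_angles: "continuous_on S (\<lambda>y. tent_angles k W y i j)"
proof -
  have c: "continuous_on S (\<lambda>y. y l)" for l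
    by (rule continuous_on_product_then_coordinatewise[OF continuous_on_id])
  have 1: "continuous_on S (\<lambda>y. clamp_angle (y i))" "continuous_on S (\<lambda>y. W i j * tent (y i))"
    unfolding clamp_angle_def tent_def
    by (intro continuous_on_max continuous_on_min continuous_on_mult continuous_on_diff
        continuous_on_const c)+
  show ?thesis
  proof (cases "W i 0 = 0 \<and> W i 1 = 0")
    case True
    then have "continuous_on S (\<lambda>y. if j = 0 then y i else if j = 1 then y (k + i) else 0)"
      using c by (cases "j = 0"; cases "j = 1") simp_all
    then show ?thesis by (rule continuous_on_eq) (use True in \<open>simp add: tent_angles_def\<close>)
  next
    case False
    then have "continuous_on S (\<lambda>y. if j = 2 then clamp_angle (y i) else W i j * tent (y i))"
      using 1 by (cases "j = 2") simp_all
    then show ?thesis by (rule continuous_on_eq) (simp only: tent_angles_def False if_False)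
  qed
qed

lemma cis_abs_pi:
  assumes "\<bar>x\<bar> = pi" shows "cis x = -1"
proof -
  have "x = pi \<or> x = - pi" using assms by linarith
  then show ?thesis by (auto simp: complex_eq_iff)
qed

text \<open>\<open>N\<close> exceeds every loss possible for a path that ends on the chosen edges:
  at most \<open>pi\<close> in each circle angle, and the error \<open>K\<close>. It does not depend
  on the cover, whereas \<open>D\<close>, \<open>B\<close> and \<open>M\<close> below do.\<close>

lemma no_movable_cover:
  assumes \<omega>: "approximates k \<omega> W K"
    and m: "m \<le> card (torus_free k W) + 2 * card (all_free k W)"
    and N: "N = (\<Sum>i\<in>{1..k}. pi * \<bar>W i 2\<bar>) + \<bar>K\<bar> + 1"
    and cover: "cat_cover (top_of_set (power_set k)) m F G"
    and mov: "movable (top_of_set (power_set k)) \<omega> N F"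
  shows False
proof -
  let ?X = "top_of_set (power_set k)"
  define U where "U s = (if s = 0 then F else G s)" for s
  have U: "openin ?X (U s)" if "s \<le> m" for s
    using cover that by (auto simp: U_def cat_cover_def)
  have "power_set k = F \<union> (\<Union>s\<in>{1..m}. G s)" using cover by (simp add: cat_cover_def)
  also have "\<dots> \<subseteq> (\<Union>s\<in>{..m}. U s)"
  proof (intro Un_least UN_least)
    show "F \<subseteq> (\<Union>s\<in>{..m}. U s)" by (rule UN_upper[of 0, THEN subset_trans[rotated]]) (auto simp: U_def)
    show "G s \<subseteq> (\<Union>s\<in>{..m}. U s)" if "s \<in> {1..m}" for s
      using that by (intro UN_upper[of s "{..m}" U, THEN subset_trans[rotated]]) (auto simp: U_def)
  qed
  finally have cov: "power_set k \<subseteq> (\<Union>s\<in>{..m}. U s)" .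
  \<comment> \<open>On the open sets themselves the homotopies may have unbounded
    displacement.\<close>
  obtain \<psi> C where psi: "\<And>s. s \<le> m \<Longrightarrow> continuous_on (power_set k) (\<psi> s)"
    and C: "\<And>s. s \<le> m \<Longrightarrow> compact (C s)" "\<And>s. s \<le> m \<Longrightarrow> C s \<subseteq> U s"
    and psi0: "\<And>s x. s \<le> m \<Longrightarrow> x \<in> power_set k \<Longrightarrow> x \<notin> C s \<Longrightarrow> \<psi> s x = 0"
    and psi01: "\<And>s x. s \<le> m \<Longrightarrow> x \<in> power_set k \<Longrightarrow> 0 \<le> \<psi> s x \<and> \<psi> s x \<le> (1::real)"
    and psi1: "\<And>x. x \<in> power_set k \<Longrightarrow> \<exists>s\<le>m. \<psi> s x = 1"
    using open_cover_cutoffs[OF compact_power_set U cov] by blast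
  have CP: "C s \<subseteq> power_set k" if "s \<le> m" for s
    using C(2)[OF that] openin_imp_subset[OF U[OF that]] by blast
  have restr: "continuous_on ({0..1::real} \<times> C s) h \<and> (\<forall>p\<in>{0..1} \<times> C s. h p \<in> power_set k)"
    if h: "continuous_map (prod_topology (top_of_set {0..1::real}) (subtopology ?X (U s))) ?X h" and s: "s \<le> m" for s h
  proof -
    have "subtopology ?X (U s) = top_of_set (U s)"
      using openin_imp_subset[OF U[OF s]] by (simp add: subtopology_subtopology Int_absorb1)
    then have 1: "continuous_on ({0..1} \<times> U s) h" "\<And>p. p \<in> {0..1} \<times> U s \<Longrightarrow> h p \<in> power_set k"
      using h by (auto simp: prod_topology_subtopology_eu)
    have "{0..1} \<times> C s \<subseteq> {0..1} \<times> U s" using C(2)[OF s] by auto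
    then show ?thesis using 1 continuous_on_subset[OF 1(1)] by blast
  qed
  obtain h0 where h0: "continuous_map (prod_topology (top_of_set {0..1::real}) (subtopology ?X F)) ?X h0"
    "\<And>x. x \<in> F \<Longrightarrow> h0 (0, x) = x" "\<And>x. x \<in> F \<Longrightarrow> path_integral \<omega> (\<lambda>\<tau>. h0 (\<tau>, x)) < - N"
    using mov unfolding movable_def by blast
  \<comment> \<open>Index 0 is the movable set with its own homotopy, for which \<open>c\<close> is
    arbitrary; the other sets carry null-homotopies ending at \<open>c\<close>.\<close>
  define R where "R s h c \<longleftrightarrow> continuous_on ({0..1} \<times> C s) h \<and> (\<forall>p\<in>{0..1} \<times> C s. h p \<in> power_set k) \<and>
      (\<forall>x\<in>C s. h (0, x) = x) \<and> (s = 0 \<longrightarrow> h = h0) \<and> (s \<noteq> 0 \<longrightarrow> (\<forall>x\<in>C s. h (1, x) = c))" for s h c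
  have "\<exists>h c. R s h c" if s: "s \<le> m" for s
  proof (cases "s = 0")
    case True
    then have "U s = F" by (simp add: U_def)
    then show ?thesis
      unfolding R_def using restr[OF _ s, of h0] h0(1,2) C(2)[OF s] True by (intro exI[of _ h0]) auto
  next
    case False
    then have Us: "U s = G s" "s \<in> {1..m}" using s by (auto simp: U_def)
    have "\<forall>j\<in>{1..m}. \<exists>c. homotopic_with (\<lambda>_. True) (subtopology ?X (G j)) ?X id (\<lambda>_. c)"
      using cover unfolding cat_cover_def by (elim conjE)
    from bspec[OF this Us(2)]
    obtain c where "homotopic_with (\<lambda>_. True) (subtopology ?X (U s)) ?X id (\<lambda>_. c)"
      unfolding Us(1) by (elim exE)
    then have "\<exists>h. continuous_map (prod_topology (top_of_set {0..1::real}) (subtopology ?X (U s))) ?X h \<and>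
        (\<forall>x. h (0, x) = x) \<and> (\<forall>x. h (1, x) = c)"
      by (simp add: homotopic_with_def)
    then obtain h where h: "continuous_map (prod_topology (top_of_set {0..1::real}) (subtopology ?X (U s))) ?X h"
      "\<forall>x. h (0, x) = x" "\<forall>x. h (1, x) = c"
      by (elim exE conjE)
    then show ?thesis
      unfolding R_def using restr[OF h(1) s] False by (intro exI[of _ h] exI[of _ c]) auto
  qed
  then obtain h c where R: "\<And>s. s \<le> m \<Longrightarrow> R s (h s) (c s)" by metis
  have h: "continuous_on ({0..1} \<times> C s) (h s)" "\<And>p. p \<in> {0..1} \<times> C s \<Longrightarrow> h s p \<in> power_set k"
      "\<And>x. x \<in> C s \<Longrightarrow> h s (0, x) = x" "\<And>x. s \<noteq> 0 \<Longrightarrow> x \<in> C s \<Longrightarrow> h s (1, x) = c s"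
    if "s \<le> m" for s
    using R[OF that] unfolding R_def by blast+
  note hc = h(4)
  have h_0: "h 0 = h0" using R[OF le0] unfolding R_def by blast
  have "\<exists>\<theta> D. \<forall>i\<in>{1..k}. \<forall>j<3. continuous_on ({0..1} \<times> C s) (\<theta> i j) \<and> (\<forall>x\<in>C s. \<theta> i j (0, x) = 0) \<and>
      (\<forall>t\<in>{0..1}. \<forall>x\<in>C s. crd j (h s (t, x) i) = crd j (x i) * cis (\<theta> i j (t, x))) \<and>
      (\<forall>p\<in>{0..1} \<times> C s. \<bar>\<theta> i j p\<bar> \<le> (D::real))" if s: "s \<le> m" for s
  proof -
    obtain \<theta> D where
      "\<And>i j. i \<in> {1..k} \<Longrightarrow> j < 3 \<Longrightarrow> continuous_on ({0..1} \<times> C s) (\<theta> i j)"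
      "\<And>i j x. i \<in> {1..k} \<Longrightarrow> j < 3 \<Longrightarrow> x \<in> C s \<Longrightarrow> \<theta> i j (0, x) = 0"
      "\<And>i j t x. i \<in> {1..k} \<Longrightarrow> j < 3 \<Longrightarrow> t \<in> {0..1} \<Longrightarrow> x \<in> C s \<Longrightarrow>
         crd j (h s (t, x) i) = crd j (x i) * cis (\<theta> i j (t, x))"
      "\<And>i j p. i \<in> {1..k} \<Longrightarrow> j < 3 \<Longrightarrow> p \<in> {0..1} \<times> C s \<Longrightarrow> \<bar>\<theta> i j p\<bar> \<le> D"
      using homotopy_coordinate_lifts[OF C(1)[OF s] h(1)[OF s] h(2)[OF s] h(3)[OF s]] by blast
    then show ?thesis by (intro exI[of _ \<theta>] exI[of _ D]) blast
  qed
  then obtain \<theta> D0 where \<theta>0: "\<And>s i j. s \<le> m \<Longrightarrow> i \<in> {1..k} \<Longrightarrow> j < 3 \<Longrightarrow>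
      continuous_on ({0..1} \<times> C s) (\<theta> s i j) \<and> (\<forall>x\<in>C s. \<theta> s i j (0, x) = 0) \<and>
      (\<forall>t\<in>{0..1}. \<forall>x\<in>C s. crd j (h s (t, x) i) = crd j (x i) * cis (\<theta> s i j (t, x))) \<and>
      (\<forall>p\<in>{0..1} \<times> C s. \<bar>\<theta> s i j p\<bar> \<le> (D0 s::real))"
    by metis
  define D where "D = (\<Sum>s\<le>m. \<bar>D0 s\<bar>)"
  have D0: "0 \<le> D" by (simp add: D_def sum_nonneg)
  have \<theta>: "continuous_on ({0..1} \<times> C s) (\<theta> s i j)" "\<And>x. x \<in> C s \<Longrightarrow> \<theta> s i j (0, x) = 0"
    "\<And>t x. t \<in> {0..1} \<Longrightarrow> x \<in> C s \<Longrightarrow> crd j (h s (t, x) i) = crd j (x i) * cis (\<theta> s i j (t, x))"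
    if "s \<le> m" "i \<in> {1..k}" "j < 3" for s i j
    using \<theta>0[OF that] by auto
  have \<theta>D: "\<bar>\<theta> s i j (t, x)\<bar> \<le> D" if "s \<le> m" "i \<in> {1..k}" "j < 3" "t \<in> {0..1}" "x \<in> C s" for s i j t x
  proof -
    have "\<bar>\<theta> s i j (t, x)\<bar> \<le> D0 s" using \<theta>0[OF that(1-3)] that by auto
    also have "\<dots> \<le> \<bar>D0 s\<bar>" by simp
    also have "\<dots> \<le> D" unfolding D_def using that(1) by (intro member_le_sum) auto
    finally show ?thesis .
  qed
  \<comment> \<open>If \<open>\<bar>tent s\<bar> \<ge> B\<close>, every torus angle of nonzero
    weight exceeds \<open>pi + D\<close>. Terms with \<open>W i j = 0\<close> are 0 by the
    convention for division.\<close>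
  define B where "B = (\<Sum>i\<in>{1..k}. \<Sum>j<3. (pi + D + 1) / \<bar>W i j\<bar>)"
  have B: "(pi + D + 1) / \<bar>W i j\<bar> \<le> B" if "i \<in> {1..k}" "j < 3" for i j
  proof -
    have nn: "0 \<le> (pi + D + 1) / \<bar>W i j\<bar>" for i j using D0 pi_gt_zero by simp
    have "(pi + D + 1) / \<bar>W i j\<bar> \<le> (\<Sum>j<3. (pi + D + 1) / \<bar>W i j\<bar>)"
      using that nn by (intro member_le_sum) auto
    also have "\<dots> \<le> B" unfolding B_def using that nn by (intro member_le_sum) (auto intro: sum_nonneg)
    finally show ?thesis .
  qed
  have B0: "0 \<le> B" unfolding B_def using D0 pi_gt_zero by (intro sum_nonneg) simp
  \<comment> \<open>\<open>M\<close> exceeds the shift \<open>D + pi\<close> of a null-homotopy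
    coordinate; it leaves \<open>[0, 2 * pi]\<close> out of reach by \<open>D\<close>; and
    \<open>B\<close> and \<open>2 * pi\<close> send both ends of the bent line deep into the
    torus.\<close>
  define M where "M = 2 * pi + D + B + pi"
  have M: "M > 0" "M \<ge> D + pi" "M \<ge> D + 2 * pi" "M - 2 * pi \<ge> B" "M \<ge> B" "M \<ge> 2 * pi"
    using D0 B0 pi_gt_zero unfolding M_def by linarith+
  \<comment> \<open>The indices in use are \<open>1..2 * k\<close>, so the idle coordinate 0 adds
    one dimension.\<close>
  define n where "n = 2 * k + 1"
  let ?Q = "cube n M"
  define Y where "Y y = angles k (tent_angles k W y)" for y
  have YP: "Y y \<in> power_set k" for y unfolding Y_def by (rule angles_tent_in_power_set)
  have crdY: "crd j (Y y i) = cis (tent_angles k W y i j)" if "i \<in> {1..k}" "j < 3" for i j y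
    using that by (simp add: Y_def)
  have contY: "continuous_on ?Q Y" unfolding Y_def by (intro continuous_on_angles continuous_on_tent_angles)
  define Qs where "Qs s = ?Q \<inter> Y -` C s" for s
  have Qs: "compact (Qs s)" if "s \<le> m" for s
  proof -
    have "closedin (top_of_set ?Q) (Qs s)"
      unfolding Qs_def by (intro continuous_closedin_preimage contY compact_imp_closed C that)
    then show ?thesis using compact_cube closedin_compact by blast
  qed
  have QsC: "Y y \<in> C s" if "y \<in> Qs s" for s y using that by (simp add: Qs_def)
  have QsQ: "Qs s \<subseteq> ?Q" for s by (auto simp: Qs_def)
  \<comment> \<open>Angles along the movable homotopy from \<open>Y y\<close>, that is, its lift to
    the abelian cover starting at the angles given by the cube.\<close>
  define A where "A i j p = tent_angles k W (snd p) i j + \<theta> 0 i j (fst p, Y (snd p))" for i j p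
  have contA: "continuous_on ({0..1} \<times> Qs 0) (A i j)" if "i \<in> {1..k}" "j < 3" for i j
  proof -
    have 1: "continuous_on ({0..1} \<times> Qs 0) (\<lambda>p. tent_angles k W (snd p) i j)"
      by (rule continuous_on_compose2[OF continuous_on_tent_angles[of UNIV]])
        (auto intro!: continuous_on_snd continuous_on_id)
    have "continuous_on ({0..1} \<times> Qs 0) (\<lambda>p. (fst p, Y (snd p)))"
      by (intro continuous_on_Pair continuous_on_fst continuous_on_id
          continuous_on_compose2[OF contY continuous_on_snd[OF continuous_on_id]]) (use QsQ in auto)
    then have "continuous_on ({0..1} \<times> Qs 0) (\<lambda>p. \<theta> 0 i j (fst p, Y (snd p)))"
      by (rule continuous_on_compose2[OF \<theta>(1)[OF le0 that]]) (use QsC in auto)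
    then show ?thesis unfolding A_def by (intro continuous_on_add 1)
  qed
  have A0: "A i j (0, y) = tent_angles k W y i j" if "i \<in> {1..k}" "j < 3" "y \<in> Qs 0" for i j y
    using \<theta>(2)[OF le0 that(1,2) QsC[OF that(3)]] by (simp add: A_def)
  have cisA: "cis (A i j (t, y)) = crd j (h0 (t, Y y) i)" if "i \<in> {1..k}" "j < 3" "t \<in> {0..1}" "y \<in> Qs 0" for i j t y
    using \<theta>(3)[OF le0 that(1-3) QsC[OF that(4)]] crdY[OF that(1,2)] by (simp add: A_def h_0 flip: cis_mult)
  have hP: "h0 (t, Y y) \<in> power_set k" if "t \<in> {0..1}" "y \<in> Qs 0" for t y
    using h(2)[OF le0, of "(t, Y y)"] that QsC by (simp add: h_0)
  have wedge: "cis (A i 2 (t, y)) = 1 \<or> cis (A i 0 (t, y)) = 1 \<and> cis (A i 1 (t, y)) = 1"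
    if "i \<in> {1..k}" "t \<in> {0..1}" "y \<in> Qs 0" for i t y
    using power_setD(2)[OF hP[OF that(2,3)] that(1)] cisA[OF that(1) _ that(2,3)] by simp
  have A_near: "\<bar>A i j (t, y) - tent_angles k W y i j\<bar> \<le> D"
    if "i \<in> {1..k}" "j < 3" "t \<in> {0..1}" "y \<in> Qs 0" for i j t y
    using \<theta>D[OF le0 that(1-3) QsC[OF that(4)]] by (simp add: A_def)
  define act where "act = torus_free k W \<union> torus_active k W"
  have act_k: "i \<in> {1..k}" if "i \<in> act" for i
    using that by (auto simp: act_def torus_free_def torus_active_def)
  \<comment> \<open>Since \<open>P\<close> vanishes on the faces of coordinate \<open>i\<close>,
    \<open>clamp_angle (y i) + P y - pi\<close> has the sign of \<open>y i\<close> there, and its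
    zeros make the homotopy end on the edge.\<close>
  define T where "T i P \<longleftrightarrow> continuous_on (Qs 0) P \<and>
      (\<forall>y\<in>Qs 0. clamp_angle (y i) + P y = pi \<longrightarrow>
         (i \<in> torus_free k W \<longrightarrow> A i 2 (1, y) = 0) \<and>
         (i \<in> torus_active k W \<longrightarrow> A i 0 (1, y) = 0 \<and> A i 1 (1, y) = 0 \<and> A i 2 (1, y) = pi)) \<and>
      (\<forall>y\<in>Qs 0. \<bar>y i\<bar> = M \<longrightarrow> P y = 0)" for i P
  have "\<exists>P. T i P" if i: "i \<in> act" for i
  proof (cases "i \<in> torus_free k W")
    case True
    then have W: "W i 0 = 0" "W i 1 = 0" by (auto simp: torus_free_def)
    have ik: "i \<in> {1..k}" using act_k[OF i] .
    have na: "i \<notin> torus_active k W" using W by (auto simp: torus_active_def)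
    have c: "continuous_on ({0..1} \<times> Qs 0) (A i 0)" "continuous_on ({0..1} \<times> Qs 0) (\<lambda>p. \<bar>A i 2 p\<bar>)"
      using contA[OF ik] by (auto intro: continuous_on_rabs)
    have g: "cis (A i 0 p) = 1" if p: "p \<in> {0..1} \<times> Qs 0" and d: "\<bar>A i 2 p\<bar> = pi" for p
    proof -
      have "cis (A i 2 p) = -1" using d by (rule cis_abs_pi)
      then show ?thesis using wedge[OF ik, of "fst p" "snd p"] p by auto
    qed
    \<comment> \<open>The target is the line \<open>A i 0 = pi\<close> in the torus sheet with
      \<open>A i 2 = 0\<close>; \<open>\<bar>A i 2\<bar> \<le> pi\<close> isolates this sheet
      together with the adjoining half circles.\<close>
    obtain P where P: "continuous_on (Qs 0) P"
      "\<And>y. y \<in> Qs 0 \<Longrightarrow> \<bar>A i 2 (0, y)\<bar> \<le> pi \<or> cis (clamp_angle (A i 0 (0, y))) = 1 \<Longrightarrow>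
         clamp_angle (A i 0 (0, y)) + P y = pi \<Longrightarrow> \<bar>A i 2 (1, y)\<bar> \<le> pi \<and> A i 0 (1, y) = pi"
      "\<And>y. y \<in> Qs 0 \<Longrightarrow> (\<And>t. t \<in> {0..1} \<Longrightarrow> \<bar>A i 2 (t, y)\<bar> > pi \<or> A i 0 (t, y) \<le> 0 \<or> 2 * pi \<le> A i 0 (t, y)) \<Longrightarrow> P y = 0"
      by (rule edge_lift[OF Qs[OF le0] c g]) blast+
    have a: "tent_angles k W y i 0 = y i" "tent_angles k W y i 2 = 0" for y
      using W by (auto simp: tent_angles_def)
    have "A i 2 (1, y) = 0" if y: "y \<in> Qs 0" and mid: "clamp_angle (y i) + P y = pi" for y
    proof -
      have 1: "\<bar>A i 2 (1, y)\<bar> \<le> pi" "A i 0 (1, y) = pi"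
        using P(2)[OF y] mid A0[OF ik _ y] a by auto
      then have "cis (A i 2 (1, y)) = 1" using wedge[OF ik _ y, of 1] by (auto simp: complex_eq_iff)
      then show ?thesis using 1(1) pi_gt_zero by (intro cis_eq_1_small) linarith+
    qed
    moreover have "P y = 0" if y: "y \<in> Qs 0" and yM: "\<bar>y i\<bar> = M" for y
    proof (rule P(3)[OF y])
      fix t :: real assume t: "t \<in> {0..1}"
      \<comment> \<open>A face lies farther out than the displacement, so the angle never enters
        \<open>(0, 2 * pi)\<close>.\<close>
      have "\<bar>A i 0 (t, y) - y i\<bar> \<le> D" using A_near[OF ik _ t y, of 0] a by simp
      then show "\<bar>A i 2 (t, y)\<bar> > pi \<or> A i 0 (t, y) \<le> 0 \<or> 2 * pi \<le> A i 0 (t, y)"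
        using yM M D0 by (cases "y i \<ge> 0") (auto simp: abs_le_iff)
    qed
    ultimately show ?thesis unfolding T_def using P(1) na by blast
  next
    case False
    then have ia: "i \<in> torus_active k W" using i by (simp add: act_def)
    then have W: "\<not> (W i 0 = 0 \<and> W i 1 = 0)" by (auto simp: torus_active_def)
    have ik: "i \<in> {1..k}" using act_k[OF i] .
    \<comment> \<open>The target is the middle of the circle edge over the origin of the torus
      angles; \<open>d \<le> pi\<close> separates it from edges over other lattice points.\<close>
    define d where "d p = max \<bar>A i 0 p\<bar> \<bar>A i 1 p\<bar>" for p
    have c: "continuous_on ({0..1} \<times> Qs 0) (A i 2)" "continuous_on ({0..1} \<times> Qs 0) d"
      unfolding d_def using contA[OF ik] by (auto intro!: continuous_on_max continuous_on_rabs)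
    have g: "cis (A i 2 p) = 1" if p: "p \<in> {0..1} \<times> Qs 0" and dp: "d p = pi" for p
    proof -
      have "\<bar>A i 0 p\<bar> = pi \<or> \<bar>A i 1 p\<bar> = pi" using dp by (auto simp: d_def max_def split: if_splits)
      then have "cis (A i 0 p) = -1 \<or> cis (A i 1 p) = -1"
        using cis_abs_pi by blast
      then show ?thesis using wedge[OF ik, of "fst p" "snd p"] p by auto
    qed
    obtain P where P: "continuous_on (Qs 0) P"
      "\<And>y. y \<in> Qs 0 \<Longrightarrow> d (0, y) \<le> pi \<or> cis (clamp_angle (A i 2 (0, y))) = 1 \<Longrightarrow>
         clamp_angle (A i 2 (0, y)) + P y = pi \<Longrightarrow> d (1, y) \<le> pi \<and> A i 2 (1, y) = pi"
      "\<And>y. y \<in> Qs 0 \<Longrightarrow> (\<And>t. t \<in> {0..1} \<Longrightarrow> d (t, y) > pi \<or> A i 2 (t, y) \<le> 0 \<or> 2 * pi \<le> A i 2 (t, y)) \<Longrightarrow> P y = 0"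
      by (rule edge_lift[OF Qs[OF le0] c g]) blast+
    have a: "tent_angles k W y i 0 = W i 0 * tent (y i)" "tent_angles k W y i 1 = W i 1 * tent (y i)"
      "tent_angles k W y i 2 = clamp_angle (y i)" for y
      using W by (auto simp: tent_angles_def)
    have "A i 0 (1, y) = 0 \<and> A i 1 (1, y) = 0 \<and> A i 2 (1, y) = pi"
      if y: "y \<in> Qs 0" and mid: "clamp_angle (y i) + P y = pi" for y
    proof -
      have e0: "A i 2 (0, y) = clamp_angle (y i)" using A0[OF ik _ y] a by simp
      have "d (0, y) \<le> pi \<or> cis (clamp_angle (A i 2 (0, y))) = 1"
        using tent_0_or_clamp[of "y i"] A0[OF ik _ y] a by (auto simp: d_def e0 clamp_angle_idem)
      then have 1: "d (1, y) \<le> pi" "A i 2 (1, y) = pi"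
        using P(2)[OF y] mid by (auto simp: e0 clamp_angle_idem)
      then have 2: "cis (A i 0 (1, y)) = 1" "cis (A i 1 (1, y)) = 1"
        using wedge[OF ik _ y, of 1] by (auto simp: complex_eq_iff)
      have "\<bar>A i 0 (1, y)\<bar> \<le> pi" "\<bar>A i 1 (1, y)\<bar> \<le> pi" using 1(1) by (auto simp: d_def)
      then have 3: "\<bar>A i 0 (1, y)\<bar> < 2 * pi" "\<bar>A i 1 (1, y)\<bar> < 2 * pi" using pi_gt_zero by linarith+
      show ?thesis
        using cis_eq_1_small[OF 2(1) 3(1)] cis_eq_1_small[OF 2(2) 3(2)] 1(2) by blast
    qed
    moreover have "P y = 0" if y: "y \<in> Qs 0" and yM: "\<bar>y i\<bar> = M" for y
    proof (rule P(3)[OF y])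
      fix t :: real assume t: "t \<in> {0..1}"
      \<comment> \<open>On a face the start is so deep in the torus that the homotopy cannot return
        to the edge over the origin.\<close>
      have far: "\<bar>A i j (t, y)\<bar> > pi" if j: "j < 3" "j \<noteq> 2" and Wj: "W i j \<noteq> 0" for j
      proof -
        have "tent (y i) \<le> - B"
          using yM M(4,5) pi_gt_zero unfolding tent_def by linarith
        then have "\<bar>tent (y i)\<bar> \<ge> B" by linarith
        then have "(pi + D + 1) / \<bar>W i j\<bar> \<le> \<bar>tent (y i)\<bar>" using B[OF ik j(1)] by linarith
        then have "pi + D + 1 \<le> \<bar>W i j * tent (y i)\<bar>"
          using Wj by (simp add: abs_mult divide_le_eq mult.commute)
        moreover have "tent_angles k W y i j = W i j * tent (y i)" using W j by (auto simp: tent_angles_def)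
        ultimately show ?thesis using A_near[OF ik j(1) t y] by linarith
      qed
      have "d (t, y) > pi" using W far[of 0] far[of 1] by (auto simp: d_def less_max_iff_disj)
      then show "d (t, y) > pi \<or> A i 2 (t, y) \<le> 0 \<or> 2 * pi \<le> A i 2 (t, y)" by blast
    qed
    ultimately show ?thesis unfolding T_def using P(1) False by blast
  qed
  then obtain P where T: "\<And>i. i \<in> act \<Longrightarrow> T i (P i)" by metis
  have P: "continuous_on (Qs 0) (P i)"
    "\<And>y. i \<in> torus_free k W \<Longrightarrow> y \<in> Qs 0 \<Longrightarrow> clamp_angle (y i) + P i y = pi \<Longrightarrow> A i 2 (1, y) = 0"
    "\<And>y. i \<in> torus_active k W \<Longrightarrow> y \<in> Qs 0 \<Longrightarrow> clamp_angle (y i) + P i y = pi \<Longrightarrow>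
       A i 0 (1, y) = 0 \<and> A i 1 (1, y) = 0 \<and> A i 2 (1, y) = pi"
    "\<And>y. y \<in> Qs 0 \<Longrightarrow> \<bar>y i\<bar> = M \<Longrightarrow> P i y = 0" if "i \<in> act" for i
    using T[OF that] unfolding T_def by blast+
  \<comment> \<open>Coordinates left to the null-homotopic sets: both torus angles where the class
    vanishes on the factor, and the second one where it is nonzero on the circle only; the first one
    there belongs to the movable set.\<close>
  define J where "J = all_free k W \<union> (\<lambda>i. k + i) ` (torus_free k W \<union> all_free k W)"
  have fin: "finite (torus_free k W)" "finite (all_free k W)" by (auto simp: torus_free_def all_free_def)
  have "card J = card (torus_free k W) + 2 * card (all_free k W)"
  proof -
    have "card J = card (all_free k W) + card ((\<lambda>i. k + i) ` (torus_free k W \<union> all_free k W))"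
      unfolding J_def by (rule card_Un_disjoint) (use fin in \<open>auto simp: torus_free_def all_free_def\<close>)
    also have "card ((\<lambda>i. k + i) ` (torus_free k W \<union> all_free k W)) = card (torus_free k W \<union> all_free k W)"
      by (intro card_image) simp
    also have "\<dots> = card (torus_free k W) + card (all_free k W)"
      by (rule card_Un_disjoint) (use fin in \<open>auto simp: torus_free_def all_free_def\<close>)
    finally show ?thesis by simp
  qed
  moreover have "finite J" using fin by (simp add: J_def)
  ultimately obtain r where r: "bij_betw r J {1..card (torus_free k W) + 2 * card (all_free k W)}"
    by (metis card_atLeastAtMost diff_Suc_1 finite_atLeastAtMost finite_same_card_bij)
  define ix where "ix d = (if d \<le> k then d else d - k)" for d
  define jx where "jx d = (if d \<le> k then 0 else 1::nat)" for d
  have JW: "ix d \<in> {1..k} \<and> jx d < 3 \<and> tent_angles k W y (ix d) (jx d) = y d" if "d \<in> J" for d y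
    using that by (auto simp: J_def ix_def jx_def torus_free_def all_free_def tent_angles_def)
  \<comment> \<open>The angle opposite to the constant end of the null-homotopy. A zero of
    \<open>g d\<close> at full cutoff would make the end equal to its own antipode.\<close>
  define e where "e d = Arg (- crd (jx d) (c (r d) (ix d)))" for d
  define sh where "sh d y = (if y \<in> Qs (r d) then \<psi> (r d) (Y y) * (\<theta> (r d) (ix d) (jx d) (1, Y y) - e d) else 0)" for d y
  \<comment> \<open>Idle coordinates, and those of \<open>J\<close> left over when \<open>m\<close>
    is smaller than \<open>card J\<close>, keep the plain function \<open>y d\<close>.\<close>
  define g where "g d y = (if d \<in> act then clamp_angle (y d) - pi + (if y \<in> Qs 0 then \<psi> 0 (Y y) * P d y else 0)
     else if d \<in> J \<and> r d \<le> m then y d + sh d y else y d)" for d y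
  have actJ: "act \<inter> J = {}"
    by (auto simp: act_def J_def torus_free_def all_free_def torus_active_def)
  have cutoff: "continuous_on ?Q (\<lambda>y. if y \<in> Qs s then \<psi> s (Y y) * f y else 0)"
    if s: "s \<le> m" and f: "continuous_on (Qs s) f" for s f
  proof (rule continuous_on_cutoff[OF compact_imp_closed[OF compact_cube] Qs[OF s] QsQ f])
    show "continuous_on ?Q (\<lambda>y. \<psi> s (Y y))"
      by (rule continuous_on_compose2[OF psi[OF s] contY]) (use YP in auto)
    show "\<psi> s (Y y) = 0" if "y \<in> ?Q" "y \<notin> Qs s" for y
      using that by (intro psi0[OF s YP]) (simp add: Qs_def)
  qed
  have coord: "continuous_on ?Q (\<lambda>y. y d)" for d
    by (rule continuous_on_product_then_coordinatewise[OF continuous_on_id])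
  have contg: "continuous_on ?Q (g d)" for d
  proof -
    consider "d \<in> act" | "d \<notin> act" "d \<in> J \<and> r d \<le> m" | "d \<notin> act" "\<not> (d \<in> J \<and> r d \<le> m)" by blast
    then show ?thesis
    proof cases
      case 1
      have "continuous_on ?Q (\<lambda>y. clamp_angle (y d) - pi + (if y \<in> Qs 0 then \<psi> 0 (Y y) * P d y else 0))"
        unfolding clamp_angle_def
        by (intro continuous_on_add continuous_on_diff continuous_on_max continuous_on_min continuous_on_const
            coord cutoff P(1)[OF 1] le0)
      then show ?thesis by (rule continuous_on_eq) (simp add: g_def 1)
    next
      case 2
      then have d: "ix d \<in> {1..k}" "jx d < 3" "r d \<le> m" using JW by auto
      have "continuous_on (Qs (r d)) (\<lambda>y. (1::real, Y y))"
        by (intro continuous_on_Pair continuous_on_const continuous_on_subset[OF contY QsQ])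
      then have "continuous_on (Qs (r d)) (\<lambda>y. \<theta> (r d) (ix d) (jx d) (1, Y y))"
        by (rule continuous_on_compose2[OF \<theta>(1)[OF d(3,1,2)]]) (use QsC in auto)
      then have "continuous_on ?Q (\<lambda>y. y d + sh d y)"
        unfolding sh_def by (intro continuous_on_add coord cutoff d continuous_on_diff continuous_on_const)
      then show ?thesis by (rule continuous_on_eq) (simp add: g_def 2)
    next
      case 3
      show ?thesis by (rule continuous_on_eq[OF coord[of d]]) (use 3 in \<open>auto simp: g_def\<close>)
    qed
  qed
  have sh_small: "\<bar>sh d y\<bar> \<le> M" if "d \<in> J" "r d \<le> m" for d y
  proof (cases "y \<in> Qs (r d)")
    case True
    have d: "ix d \<in> {1..k}" "jx d < 3" using JW[OF that(1)] by auto
    have "\<bar>\<theta> (r d) (ix d) (jx d) (1, Y y)\<bar> \<le> D"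
      using \<theta>D[OF that(2) d, of 1 "Y y"] QsC[OF True] by simp
    moreover have "\<bar>e d\<bar> \<le> pi"
      using Arg_bounded[of "- crd (jx d) (c (r d) (ix d))"] by (simp add: e_def abs_le_iff)
    ultimately have "\<bar>\<theta> (r d) (ix d) (jx d) (1, Y y) - e d\<bar> \<le> M" using M(2) by linarith
    moreover have "\<bar>\<psi> (r d) (Y y)\<bar> \<le> 1" using psi01[OF that(2) YP, of y] by simp
    ultimately have "\<bar>\<psi> (r d) (Y y)\<bar> * \<bar>\<theta> (r d) (ix d) (jx d) (1, Y y) - e d\<bar> \<le> 1 * M"
      by (intro mult_mono) auto
    then show ?thesis using True by (simp add: sh_def abs_mult)
  next
    case False then show ?thesis using M(1) by (simp add: sh_def)
  qed
  have face: "g d y * y d \<ge> 0" if yM: "\<bar>y d\<bar> = M" for d y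
  proof -
    consider "d \<in> act" | "d \<notin> act" "d \<in> J \<and> r d \<le> m" | "d \<notin> act" "\<not> (d \<in> J \<and> r d \<le> m)" by blast
    then show ?thesis
    proof cases
      case 1
      then have "g d y = clamp_angle (y d) - pi" using P(4)[of d y, OF 1 _ yM] by (simp add: g_def)
      moreover have "clamp_angle (y d) = (if y d \<ge> 0 then 2 * pi else 0)"
        using yM M(6) by (auto simp: clamp_angle_def)
      ultimately show ?thesis
        by (cases "y d \<ge> 0") (auto intro!: mult_nonneg_nonneg mult_nonneg_nonpos)
    next
      case 2
      then have "g d y = y d + sh d y" "\<bar>sh d y\<bar> \<le> \<bar>y d\<bar>" using sh_small[of d y] yM by (auto simp: g_def)
      then show ?thesis
        by (cases "y d \<ge> 0") (auto intro!: mult_nonneg_nonneg mult_nonpos_nonpos)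
    next
      case 3
      then have "g d y = y d" by (auto simp: g_def)
      then show ?thesis by simp
    qed
  qed
  obtain y where y: "y \<in> ?Q" "\<And>d. d < n \<Longrightarrow> g d y = 0"
  proof (rule poincare_miranda[OF M(1), of n g])
    show "g i y \<le> 0" if "y i = - M" for i y
      using face[of y i] that M(1) by (simp add: mult_le_0_iff)
    show "0 \<le> g i y" if "y i = M" for i y
      using face[of y i] that M(1) by (simp add: zero_le_mult_iff)
  qed (use contg in auto)
  obtain s where s: "s \<le> m" "\<psi> s (Y y) = 1" using psi1[OF YP] by blast
  then have YC: "Y y \<in> C s" using psi0[OF s(1) YP, of y] by fastforce
  then have yQ: "y \<in> Qs s" using y(1) by (simp add: Qs_def)
  show False
  proof (cases "s = 0")
    case False
    then have "s \<in> r ` J" using r s(1) m by (auto simp: bij_betw_def)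
    then obtain d where d: "d \<in> J" "r d = s" by blast
    note dx = JW[OF d(1), of y]
    have "d < n" using d(1) by (auto simp: J_def n_def torus_free_def all_free_def)
    moreover have "d \<notin> act" using d(1) actJ by blast
    ultimately have "y d + (\<theta> s (ix d) (jx d) (1, Y y) - e d) = 0"
      using y(2)[of d] d s yQ by (simp add: g_def sh_def)
    then have eq: "y d + \<theta> s (ix d) (jx d) (1, Y y) = e d" by simp
    let ?z = "crd (jx d) (c s (ix d))"
    have c: "h s (1, Y y) = c s" using hc[OF s(1) False YC] .
    have "c s \<in> power_set k" using h(2)[OF s(1), of "(1, Y y)"] YC c by simp
    then have z: "norm ?z = 1" using power_setD(1)[of "c s" k "ix d" "jx d"] dx by blast
    have "?z = crd (jx d) (Y y (ix d)) * cis (\<theta> s (ix d) (jx d) (1, Y y))"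
      using \<theta>(3)[of s "ix d" "jx d" 1 "Y y"] s(1) dx YC c by simp
    also have "\<dots> = cis (y d + \<theta> s (ix d) (jx d) (1, Y y))"
      using crdY[of "ix d" "jx d" y] dx by (simp add: cis_mult)
    also have "\<dots> = - ?z"
    proof -
      have "- ?z \<noteq> 0" using z by auto
      from cis_Arg[OF this] show ?thesis unfolding eq e_def d(2) using z by (simp add: sgn_eq)
    qed
    finally have "?z = 0" by simp
    then show False using z by simp
  next
    case True
    have yQ0: "y \<in> Qs 0" and psi1: "\<psi> 0 (Y y) = 1" using yQ s True by auto
    have mid: "clamp_angle (y i) + P i y = pi" if "i \<in> act" for i
    proof -
      have "i < n" using act_k[OF that] by (simp add: n_def)
      then show ?thesis using y(2)[of i] that yQ0 psi1 by (simp add: g_def)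
    qed
    have YF: "Y y \<in> F" using QsC[OF yQ0] C(2)[OF le0] by (auto simp: U_def)
    let ?\<gamma> = "\<lambda>\<tau>. h0 (\<tau>, Y y)"
    have c1: "continuous_on {0..1} (\<lambda>\<tau>. (\<tau>, z))" for z :: "'z::topological_space"
      by (intro continuous_on_Pair continuous_on_id continuous_on_const)
    have "continuous_on {0..1} ?\<gamma>"
      using continuous_on_compose2[OF h(1)[OF le0] c1[of "Y y"]] QsC[OF yQ0] by (auto simp: h_0)
    moreover have "\<forall>\<tau>\<in>{0..1}. ?\<gamma> \<tau> \<in> power_set k" using hP yQ0 by blast
    moreover have "\<forall>i\<in>{1..k}. \<forall>j<3. continuous_on {0..1} (\<lambda>\<tau>. A i j (\<tau>, y))"
    proof (intro ballI allI impI)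
      show "continuous_on {0..1} (\<lambda>\<tau>. A i j (\<tau>, y))" if "i \<in> {1..k}" "j < 3" for i j
        by (rule continuous_on_compose2[OF contA[OF that] c1[of y]]) (use yQ0 in auto)
    qed
    moreover have "\<forall>i\<in>{1..k}. \<forall>j<3. \<forall>\<tau>\<in>{0..1}. crd j (?\<gamma> \<tau> i) = cis (A i j (\<tau>, y))"
      using cisA yQ0 by simp
    ultimately have approx: "\<bar>path_integral \<omega> ?\<gamma> - angle_sum k W (\<lambda>i j. A i j (1, y) - A i j (0, y))\<bar> \<le> K"
      using \<omega>[unfolded approximates_def, rule_format, of ?\<gamma> "\<lambda>i j \<tau>. A i j (\<tau>, y)"] by blast
    \<comment> \<open>In an active torus the weighted angles rise from nonpositive values to 0, and
      the circle angle goes from \<open>[0, 2 * pi]\<close> to \<open>pi\<close>. In the other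
      factors no angle of nonzero weight changes.\<close>
    have "(\<Sum>i\<in>{1..k}. - (pi * \<bar>W i 2\<bar>)) \<le> angle_sum k W (\<lambda>i j. A i j (1, y) - A i j (0, y))"
      unfolding angle_sum_def
    proof (rule sum_mono)
      fix i assume i: "i \<in> {1..k}"
      note start = A0[OF i _ yQ0]
      show "- (pi * \<bar>W i 2\<bar>) \<le> (\<Sum>j<3. W i j * (A i j (1, y) - A i j (0, y)))"
      proof (rule index_cases[OF i, of W])
        assume a: "i \<in> torus_free k W"
        then have "A i 2 (1, y) = 0" using P(2)[of i, OF _ a yQ0 mid] by (simp add: act_def)
        then show ?thesis using a start[of 2] by (simp add: sum_less_3 torus_free_def tent_angles_def)
      next
        assume "i \<in> all_free k W" then show ?thesis by (simp add: sum_less_3 all_free_def)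
      next
        assume a: "i \<in> torus_active k W"
        then have W: "\<not> (W i 0 = 0 \<and> W i 1 = 0)" by (auto simp: torus_active_def)
        have ia: "i \<in> act" using a by (simp add: act_def)
        have fin: "A i 0 (1, y) = 0" "A i 1 (1, y) = 0" "A i 2 (1, y) = pi"
          using P(3)[of i y, OF ia a yQ0 mid[OF ia]] by auto
        have st: "A i 0 (0, y) = W i 0 * tent (y i)" "A i 1 (0, y) = W i 1 * tent (y i)"
          "A i 2 (0, y) = clamp_angle (y i)"
          using start W by (auto simp: tent_angles_def)
        have "\<bar>W i 2 * (pi - clamp_angle (y i))\<bar> \<le> \<bar>W i 2\<bar> * pi"
          unfolding abs_mult using clamp_angle_bounds[of "y i"] by (intro mult_left_mono) auto
        moreover have "W i 0 * (W i 0 * tent (y i)) \<le> 0" "W i 1 * (W i 1 * tent (y i)) \<le> 0"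
          using tent_nonpos[of "y i"] by (simp_all add: mult_nonneg_nonpos flip: mult.assoc)
        ultimately show ?thesis unfolding sum_less_3 fin st by (simp add: mult.commute)
      qed
    qed
    then have "- (\<Sum>i\<in>{1..k}. pi * \<bar>W i 2\<bar>) - K \<le> path_integral \<omega> ?\<gamma>"
      using approx unfolding sum_negf by linarith
    then show False using h0(3)[OF YF] N by linarith
  qed
qed


lemma movable_with_control_imp_movable: "movable_with_control X \<omega> C N A \<Longrightarrow> movable X \<omega> N A"
  unfolding movable_with_control_def movable_def by blast

theorem theorem18:
  fixes k :: nat
    and \<xi> :: "(((nat \<Rightarrow> real) \<Rightarrow> nat \<Rightarrow> bouquet_point) \<Rightarrow> real) set"
  assumes "k \<ge> 1"
    and "\<xi> \<in> carrier (cohomology_group 1 (bouquet_power k))"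
  shows "cat (bouquet_power k) \<xi> = ccat (bouquet_power k) \<xi> \<and>
         ccat (bouquet_power k) \<xi> = 1 + a_number k \<xi> + 2 * b_number k \<xi>"
proof -
  let ?X = "bouquet_power k" and ?\<omega> = "representing_form (bouquet_power k) \<xi>"
  obtain W K where W: "approximates k ?\<omega> W K"
    "\<And>i. i \<in> {1..k} \<Longrightarrow> p_pullback_zero k i \<xi> \<longleftrightarrow> (\<forall>j<3. W i j = 0)"
    "\<And>i. i \<in> {1..k} \<Longrightarrow> q_pullback_zero k i \<xi> \<longleftrightarrow> W i 0 = 0 \<and> W i 1 = 0"
    by (rule representing_form_approximates[OF assms(2)]) blast
  define n where "n = 1 + card (torus_free k W) + 2 * card (all_free k W)"
  have "{i \<in> {1..k}. \<not> p_pullback_zero k i \<xi> \<and> q_pullback_zero k i \<xi>} = torus_free k W"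
    "{i \<in> {1..k}. p_pullback_zero k i \<xi>} = all_free k W"
    using W(2,3) unfolding torus_free_def all_free_def all_less_3 by blast+
  then have n: "n = 1 + a_number k \<xi> + 2 * b_number k \<xi>"
    by (simp only: n_def a_number_def b_number_def)
  \<comment> \<open>These are the predicates under the two minima. \<open>R n\<close>, the passage
    from \<open>R\<close> to \<open>Q\<close>, and the lower bound for \<open>Q\<close> determine
    both minima at once.\<close>
  define Q where "Q m \<longleftrightarrow> (\<forall>N>0. \<exists>F G. cat_cover ?X m F G \<and> movable ?X ?\<omega> N F)" for m
  define R where "R m \<longleftrightarrow> (\<exists>C>0. \<forall>N>0. \<exists>F G. cat_cover ?X m F G \<and> movable_with_control ?X ?\<omega> C N F)" for m
  have R: "R n" using ccat_upper_bound[OF W(1)] unfolding R_def n_def bouquet_power_eq .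
  have RQ: "Q m" if "R m" for m
    using that movable_with_control_imp_movable unfolding R_def Q_def by meson
  have Qn: "n \<le> m" if "Q m" for m
  proof (rule ccontr)
    assume "\<not> n \<le> m"
    then have m: "m \<le> card (torus_free k W) + 2 * card (all_free k W)" by (simp add: n_def)
    define N where "N = (\<Sum>i\<in>{1..k}. pi * \<bar>W i 2\<bar>) + \<bar>K\<bar> + 1"
    have "0 \<le> (\<Sum>i\<in>{1..k}. pi * \<bar>W i 2\<bar>)" by (intro sum_nonneg) simp
    then have "N > 0" by (simp add: N_def)
    then obtain F G where "cat_cover ?X m F G" "movable ?X ?\<omega> N F"
      using \<open>Q m\<close> unfolding Q_def by blast
    then show False
      using no_movable_cover[OF W(1) m N_def] unfolding bouquet_power_eq by blast
  qed
  have "cat ?X \<xi> = n"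
    unfolding cat_def cat_form_def Q_def[symmetric] by (rule Least_equality[of Q n]) (use R RQ Qn in blast)+
  moreover have "ccat ?X \<xi> = n"
    unfolding ccat_def ccat_form_def R_def[symmetric] by (rule Least_equality[of R n]) (use R RQ Qn in blast)+
  ultimately show ?thesis by (simp only: n)
qed


end
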